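(* Let $\mathbb{K}$ be a field of characteristic zero, let $k\leq n$ be positive integers, let $\lambda\vdash n$, $\mu\vdash k$ with $\mu\subset\lambda$, and let $T$ be a Young tableau of shape $\lambda$ with entries $1,\dots,n$ whose Young subtableau $S$ of shape $\mu$ has set of entries $[k]=\{1,\dots,k\}$. Let $\mathcal{S}$ be the set of Young tableaux $S'$ of some shape $\delta\vdash k$ with $\delta\subset\lambda$, with set of entries $[k]$, which dominate $S$. Then \[\mathfrak{c}_\lambda(T)\in\mathscr{I}\big(\mathfrak{c}_\delta(S'):S'\in\mathcal{S}\big),\] where $\delta$ denotes the shape of $S'$.
   Context: Permutations are multiplied by composition. A Young tableau of shape $\lambda$ is a bijection from $D_\lambda=\{(i,j):1\leq j\leq\lambda_i\}$ to its set of entries, drawn as left-justified rows; the Young subtableau of shape $\mu\subset\lambda$ is its restriction to $D_\mu$; $R_i$, $C_j$ denote rows and columns. For a set $X$, $\mathfrak{a}(X)=\sum_{\sigma\in\mathfrak{S}_X}\sigma$, $\mathfrak{b}(X)=\sum_{\tau\in\mathfrak{S}_X}\mathrm{sgn}(\tau)\tau$, and the Young symmetrizer is $\mathfrak{c}_\lambda(T)=\prod_i\mathfrak{a}(R_i(T))\cdot\prod_j\mathfrak{b}(C_j(T))$; for a tableau with entries $[m]$ it lies in $\mathbb{K}[\mathfrak{S}_m]$. The generic tensor algebra is $\mathscr{T}=\bigoplus_{m\geq0}\mathbb{K}[\mathfrak{S}_m]$ with product defined on permutations $\sigma\in\mathfrak{S}_m$, $\tau\in\mathfrak{S}_p$ by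 $\sigma*\tau\in\mathfrak{S}_{m+p}$, $(\sigma*\tau)(i)=\sigma(i)$ for $i\leq m$ and $(\sigma*\tau)(i)=m+\tau(i-m)$ for $m<i\leq m+p$, extended bilinearly. A homogeneous invariant right ideal $\mathscr{I}=\bigoplus_m\mathscr{I}_m$ is a homogeneous right ideal of $\mathscr{T}$ such that each $\mathscr{I}_m$ is a left ideal of $\mathbb{K}[\mathfrak{S}_m]$; for $A\subset\mathscr{T}$, $\mathscr{I}(A)$ is the smallest homogeneous invariant right ideal containing $A$. For Young tableaux $S,S'$ with set of entries $[k]$, $S'$ dominates $S$ if for every $i\in[k]$, the column index $j$ of $S$ containing $i$ and the column index $j'$ of $S'$ containing $i$ satisfy $j\geq j'$. *)

theory Defs
  imports "HOL-Combinatorics.Permutations" "HOL-Library.Poly_Mapping" "HOL-Library.FuncSet"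
begin

section \<open>Group algebras of symmetric groups\<close>

text \<open>
  Permutations of a finite set \<open>X\<close> of naturals are total functions with
  \<open>\<sigma> permutes X\<close>, hence the identity outside \<open>X\<close>; in this way \<open>S\<^sub>X\<close> sits inside \<open>S\<^sub>m\<close>
  whenever \<open>X \<subseteq> {1..m}\<close>.  Elements of all the group algebras \<open>K[S\<^sub>m]\<close> live in one type and
  are told apart by the carrier \<open>sym_alg m\<close>.
\<close>

type_synonym 'a perm_comb = "(nat \<Rightarrow> nat) \<Rightarrow>\<^sub>0 'a"

definition sym_alg :: "nat \<Rightarrow> ('a::field) perm_comb set" where
  "sym_alg m = {f. \<forall>\<sigma>\<in>Poly_Mapping.keys f. \<sigma> permutes {1..m}}"

definition bilinear_ext :: "('b \<Rightarrow> 'c \<Rightarrow> 'd) \<Rightarrow> ('b \<Rightarrow>\<^sub>0 'a) \<Rightarrow> ('c \<Rightarrow>\<^sub>0 'a) \<Rightarrow> ('d \<Rightarrow>\<^sub>0 'a::field)" where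
  "bilinear_ext h f g =
     (\<Sum>\<sigma>\<in>Poly_Mapping.keys f. \<Sum>\<tau>\<in>Poly_Mapping.keys g.
        Poly_Mapping.single (h \<sigma> \<tau>) (Poly_Mapping.lookup f \<sigma> * Poly_Mapping.lookup g \<tau>))"

definition sym_mult :: "('a::field) perm_comb \<Rightarrow> 'a perm_comb \<Rightarrow> 'a perm_comb" (infixl \<open>\<cdot>\<^sub>S\<close> 70) where
  "f \<cdot>\<^sub>S g = bilinear_ext (\<circ>) f g"

definition sym_one :: "('a::field) perm_comb" where
  "sym_one = Poly_Mapping.single id 1"

definition sym_prod_list :: "('a::field) perm_comb list \<Rightarrow> 'a perm_comb" where
  "sym_prod_list fs = foldr (\<cdot>\<^sub>S) fs sym_one"

definition symmetrizer :: "nat set \<Rightarrow> ('a::field) perm_comb" (\<open>\<aa>\<close>) where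
  "\<aa> X = (\<Sum>\<sigma> | \<sigma> permutes X. Poly_Mapping.single \<sigma> 1)"

definition antisymmetrizer :: "nat set \<Rightarrow> ('a::field) perm_comb" (\<open>\<bb>\<close>) where
  "\<bb> X = (\<Sum>\<tau> | \<tau> permutes X. Poly_Mapping.single \<tau> (of_int (sign \<tau>)))"


section \<open>Partitions, Young tableaux and Young symmetrizers\<close>

definition partition_of :: "nat list \<Rightarrow> nat \<Rightarrow> bool" (infix \<open>\<turnstile>\<close> 50) where
  "lam \<turnstile> n \<longleftrightarrow> sorted_wrt (\<ge>) lam \<and> (\<forall>a\<in>set lam. 0 < a) \<and> sum_list lam = n"

text \<open>Parts are numbered from \<open>1\<close>, and there are infinitely many trailing zero parts.\<close>

definition part :: "nat list \<Rightarrow> nat \<Rightarrow> nat" where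
  "part lam i = (if 1 \<le> i \<and> i \<le> length lam then lam ! (i - 1) else 0)"

definition shape_contained :: "nat list \<Rightarrow> nat list \<Rightarrow> bool" where
  "shape_contained \<mu> lam \<longleftrightarrow> (\<forall>i\<ge>1. part \<mu> i \<le> part lam i)"

definition diagram :: "nat list \<Rightarrow> (nat \<times> nat) set" where
  "diagram lam = {(i, j). 1 \<le> i \<and> 1 \<le> j \<and> j \<le> part lam i}"

text \<open>Only the values of a tableau on its diagram are meaningful.\<close>

type_synonym tableau = "nat \<times> nat \<Rightarrow> nat"

definition young_tableau :: "nat list \<Rightarrow> nat set \<Rightarrow> tableau \<Rightarrow> bool" where
  "young_tableau lam E T \<longleftrightarrow> bij_betw T (diagram lam) E"

definition subtableau :: "nat list \<Rightarrow> tableau \<Rightarrow> tableau" where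
  "subtableau \<mu> T = restrict T (diagram \<mu>)"

definition tab_row :: "nat list \<Rightarrow> tableau \<Rightarrow> nat \<Rightarrow> nat set" where
  "tab_row lam T i = {T (i, j) |j. (i, j) \<in> diagram lam}"

definition tab_column :: "nat list \<Rightarrow> tableau \<Rightarrow> nat \<Rightarrow> nat set" where
  "tab_column lam T j = {T (i, j) |i. (i, j) \<in> diagram lam}"

text \<open>
  The row factors commute among themselves because the rows are disjoint, and likewise the column
  factors, so the order in which the lists are multiplied is immaterial.
\<close>

definition young_symmetrizer :: "nat list \<Rightarrow> tableau \<Rightarrow> ('a::field) perm_comb" (\<open>\<cc>\<close>) where
  "\<cc> lam T =
     sym_prod_list (map (\<lambda>i. \<aa> (tab_row lam T i)) [1..<length lam + 1]) \<cdot>\<^sub>S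
     sym_prod_list (map (\<lambda>j. \<bb> (tab_column lam T j)) [1..<part lam 1 + 1])"

definition dominates :: "nat \<Rightarrow> nat list \<Rightarrow> tableau \<Rightarrow> nat list \<Rightarrow> tableau \<Rightarrow> bool" where
  "dominates k \<delta> S' \<mu> S \<longleftrightarrow>
     (\<forall>i\<in>{1..k}. \<forall>j j'. i \<in> tab_column \<mu> S j \<longrightarrow> i \<in> tab_column \<delta> S' j' \<longrightarrow> j \<ge> j')"


section \<open>The generic tensor algebra\<close>

text \<open>
  An element of \<open>\<Oplus>\<^sub>m K[S\<^sub>m]\<close> is a finitely supported family; \<open>Poly_Mapping.single m f\<close> is
  \<open>f \<in> K[S\<^sub>m]\<close> placed in degree \<open>m\<close>.
\<close>

type_synonym 'a perm_family = "nat \<Rightarrow>\<^sub>0 'a perm_comb"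

definition gta :: "('a::field) perm_family set" where
  "gta = {x. \<forall>m. Poly_Mapping.lookup x m \<in> sym_alg m}"

definition perm_concat :: "nat \<Rightarrow> (nat \<Rightarrow> nat) \<Rightarrow> (nat \<Rightarrow> nat) \<Rightarrow> (nat \<Rightarrow> nat)" where
  "perm_concat m \<sigma> \<tau> = (\<lambda>i. if i \<le> m then \<sigma> i else m + \<tau> (i - m))"

definition gta_mult :: "('a::field) perm_family \<Rightarrow> 'a perm_family \<Rightarrow> 'a perm_family" (infixl \<open>\<star>\<close> 70) where
  "x \<star> y =
     (\<Sum>m\<in>Poly_Mapping.keys x. \<Sum>p\<in>Poly_Mapping.keys y.
        Poly_Mapping.single (m + p)
          (bilinear_ext (perm_concat m) (Poly_Mapping.lookup x m) (Poly_Mapping.lookup y p)))"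

definition right_ideal :: "('a::field) perm_family set \<Rightarrow> bool" where
  "right_ideal I \<longleftrightarrow> I \<subseteq> gta \<and> 0 \<in> I \<and> (\<forall>x\<in>I. \<forall>y\<in>I. x + y \<in> I) \<and> (\<forall>x\<in>I. - x \<in> I) \<and>
     (\<forall>x\<in>I. \<forall>y\<in>gta. x \<star> y \<in> I)"

definition homogeneous :: "('a::field) perm_family set \<Rightarrow> bool" where
  "homogeneous I \<longleftrightarrow> (\<forall>x\<in>I. \<forall>m. Poly_Mapping.single m (Poly_Mapping.lookup x m) \<in> I)"

definition degree_part :: "('a::field) perm_family set \<Rightarrow> nat \<Rightarrow> 'a perm_comb set" where
  "degree_part I m = {f \<in> sym_alg m. Poly_Mapping.single m f \<in> I}"

definition sym_left_ideal :: "nat \<Rightarrow> ('a::field) perm_comb set \<Rightarrow> bool" where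
  "sym_left_ideal m J \<longleftrightarrow> J \<subseteq> sym_alg m \<and> 0 \<in> J \<and> (\<forall>f\<in>J. \<forall>g\<in>J. f + g \<in> J) \<and> (\<forall>f\<in>J. - f \<in> J) \<and>
     (\<forall>f\<in>J. \<forall>g\<in>sym_alg m. g \<cdot>\<^sub>S f \<in> J)"

definition invariant_right_ideal :: "('a::field) perm_family set \<Rightarrow> bool" where
  "invariant_right_ideal I \<longleftrightarrow>
     right_ideal I \<and> homogeneous I \<and> (\<forall>m. sym_left_ideal m (degree_part I m))"

definition generated_ideal :: "('a::field) perm_family set \<Rightarrow> 'a perm_family set" (\<open>\<I>\<close>) where
  "\<I> A = \<Inter> {I. invariant_right_ideal I \<and> A \<subseteq> I}"


section \<open>Basic facts\<close>

lemma bilinear_ext_single [simp]: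
  "bilinear_ext h (Poly_Mapping.single \<sigma> a) (Poly_Mapping.single \<tau> b) =
     Poly_Mapping.single (h \<sigma> \<tau>) (a * b :: 'a::field)"
  by (auto simp: bilinear_ext_def)

lemma gta_mult_single:
  "Poly_Mapping.single m (Poly_Mapping.single \<sigma> a) \<star> Poly_Mapping.single p (Poly_Mapping.single \<tau> b) =
     Poly_Mapping.single (m + p) (Poly_Mapping.single (perm_concat m \<sigma> \<tau>) (a * b :: 'a::field))"
proof (cases "a = 0 \<or> b = 0")
  case True
  then show ?thesis by (auto simp: gta_mult_def)
next
  case False
  then have "Poly_Mapping.single \<sigma> a \<noteq> 0" "Poly_Mapping.single \<tau> b \<noteq> 0"
    by (metis lookup_single_eq lookup_zero)+
  then show ?thesis by (simp add: gta_mult_def)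
qed

lemma perm_concat_permutes:
  assumes \<sigma>: "\<sigma> permutes {1..m}" and \<tau>: "\<tau> permutes {1..p}"
  shows "perm_concat m \<sigma> \<tau> permutes {1..m + p}"
proof (rule bij_imp_permutes)
  have \<sigma>_le: "\<sigma> i \<le> m" if "i \<le> m" for i
    using permutes_in_image[OF \<sigma>, of i] permutes_not_in[OF \<sigma>, of i] that by (cases "i \<in> {1..m}") auto
  have \<sigma>_pos: "1 \<le> \<sigma> i" if "1 \<le> i" "i \<le> m" for i
    using permutes_in_image[OF \<sigma>, of i] that by auto
  have \<tau>_in: "\<tau> i \<in> {1..p}" if "i \<in> {1..p}" for i
    using permutes_in_image[OF \<tau>, of i] that by auto
  have \<tau>_pos: "0 < \<tau> i" if "0 < i" for i
    using permutes_in_image[OF \<tau>, of i] permutes_not_in[OF \<tau>, of i] that by (cases "i \<in> {1..p}") auto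
  have inj: "inj (perm_concat m \<sigma> \<tau>)"
  proof (rule injI)
    fix x y assume eq: "perm_concat m \<sigma> \<tau> x = perm_concat m \<sigma> \<tau> y"
    show "x = y"
    proof (cases "x \<le> m"; cases "y \<le> m")
      assume "x \<le> m" "y \<le> m"
      with eq show ?thesis using permutes_inj[OF \<sigma>] by (auto simp: perm_concat_def inj_eq)
    next
      assume "x \<le> m" "\<not> y \<le> m"
      with eq \<sigma>_le[of x] \<tau>_pos[of "y - m"] show ?thesis by (auto simp: perm_concat_def)
    next
      assume "\<not> x \<le> m" "y \<le> m"
      with eq \<sigma>_le[of y] \<tau>_pos[of "x - m"] show ?thesis by (auto simp: perm_concat_def)
    next
      assume *: "\<not> x \<le> m" "\<not> y \<le> m"
      with eq have "x - m = y - m" using permutes_inj[OF \<tau>] by (auto simp: perm_concat_def inj_eq)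
      with * show ?thesis by simp
    qed
  qed
  have sub: "perm_concat m \<sigma> \<tau> ` {1..m + p} \<subseteq> {1..m + p}"
  proof
    fix y assume "y \<in> perm_concat m \<sigma> \<tau> ` {1..m + p}"
    then obtain x where x: "x \<in> {1..m + p}" "y = perm_concat m \<sigma> \<tau> x" by auto
    show "y \<in> {1..m + p}"
    proof (cases "x \<le> m")
      case True
      then show ?thesis using x \<sigma>_le[of x] \<sigma>_pos[of x] by (auto simp: perm_concat_def)
    next
      case False
      then have "x - m \<in> {1..p}" using x by auto
      then have "\<tau> (x - m) \<in> {1..p}" by (rule \<tau>_in)
      then show ?thesis using False x by (auto simp: perm_concat_def)
    qed
  qed
  have inj': "inj_on (perm_concat m \<sigma> \<tau>) {1..m + p}"
    using inj by (rule inj_on_subset) simp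
  have "perm_concat m \<sigma> \<tau> ` {1..m + p} = {1..m + p}"
    using endo_inj_surj[OF _ sub inj'] by simp
  with inj' show "bij_betw (perm_concat m \<sigma> \<tau>) {1..m + p} {1..m + p}"
    by (simp add: bij_betw_def)
next
  fix x assume x: "x \<notin> {1..m + p}"
  show "perm_concat m \<sigma> \<tau> x = x"
  proof (cases "x \<le> m")
    case True
    then show ?thesis using x permutes_not_in[OF \<sigma>, of x] by (auto simp: perm_concat_def)
  next
    case False
    then have "x - m \<notin> {1..p}" using x by auto
    then have "\<tau> (x - m) = x - m" by (rule permutes_not_in[OF \<tau>])
    then show ?thesis using False by (simp add: perm_concat_def)
  qed
qed

lemma sym_alg_zero: "0 \<in> sym_alg m"
  by (simp add: sym_alg_def)

lemma sym_alg_add: "f \<in> sym_alg m \<Longrightarrow> g \<in> sym_alg m \<Longrightarrow> f + g \<in> sym_alg m"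
  using Poly_Mapping.keys_add[of f g] by (auto simp: sym_alg_def)

lemma sym_alg_uminus: "f \<in> sym_alg m \<Longrightarrow> - f \<in> sym_alg m"
  by (auto simp: sym_alg_def in_keys_iff)

lemma sym_alg_single: "\<sigma> permutes {1..m} \<Longrightarrow> Poly_Mapping.single \<sigma> a \<in> sym_alg m"
  by (auto simp: sym_alg_def)

lemma sym_alg_sum: "(\<And>x. x \<in> A \<Longrightarrow> f x \<in> sym_alg m) \<Longrightarrow> sum f A \<in> sym_alg m"
  by (induction A rule: infinite_finite_induct) (auto intro: sym_alg_zero sym_alg_add)

lemma sym_alg_mult: "f \<in> sym_alg m \<Longrightarrow> g \<in> sym_alg m \<Longrightarrow> f \<cdot>\<^sub>S g \<in> sym_alg m"
  unfolding sym_mult_def bilinear_ext_def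
  by (intro sym_alg_sum sym_alg_single permutes_compose) (auto simp: sym_alg_def)

lemma sym_alg_concat:
  "f \<in> sym_alg m \<Longrightarrow> g \<in> sym_alg p \<Longrightarrow> bilinear_ext (perm_concat m) f g \<in> sym_alg (m + p)"
  unfolding bilinear_ext_def
  by (intro sym_alg_sum sym_alg_single perm_concat_permutes) (auto simp: sym_alg_def)

lemma sym_prod_list_in: "(\<And>f. f \<in> set fs \<Longrightarrow> f \<in> sym_alg m) \<Longrightarrow> sym_prod_list fs \<in> sym_alg m"
  by (induction fs)
    (auto simp: sym_prod_list_def sym_one_def id_def[symmetric]
      intro!: sym_alg_mult sym_alg_single permutes_id)

lemma young_symmetrizer_in:
  assumes "young_tableau lam {1..m} T"
  shows "(\<cc> lam T :: ('a::field) perm_comb) \<in> sym_alg m"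
proof -
  have sub: "tab_row lam T i \<subseteq> {1..m}" "tab_column lam T i \<subseteq> {1..m}" for i
    using assms unfolding young_tableau_def tab_row_def tab_column_def bij_betw_def by blast+
  have "(\<aa> X :: 'a perm_comb) \<in> sym_alg m" "(\<bb> X :: 'a perm_comb) \<in> sym_alg m" if "X \<subseteq> {1..m}" for X
    using that permutes_subset[of _ X "{1..m}"]
    by (auto simp: symmetrizer_def antisymmetrizer_def intro!: sym_alg_sum sym_alg_single)
  with sub show ?thesis
    unfolding young_symmetrizer_def by (intro sym_alg_mult sym_prod_list_in) (auto simp del: One_nat_def)
qed

lemma gta_zero: "0 \<in> gta"
  by (simp add: gta_def sym_alg_zero)

lemma gta_add: "x \<in> gta \<Longrightarrow> y \<in> gta \<Longrightarrow> x + y \<in> gta"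
  by (simp add: gta_def lookup_add sym_alg_add)

lemma gta_single: "f \<in> sym_alg m \<Longrightarrow> Poly_Mapping.single m f \<in> gta"
  by (simp add: gta_def lookup_single when_def sym_alg_zero)

lemma gta_sum: "(\<And>x. x \<in> A \<Longrightarrow> f x \<in> gta) \<Longrightarrow> sum f A \<in> gta"
  by (induction A rule: infinite_finite_induct) (auto intro: gta_zero gta_add)

lemma gta_mult_closed: "x \<in> gta \<Longrightarrow> y \<in> gta \<Longrightarrow> x \<star> y \<in> gta"
  unfolding gta_mult_def
  by (intro gta_sum gta_single sym_alg_concat) (auto simp: gta_def)

lemma invariant_right_ideal_gta: "invariant_right_ideal gta"
  by (auto simp: invariant_right_ideal_def right_ideal_def homogeneous_def sym_left_ideal_def
      degree_part_def gta_zero gta_add gta_mult_closed gta_single sym_alg_zero sym_alg_add sym_alg_uminus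
      sym_alg_mult) (auto simp: gta_def sym_alg_uminus lookup_single when_def sym_alg_zero)

lemma invariant_right_ideal_generated:
  assumes "A \<subseteq> gta"
  shows "invariant_right_ideal (\<I> A)"
proof -
  have "\<I> A \<subseteq> gta"
    using assms invariant_right_ideal_gta by (auto simp: generated_ideal_def)
  then show ?thesis
    unfolding invariant_right_ideal_def right_ideal_def homogeneous_def sym_left_ideal_def
      degree_part_def generated_ideal_def
    by (auto simp: sym_alg_zero sym_alg_add sym_alg_uminus sym_alg_mult)
qed

lemma generated_ideal_least:
  "A \<subseteq> \<I> A" "invariant_right_ideal I \<Longrightarrow> A \<subseteq> I \<Longrightarrow> \<I> A \<subseteq> I"
  by (auto simp: generated_ideal_def)

end

theory Submission
  imports Defs
begin

text \<open>
  Write \<open>b(S)\<close> for the product of the column antisymmetrizers of \<open>S\<close>. Since the columns of \<open>S\<close> are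
  contained in those of \<open>T\<close>, \<open>\<cc> lam T\<close> is a nonzero multiple of \<open>\<cc> lam T \<cdot>\<^sub>S b(S)\<close>. The Young symmetrizers of
  size \<open>k\<close> generate the unit ideal, so \<open>b(S)\<close> is a combination of products \<open>\<sigma> \<cdot>\<^sub>S \<cc> \<delta> U \<cdot>\<^sub>S \<tau> \<cdot>\<^sub>S b(S)\<close>. Using Garnir
  relations, these are straightened into the left ideal of the \<open>\<cc> \<delta> S'\<close> in whose rows the column
  numbers of \<open>S\<close> increase strictly; such \<open>S'\<close> dominate \<open>S\<close>. Finally \<open>\<cc> lam T \<cdot>\<^sub>S x \<cdot>\<^sub>S \<cc> \<delta> S' = 0\<close> unless \<open>\<delta>\<close> is
  contained in \<open>lam\<close>, by a second straightening argument.
\<close>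

section \<open>The group algebra as a ring\<close>

text \<open>Each degree of the ideal is a left ideal, and multiplication by an identity permutation
  places \<open>K[S_k]\<close> inside \<open>K[S_n]\<close>. Hence all products \<open>\<cc> lam T
  \<cdot>\<^sub>S x \<cdot>\<^sub>S \<cc> \<delta> S'\<close> with admissible \<open>S'\<close> are
  available. Straightening inside \<open>K[S_k]\<close> bounds the columns of \<open>S'\<close> but
  not its shape, so \<open>\<delta>\<close> may stick out of \<open>lam\<close>; this is why the
  factor \<open>\<cc> lam T\<close> stays on the left throughout. Domination appears because weights
  that start at 1 or more and increase strictly along rows are at least the column number. That the
  symmetrizers generate the unit ideal is proved by straightening as well, without decomposing the
  group algebra. What this needs is a nonzero scalar \<open>N\<close>, and it comes from
  integrality: the coefficients are integers, whose sums of squares are positive even though the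
  field need not be ordered. Straightening is therefore stated for an arbitrary weight, an arbitrary
  left factor alternating under the column group, and an arbitrary target subspace. The weight is
  the filling's own column function for quasi-idempotence and completeness, the columns of
  \<open>S\<close> for domination, and the columns of \<open>S'\<close>, extended to
  \<open>[n]\<close>, for vanishing.\<close>

lemma bilinear_ext_superset:
  assumes "finite A" "Poly_Mapping.keys f \<subseteq> A" "finite B" "Poly_Mapping.keys g \<subseteq> B"
  shows "bilinear_ext h f g = (\<Sum>\<sigma>\<in>A. \<Sum>\<tau>\<in>B.
           Poly_Mapping.single (h \<sigma> \<tau>) (Poly_Mapping.lookup f \<sigma> * Poly_Mapping.lookup g \<tau> :: 'a::field))"
proof -
  have "(\<Sum>\<tau>\<in>Poly_Mapping.keys g. Poly_Mapping.single (h \<sigma> \<tau>) (Poly_Mapping.lookup f \<sigma> * Poly_Mapping.lookup g \<tau>)) =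
      (\<Sum>\<tau>\<in>B. Poly_Mapping.single (h \<sigma> \<tau>) (Poly_Mapping.lookup f \<sigma> * Poly_Mapping.lookup g \<tau>))" for \<sigma>
    by (rule sum.mono_neutral_left) (use assms in \<open>auto simp: in_keys_iff\<close>)
  then show ?thesis
    unfolding bilinear_ext_def
    by (simp, intro sum.mono_neutral_left) (use assms in \<open>auto simp: in_keys_iff\<close>)
qed

lemma bilinear_ext_add_left: "bilinear_ext h (f + f') g = bilinear_ext h f g + bilinear_ext h f' (g :: _ \<Rightarrow>\<^sub>0 'a::field)"
proof -
  \<comment> \<open>Terms may cancel in \<open>f + f'\<close>, so all three sums are taken over one
    common finite set of keys.\<close>
  let ?A = "Poly_Mapping.keys f \<union> Poly_Mapping.keys f'"
  have "Poly_Mapping.keys (f + f') \<subseteq> ?A" by (rule Poly_Mapping.keys_add)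
  then show ?thesis
    by (simp add: bilinear_ext_superset[of ?A _ "Poly_Mapping.keys g"] lookup_add distrib_right
        single_add sum.distrib)
qed

lemma bilinear_ext_add_right: "bilinear_ext h f (g + g') = bilinear_ext h f g + bilinear_ext h f (g' :: _ \<Rightarrow>\<^sub>0 'a::field)"
proof -
  let ?A = "Poly_Mapping.keys g \<union> Poly_Mapping.keys g'"
  have "Poly_Mapping.keys (g + g') \<subseteq> ?A" by (rule Poly_Mapping.keys_add)
  then show ?thesis
    by (simp add: bilinear_ext_superset[of "Poly_Mapping.keys f" _ ?A] lookup_add distrib_left
        single_add sum.distrib)
qed

lemma bilinear_ext_zero [simp]: "bilinear_ext h 0 g = 0" "bilinear_ext h f 0 = 0"
  by (simp_all add: bilinear_ext_def)

lemma sym_mult_add_left: "(f + f') \<cdot>\<^sub>S g = f \<cdot>\<^sub>S g + f' \<cdot>\<^sub>S g"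
  by (simp add: sym_mult_def bilinear_ext_add_left)

lemma sym_mult_add_right: "f \<cdot>\<^sub>S (g + g') = f \<cdot>\<^sub>S g + f \<cdot>\<^sub>S g'"
  by (simp add: sym_mult_def bilinear_ext_add_right)

lemma sym_mult_zero [simp]: "0 \<cdot>\<^sub>S g = 0" "f \<cdot>\<^sub>S 0 = 0"
  by (simp_all add: sym_mult_def)

lemma sym_mult_single [simp]:
  "Poly_Mapping.single \<sigma> a \<cdot>\<^sub>S Poly_Mapping.single \<tau> b = Poly_Mapping.single (\<sigma> \<circ> \<tau>) (a * b)"
  by (simp add: sym_mult_def)

lemma sym_mult_uminus_left: "(- f) \<cdot>\<^sub>S g = - (f \<cdot>\<^sub>S g)"
  using sym_mult_add_left[of f "- f" g] by (simp add: eq_neg_iff_add_eq_0 add.commute)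

lemma sym_mult_uminus_right: "f \<cdot>\<^sub>S (- g) = - (f \<cdot>\<^sub>S g)"
  using sym_mult_add_right[of f g "- g"] by (simp add: eq_neg_iff_add_eq_0 add.commute)

lemma sym_mult_diff_right: "f \<cdot>\<^sub>S (g - g') = f \<cdot>\<^sub>S g - f \<cdot>\<^sub>S g'"
  using sym_mult_add_right[of f g "- g'"] by (simp add: sym_mult_uminus_right)

lemma sym_mult_sum_left: "(\<Sum>x\<in>A. f x) \<cdot>\<^sub>S g = (\<Sum>x\<in>A. f x \<cdot>\<^sub>S g)"
  by (induction A rule: infinite_finite_induct) (simp_all add: sym_mult_add_left)

lemma sym_mult_sum_right: "f \<cdot>\<^sub>S (\<Sum>x\<in>A. g x) = (\<Sum>x\<in>A. f \<cdot>\<^sub>S g x)"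
  by (induction A rule: infinite_finite_induct) (simp_all add: sym_mult_add_right)

lemma poly_mapping_eq_sum_single:
  fixes f :: "'b \<Rightarrow>\<^sub>0 'a::comm_monoid_add"
  shows "f = (\<Sum>\<sigma>\<in>Poly_Mapping.keys f. Poly_Mapping.single \<sigma> (Poly_Mapping.lookup f \<sigma>))"
  by (rule poly_mapping_eqI) (simp add: lookup_sum lookup_single when_def in_keys_iff)

text \<open>Restricting the case \<open>single\<close> to the support of \<open>f\<close> passes
  support conditions, such as membership in \<open>sym_alg n\<close> or \<open>bij_keys\<close>, on
  to the individual permutations.\<close>

lemma perm_comb_induct [case_names zero single add]:
  fixes f :: "('a::field) perm_comb"
  assumes "P 0" "\<And>\<sigma> a. \<sigma> \<in> Poly_Mapping.keys f \<Longrightarrow> P (Poly_Mapping.single \<sigma> a)"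
    and "\<And>f g. P f \<Longrightarrow> P g \<Longrightarrow> P (f + g)"
  shows "P f"
proof -
  have "P (\<Sum>\<sigma>\<in>A. Poly_Mapping.single \<sigma> (Poly_Mapping.lookup f \<sigma>))" if "A \<subseteq> Poly_Mapping.keys f" for A
    using that by (induction A rule: infinite_finite_induct) (auto intro: assms)
  then show ?thesis using poly_mapping_eq_sum_single[of f] by (metis order_refl)
qed

lemma sym_mult_assoc: "(f \<cdot>\<^sub>S g) \<cdot>\<^sub>S h = f \<cdot>\<^sub>S (g \<cdot>\<^sub>S h)"
proof (induction f rule: perm_comb_induct)
  case (single \<sigma> a)
  show ?case
  proof (induction g rule: perm_comb_induct)
    case (single \<tau> b)
    show ?case
      by (induction h rule: perm_comb_induct) (simp_all add: sym_mult_add_right o_assoc mult.assoc)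
  qed (simp_all add: sym_mult_add_right sym_mult_add_left)
qed (simp_all add: sym_mult_add_left)

lemma sym_mult_id [simp]: "Poly_Mapping.single id 1 \<cdot>\<^sub>S f = f" "f \<cdot>\<^sub>S Poly_Mapping.single id 1 = f"
proof -
  show "Poly_Mapping.single id 1 \<cdot>\<^sub>S f = f"
    by (induction f rule: perm_comb_induct)
      (simp_all only: sym_mult_add_right sym_mult_zero sym_mult_single id_comp mult_1)
  show "f \<cdot>\<^sub>S Poly_Mapping.single id 1 = f"
    by (induction f rule: perm_comb_induct)
      (simp_all only: sym_mult_add_left sym_mult_zero sym_mult_single comp_id mult_1_right)
qed

text \<open>Scalars act as multiples of the identity permutation, so the module laws are instances
  of the ring laws.\<close>

definition scale :: "'a::field \<Rightarrow> 'a perm_comb \<Rightarrow> 'a perm_comb" (infixr \<open>\<odot>\<close> 75) where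
  "a \<odot> f = Poly_Mapping.single id a \<cdot>\<^sub>S f"

lemma scale_single [simp]: "a \<odot> Poly_Mapping.single \<sigma> b = Poly_Mapping.single \<sigma> (a * b)"
  by (simp only: scale_def sym_mult_single id_comp)

lemma scale_add: "a \<odot> (f + g) = a \<odot> f + a \<odot> g"
  and scale_add_left: "(a + b) \<odot> f = a \<odot> f + b \<odot> f"
  and scale_sum: "a \<odot> sum F A = (\<Sum>x\<in>A. a \<odot> F x)"
  and scale_uminus_left: "(- a) \<odot> f = - (a \<odot> f)"
  by (simp_all add: scale_def single_add single_uminus sym_mult_add_right sym_mult_add_left
      sym_mult_sum_right sym_mult_uminus_left)

lemma scale_uminus_right: "a \<odot> (- f) = - (a \<odot> f)"
  by (simp add: scale_def sym_mult_uminus_right)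

lemma scale_zero [simp]: "a \<odot> 0 = 0" "0 \<odot> f = 0"
  by (simp_all add: scale_def)

lemma scale_one [simp]: "1 \<odot> f = f"
  by (simp only: scale_def sym_mult_id)

lemma scale_mult_left: "(a \<odot> f) \<cdot>\<^sub>S g = a \<odot> (f \<cdot>\<^sub>S g)"
  by (simp add: scale_def sym_mult_assoc)

lemma scale_scale [simp]: "a \<odot> (b \<odot> f) = (a * b) \<odot> f"
  by (simp only: scale_def flip: sym_mult_assoc) (simp only: sym_mult_single id_comp)

lemma scale_mult_right: "f \<cdot>\<^sub>S (a \<odot> g) = a \<odot> (f \<cdot>\<^sub>S g)"
proof (induction f rule: perm_comb_induct)
  case (single \<sigma> b)
  show ?case
    by (simp only: scale_def flip: sym_mult_assoc)
      (simp only: sym_mult_single id_comp comp_id mult.commute)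
qed (simp_all add: sym_mult_add_left scale_add)

lemma single_eq_scale: "Poly_Mapping.single \<sigma> a = a \<odot> Poly_Mapping.single \<sigma> 1"
  by simp

lemma sum_constant_scale: "(\<Sum>x\<in>A. f) = of_nat (card A) \<odot> f"
  by (induction A rule: infinite_finite_induct) (simp_all add: scale_add_left)

lemma scale_eq_iff: "a \<noteq> 0 \<Longrightarrow> a \<odot> f = g \<longleftrightarrow> f = inverse a \<odot> g"
  by auto

text \<open>Linear subspaces serve as targets of straightening: the kernel of a multiplication
  yields vanishing statements, an ideal yields membership statements.\<close>

definition lin_closed :: "('a::field) perm_comb set \<Rightarrow> bool" where
  "lin_closed V \<longleftrightarrow> 0 \<in> V \<and> (\<forall>x\<in>V. \<forall>y\<in>V. x + y \<in> V) \<and> (\<forall>a. \<forall>x\<in>V. a \<odot> x \<in> V)"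

lemma lin_closed_zero: "lin_closed V \<Longrightarrow> 0 \<in> V"
  and lin_closed_add: "lin_closed V \<Longrightarrow> x \<in> V \<Longrightarrow> y \<in> V \<Longrightarrow> x + y \<in> V"
  and lin_closed_scale: "lin_closed V \<Longrightarrow> x \<in> V \<Longrightarrow> a \<odot> x \<in> V"
  by (simp_all add: lin_closed_def)

lemma lin_closed_uminus: "lin_closed V \<Longrightarrow> x \<in> V \<Longrightarrow> - x \<in> V"
  using lin_closed_scale[of V x "- 1"] by (simp add: scale_uminus_left)

lemma lin_closed_diff: "lin_closed V \<Longrightarrow> x \<in> V \<Longrightarrow> y \<in> V \<Longrightarrow> x - y \<in> V"
  using lin_closed_add[of V x "- y"] lin_closed_uminus[of V y] by simp

lemma lin_closed_sum: "lin_closed V \<Longrightarrow> (\<And>x. x \<in> A \<Longrightarrow> f x \<in> V) \<Longrightarrow> sum f A \<in> V"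
  by (induction A rule: infinite_finite_induct) (auto intro: lin_closed_zero lin_closed_add)

lemma lin_closed_cancel_scale:
  assumes "lin_closed V" "a \<odot> x \<in> V" "a \<noteq> 0"
  shows "x \<in> V"
  using lin_closed_scale[OF assms(1,2), of "inverse a"] assms(3) by simp

section \<open>Character sums over Young subgroups\<close>

text \<open>The Young subgroup of the level sets of \<open>v\<close> on \<open>E\<close>: the row
  group when \<open>v\<close> gives row numbers, the column group when it gives column
  numbers.\<close>

definition stab :: "nat set \<Rightarrow> (nat \<Rightarrow> nat) \<Rightarrow> (nat \<Rightarrow> nat) set" where
  "stab E v = {\<sigma>. \<sigma> permutes E \<and> (\<forall>x\<in>E. v (\<sigma> x) = v x)}"

definition char_sum :: "((nat \<Rightarrow> nat) \<Rightarrow> int) \<Rightarrow> (nat \<Rightarrow> nat) set \<Rightarrow> ('a::field_char_0) perm_comb" where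
  "char_sum \<chi> H = (\<Sum>\<sigma>\<in>H. Poly_Mapping.single \<sigma> (of_int (\<chi> \<sigma>)))"

abbreviation row_sum :: "nat set \<Rightarrow> (nat \<Rightarrow> nat) \<Rightarrow> ('a::field_char_0) perm_comb" where
  "row_sum E v \<equiv> char_sum (\<lambda>_. 1) (stab E v)"

abbreviation col_sum :: "nat set \<Rightarrow> (nat \<Rightarrow> nat) \<Rightarrow> ('a::field_char_0) perm_comb" where
  "col_sum E v \<equiv> char_sum sign (stab E v)"

section \<open>Young subgroups as groups\<close>

lemma finite_stab [simp]: "finite E \<Longrightarrow> finite (stab E v)"
  unfolding stab_def by (rule finite_subset[OF _ finite_permutations[of E]]) auto

lemma stab_permutes: "\<sigma> \<in> stab E v \<Longrightarrow> \<sigma> permutes E"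
  and stab_eq: "\<sigma> \<in> stab E v \<Longrightarrow> x \<in> E \<Longrightarrow> v (\<sigma> x) = v x"
  by (simp_all add: stab_def)

lemma stab_eq': "\<sigma> \<in> stab E v \<Longrightarrow> v (\<sigma> x) = v x"
  by (metis permutes_not_in stab_eq stab_permutes)

lemma stabI: "\<sigma> permutes E \<Longrightarrow> (\<And>x. x \<in> E \<Longrightarrow> v (\<sigma> x) = v x) \<Longrightarrow> \<sigma> \<in> stab E v"
  by (simp add: stab_def)

lemma stab_cong: "(\<And>x y. x \<in> E \<Longrightarrow> y \<in> E \<Longrightarrow> v x = v y \<longleftrightarrow> w x = w y) \<Longrightarrow> stab E v = stab E w"
  unfolding stab_def by (auto simp: permutes_in_image)

lemma stab_id: "id \<in> stab E v"
  by (simp add: stab_def permutes_id)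

lemma stab_compose: "\<sigma> \<in> stab E v \<Longrightarrow> \<tau> \<in> stab E v \<Longrightarrow> \<sigma> \<circ> \<tau> \<in> stab E v"
  by (auto simp: stab_def permutes_compose permutes_in_image)

lemma stab_inv: "\<sigma> \<in> stab E v \<Longrightarrow> inv \<sigma> \<in> stab E v"
  by (rule stabI) (metis permutes_inv stab_permutes, metis permutes_inverses(1) stab_eq' stab_permutes)

lemma stab_transpose: "x \<in> E \<Longrightarrow> y \<in> E \<Longrightarrow> v x = v y \<Longrightarrow> Transposition.transpose x y \<in> stab E v"
  by (rule stabI) (auto simp: permutes_swap_id transpose_def)

lemma stab_mono: "E \<subseteq> F \<Longrightarrow> (\<And>x y. x \<in> E \<Longrightarrow> y \<in> E \<Longrightarrow> v x = v y \<Longrightarrow> w x = w y) \<Longrightarrow> stab E v \<subseteq> stab F w"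
proof
  fix \<sigma> assume *: "E \<subseteq> F" "\<And>x y. x \<in> E \<Longrightarrow> y \<in> E \<Longrightarrow> v x = v y \<Longrightarrow> w x = w y" "\<sigma> \<in> stab E v"
  then have p: "\<sigma> permutes E" by (simp add: stab_def)
  show "\<sigma> \<in> stab F w"
  proof (rule stabI)
    show "\<sigma> permutes F" using p *(1) by (rule permutes_subset)
    fix x assume "x \<in> F"
    show "w (\<sigma> x) = w x"
    proof (cases "x \<in> E")
      case True
      then show ?thesis using *(2)[of "\<sigma> x" x] stab_eq[OF *(3)] p by (simp add: permutes_in_image)
    qed (use p in \<open>simp add: permutes_not_in\<close>)
  qed
qed

lemma stab_const: "stab E (\<lambda>_. a) = {\<sigma>. \<sigma> permutes E}"
  by (simp add: stab_def)

text \<open>Covers the trivial character and the sign at once, hence symmetrizers and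
  antisymmetrizers. By \<open>char_square\<close> every value is its own inverse, so absorbing
  \<open>h\<close> costs the factor \<open>\<chi> h\<close> on either side.\<close>

locale multiplicative_char =
  fixes \<chi> :: "(nat \<Rightarrow> nat) \<Rightarrow> int"
  assumes char_compose: "permutation \<sigma> \<Longrightarrow> permutation \<tau> \<Longrightarrow> \<chi> (\<sigma> \<circ> \<tau>) = \<chi> \<sigma> * \<chi> \<tau>"
    and char_square: "\<chi> \<sigma> * \<chi> \<sigma> = 1"
begin

lemma char_id: "\<chi> id = 1"
proof -
  have "\<chi> id = \<chi> id * \<chi> id" using char_compose[of id id] by (simp add: permutation_id)
  then show ?thesis by (simp add: char_square)
qed

lemma char_square_of_int: "of_int (\<chi> \<sigma>) * of_int (\<chi> \<sigma>) = (1 :: 'a::field_char_0)"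
  by (metis char_square of_int_1 of_int_mult)

lemma single_mult_char_sum:
  assumes "finite E" and h: "h \<in> stab E v"
  shows "Poly_Mapping.single h 1 \<cdot>\<^sub>S char_sum \<chi> (stab E v) =
    of_int (\<chi> h) \<odot> (char_sum \<chi> (stab E v) :: ('a::field_char_0) perm_comb)"
proof -
  have perm: "permutation \<sigma>" if "\<sigma> \<in> stab E v" for \<sigma>
    using that stab_permutes[of \<sigma> E v] assms(1) permutation_permutes by blast
  have bij: "bij_betw ((\<circ>) h) (stab E v) (stab E v)"
    by (rule bij_betw_byWitness[where f' = "(\<circ>) (inv h)"])
      (use h in \<open>auto simp: o_assoc stab_inv stab_compose permutes_inv_o[OF stab_permutes[OF h]]\<close>)
  have "of_int (\<chi> h) \<odot> (char_sum \<chi> (stab E v) :: 'a perm_comb) =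
      (\<Sum>\<sigma>\<in>stab E v. Poly_Mapping.single \<sigma> (of_int (\<chi> h) * of_int (\<chi> \<sigma>)))"
    by (simp add: char_sum_def scale_sum)
  also have "\<dots> = (\<Sum>\<sigma>\<in>stab E v. Poly_Mapping.single (h \<circ> \<sigma>) (of_int (\<chi> h) * of_int (\<chi> (h \<circ> \<sigma>))))"
    by (rule sum.reindex_bij_betw[OF bij, symmetric])
  also have "\<dots> = (\<Sum>\<sigma>\<in>stab E v. Poly_Mapping.single (h \<circ> \<sigma>) (of_int (\<chi> \<sigma>)))"
    by (rule sum.cong) (simp_all add: char_compose perm h char_square_of_int flip: mult.assoc)
  also have "\<dots> = Poly_Mapping.single h 1 \<cdot>\<^sub>S char_sum \<chi> (stab E v)"
    by (simp add: char_sum_def sym_mult_sum_right)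
  finally show ?thesis by simp
qed

lemma char_sum_mult_single:
  assumes "finite E" and h: "h \<in> stab E v"
  shows "char_sum \<chi> (stab E v) \<cdot>\<^sub>S Poly_Mapping.single h 1 =
    of_int (\<chi> h) \<odot> (char_sum \<chi> (stab E v) :: ('a::field_char_0) perm_comb)"
proof -
  have perm: "permutation \<sigma>" if "\<sigma> \<in> stab E v" for \<sigma>
    using that stab_permutes[of \<sigma> E v] assms(1) permutation_permutes by blast
  have bij: "bij_betw (\<lambda>\<sigma>. \<sigma> \<circ> h) (stab E v) (stab E v)"
    by (rule bij_betw_byWitness[where f' = "\<lambda>\<sigma>. \<sigma> \<circ> inv h"])
      (use h in \<open>auto simp: stab_inv stab_compose permutes_inv_o[OF stab_permutes[OF h]] o_assoc[symmetric]\<close>)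
  have "of_int (\<chi> h) \<odot> (char_sum \<chi> (stab E v) :: 'a perm_comb) =
      (\<Sum>\<sigma>\<in>stab E v. Poly_Mapping.single \<sigma> (of_int (\<chi> h) * of_int (\<chi> \<sigma>)))"
    by (simp add: char_sum_def scale_sum)
  also have "\<dots> = (\<Sum>\<sigma>\<in>stab E v. Poly_Mapping.single (\<sigma> \<circ> h) (of_int (\<chi> h) * of_int (\<chi> (\<sigma> \<circ> h))))"
    by (rule sum.reindex_bij_betw[OF bij, symmetric])
  also have "\<dots> = (\<Sum>\<sigma>\<in>stab E v. Poly_Mapping.single (\<sigma> \<circ> h) (of_int (\<chi> \<sigma>)))"
    by (rule sum.cong) (simp_all add: char_compose perm h char_square_of_int mult.left_commute)
  also have "\<dots> = char_sum \<chi> (stab E v) \<cdot>\<^sub>S Poly_Mapping.single h 1"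
    by (simp add: char_sum_def sym_mult_sum_left)
  finally show ?thesis by simp
qed

text \<open>Each term of the second factor is absorbed with the factor
  \<open>\<chi> h * \<chi> h = 1\<close>, so only the number of terms remains.\<close>

lemma char_sum_mult_subgroup:
  assumes "finite E" and "H \<subseteq> stab E v"
  shows "char_sum \<chi> (stab E v) \<cdot>\<^sub>S char_sum \<chi> H =
    of_nat (card H) \<odot> (char_sum \<chi> (stab E v) :: ('a::field_char_0) perm_comb)"
proof -
  have "char_sum \<chi> (stab E v) \<cdot>\<^sub>S Poly_Mapping.single h (of_int (\<chi> h)) = (char_sum \<chi> (stab E v) :: 'a perm_comb)"
    if "h \<in> H" for h
  proof -
    have "char_sum \<chi> (stab E v) \<cdot>\<^sub>S Poly_Mapping.single h (of_int (\<chi> h)) =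
        of_int (\<chi> h) \<odot> (char_sum \<chi> (stab E v) \<cdot>\<^sub>S (Poly_Mapping.single h 1 :: 'a perm_comb))"
      by (simp flip: scale_mult_right)
    also have "\<dots> = char_sum \<chi> (stab E v)"
      using that assms by (subst char_sum_mult_single) (auto simp: char_square_of_int)
    finally show ?thesis .
  qed
  then show ?thesis
    by (subst (2) char_sum_def) (simp add: sym_mult_sum_right sum_constant_scale)
qed

text \<open>Since \<open>E\<close> and \<open>F\<close> share no value of \<open>v\<close>, a
  permutation of the union that preserves \<open>v\<close> maps each of them to itself, and the
  Young subgroup is a direct product.\<close>

lemma char_sum_stab_union:
  assumes fin: "finite E" "finite F" and disj: "E \<inter> F = {}"
    and sep: "\<And>x y. x \<in> E \<Longrightarrow> y \<in> F \<Longrightarrow> v x \<noteq> v y"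
  shows "char_sum \<chi> (stab E v) \<cdot>\<^sub>S char_sum \<chi> (stab F v) = (char_sum \<chi> (stab (E \<union> F) v) :: ('a::field_char_0) perm_comb)"
proof -
  have perm: "permutation \<sigma>" if "\<sigma> \<in> stab G v" "finite G" for \<sigma> G
    using that stab_permutes[of \<sigma> G v] permutation_permutes by blast
  have bij: "bij_betw (\<lambda>(\<sigma>, \<tau>). \<sigma> \<circ> \<tau>) (stab E v \<times> stab F v) (stab (E \<union> F) v)"
  proof (rule bij_betw_byWitness[where f' = "\<lambda>\<rho>. (\<lambda>x. if x \<in> E then \<rho> x else x, \<lambda>x. if x \<in> F then \<rho> x else x)"])
    show "\<forall>a\<in>stab E v \<times> stab F v. (\<lambda>\<rho>. (\<lambda>x. if x \<in> E then \<rho> x else x, \<lambda>x. if x \<in> F then \<rho> x else x))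
        ((\<lambda>(\<sigma>, \<tau>). \<sigma> \<circ> \<tau>) a) = a"
    proof
      fix a assume a: "a \<in> stab E v \<times> stab F v"
      obtain \<sigma> \<tau> where [simp]: "a = (\<sigma>, \<tau>)" by (cases a)
      have p: "\<sigma> permutes E" "\<tau> permutes F" using a by (auto simp: stab_def)
      have "\<tau> x = x" if "x \<in> E" for x using that disj p(2) by (auto intro: permutes_not_in)
      moreover have "\<sigma> x = x" if "x \<notin> E" for x using that p by (auto intro: permutes_not_in)
      moreover have "\<tau> x = x" if "x \<notin> F" for x using that p by (auto intro: permutes_not_in)
      moreover have "\<tau> x \<notin> E" if "x \<in> F" for x using that disj permutes_in_image[OF p(2), of x] by auto
      ultimately show "(\<lambda>\<rho>. (\<lambda>x. if x \<in> E then \<rho> x else x, \<lambda>x. if x \<in> F then \<rho> x else x))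
        ((\<lambda>(\<sigma>, \<tau>). \<sigma> \<circ> \<tau>) a) = a"
        by (auto simp: fun_eq_iff)
    qed
    have keyE: "\<rho> x \<in> E \<longleftrightarrow> x \<in> E" "\<rho> x \<in> F \<longleftrightarrow> x \<in> F" if "\<rho> \<in> stab (E \<union> F) v" for \<rho> x
    proof -
      have p: "\<rho> permutes E \<union> F" "v (\<rho> x) = v x" using that by (auto simp: stab_eq' stab_permutes)
      then show "\<rho> x \<in> E \<longleftrightarrow> x \<in> E" "\<rho> x \<in> F \<longleftrightarrow> x \<in> F"
        using permutes_in_image[OF p(1), of x] sep disj by (metis IntI UnE UnI1 UnI2 emptyE)+
    qed
    show "\<forall>a'\<in>stab (E \<union> F) v. (\<lambda>(\<sigma>, \<tau>). \<sigma> \<circ> \<tau>) (\<lambda>x. if x \<in> E then a' x else x, \<lambda>x. if x \<in> F then a' x else x) = a'"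
    proof
      fix \<rho> assume r: "\<rho> \<in> stab (E \<union> F) v"
      have "\<rho> x = x" if "x \<notin> E" "x \<notin> F" for x
        using r that by (auto simp: stab_def intro: permutes_not_in)
      then show "(\<lambda>(\<sigma>, \<tau>). \<sigma> \<circ> \<tau>) (\<lambda>x. if x \<in> E then \<rho> x else x, \<lambda>x. if x \<in> F then \<rho> x else x) = \<rho>"
        using keyE[OF r] disj by (auto simp: fun_eq_iff)
    qed
    show "(\<lambda>(\<sigma>, \<tau>). \<sigma> \<circ> \<tau>) ` (stab E v \<times> stab F v) \<subseteq> stab (E \<union> F) v"
    proof clarify
      fix \<sigma> \<tau> assume s: "\<sigma> \<in> stab E v" and t: "\<tau> \<in> stab F v"
      have "\<sigma> permutes E \<union> F" "\<tau> permutes E \<union> F"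
        using s t by (auto intro: permutes_subset dest: stab_permutes)
      then show "\<sigma> \<circ> \<tau> \<in> stab (E \<union> F) v"
        using s t by (auto intro!: stabI simp: permutes_compose stab_eq')
    qed
    have restr: "(\<lambda>x. if x \<in> G then \<rho> x else x) \<in> stab G v"
      if r: "\<rho> \<in> stab (E \<union> F) v" and G: "finite G" "\<And>x. \<rho> x \<in> G \<longleftrightarrow> x \<in> G" for \<rho> G
    proof (rule stabI)
      have inj: "inj \<rho>" using stab_permutes[OF r] by (rule permutes_inj)
      show "(\<lambda>x. if x \<in> G then \<rho> x else x) permutes G"
      proof (rule bij_imp_permutes)
        have "inj_on (\<lambda>x. if x \<in> G then \<rho> x else x) G"
          using inj by (auto simp: inj_on_def inj_def)
        moreover have "(\<lambda>x. if x \<in> G then \<rho> x else x) ` G \<subseteq> G" using G(2) by auto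
        ultimately show "bij_betw (\<lambda>x. if x \<in> G then \<rho> x else x) G G"
          unfolding bij_betw_def using endo_inj_surj[OF G(1)] by (intro conjI)
      qed simp
      show "v (if x \<in> G then \<rho> x else x) = v x" for x using stab_eq'[OF r] by simp
    qed
    show "(\<lambda>\<rho>. (\<lambda>x. if x \<in> E then \<rho> x else x, \<lambda>x. if x \<in> F then \<rho> x else x)) ` stab (E \<union> F) v \<subseteq> stab E v \<times> stab F v"
    proof clarify
      fix \<rho> assume r: "\<rho> \<in> stab (E \<union> F) v"
      show "(\<lambda>x. if x \<in> E then \<rho> x else x) \<in> stab E v \<and> (\<lambda>x. if x \<in> F then \<rho> x else x) \<in> stab F v"
        using restr[OF r fin(1) keyE(1)[OF r]] restr[OF r fin(2) keyE(2)[OF r]] by (rule conjI)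
    qed
  qed
  have "char_sum \<chi> (stab E v) \<cdot>\<^sub>S char_sum \<chi> (stab F v) =
      (\<Sum>(\<sigma>, \<tau>)\<in>stab E v \<times> stab F v. Poly_Mapping.single (\<sigma> \<circ> \<tau>) (of_int (\<chi> (\<sigma> \<circ> \<tau>)) :: 'a))"
    unfolding char_sum_def sum.cartesian_product[symmetric]
    by (simp add: sym_mult_sum_left sym_mult_sum_right char_compose perm fin cong: sum.cong)
      (rule sum.swap)
  also have "\<dots> = char_sum \<chi> (stab (E \<union> F) v)"
    unfolding char_sum_def using sum.reindex_bij_betw[OF bij, of "\<lambda>\<rho>. Poly_Mapping.single \<rho> (of_int (\<chi> \<rho>) :: 'a)"]
    by (simp add: case_prod_unfold)
  finally show ?thesis .
qed

text \<open>Conjugation by \<open>\<sigma>\<close> matches the Young subgroup of \<open>v\<close>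
  with that of \<open>v \<circ> \<sigma>\<close> and leaves the character unchanged. Moving a sum
  past \<open>\<sigma>\<close> thus relabels the entries.\<close>

lemma char_sum_conj:
  assumes "finite E" and s: "\<sigma> permutes E"
  shows "char_sum \<chi> (stab E v) \<cdot>\<^sub>S Poly_Mapping.single \<sigma> 1 =
    Poly_Mapping.single \<sigma> 1 \<cdot>\<^sub>S (char_sum \<chi> (stab E (v \<circ> \<sigma>)) :: ('a::field_char_0) perm_comb)"
proof -
  have bij: "bij_betw (\<lambda>\<tau>. inv \<sigma> \<circ> \<tau> \<circ> \<sigma>) (stab E v) (stab E (v \<circ> \<sigma>))"
  proof (rule bij_betw_byWitness[where f' = "\<lambda>\<tau>. \<sigma> \<circ> \<tau> \<circ> inv \<sigma>"])
    show "\<forall>\<tau>\<in>stab E v. \<sigma> \<circ> (inv \<sigma> \<circ> \<tau> \<circ> \<sigma>) \<circ> inv \<sigma> = \<tau>" "\<forall>\<tau>\<in>stab E (v \<circ> \<sigma>). inv \<sigma> \<circ> (\<sigma> \<circ> \<tau> \<circ> inv \<sigma>) \<circ> \<sigma> = \<tau>"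
      using permutes_inverses[OF s] by (auto simp: fun_eq_iff)
    show "(\<lambda>\<tau>. inv \<sigma> \<circ> \<tau> \<circ> \<sigma>) ` stab E v \<subseteq> stab E (v \<circ> \<sigma>)"
      by (auto intro!: stabI permutes_compose s permutes_inv[OF s] dest: stab_permutes
          simp: permutes_inverses[OF s] stab_eq')
    have "v (\<sigma> (\<tau> x)) = v (\<sigma> x)" if "\<tau> \<in> stab E (v \<circ> \<sigma>)" for \<tau> x
      using stab_eq'[OF that, of x] by simp
    then show "(\<lambda>\<tau>. \<sigma> \<circ> \<tau> \<circ> inv \<sigma>) ` stab E (v \<circ> \<sigma>) \<subseteq> stab E v"
      by (auto intro!: stabI permutes_compose s permutes_inv[OF s] dest: stab_permutes
          simp: permutes_inverses[OF s])
  qed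
  have chi: "\<chi> (inv \<sigma> \<circ> \<tau> \<circ> \<sigma>) = \<chi> \<tau>" if "\<tau> \<in> stab E v" for \<tau>
  proof -
    have p: "permutation \<sigma>" "permutation \<tau>" "permutation (inv \<sigma>)"
      using assms stab_permutes[OF that] permutation_permutes permutes_inv by blast+
    have "\<chi> \<sigma> * \<chi> (inv \<sigma> \<circ> \<tau> \<circ> \<sigma>) = \<chi> \<tau> * \<chi> \<sigma>"
      using p by (simp add: permutation_compose permutes_inv_o[OF s] o_assoc flip: char_compose)
    then have "\<chi> \<sigma> * (\<chi> \<sigma> * \<chi> (inv \<sigma> \<circ> \<tau> \<circ> \<sigma>)) = \<chi> \<sigma> * \<chi> \<sigma> * \<chi> \<tau>" by simp
    then show ?thesis by (simp add: char_square flip: mult.assoc)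
  qed
  have "(char_sum \<chi> (stab E (v \<circ> \<sigma>)) :: 'a perm_comb) =
      (\<Sum>\<tau>\<in>stab E v. Poly_Mapping.single (inv \<sigma> \<circ> \<tau> \<circ> \<sigma>) (of_int (\<chi> (inv \<sigma> \<circ> \<tau> \<circ> \<sigma>))))"
    unfolding char_sum_def by (rule sum.reindex_bij_betw[OF bij, symmetric])
  then show ?thesis
    by (simp add: char_sum_def sym_mult_sum_left sym_mult_sum_right chi o_assoc permutes_inv_o[OF s])
qed

end

interpretation trivial_char: multiplicative_char "\<lambda>_. 1"
  by unfold_locales simp_all

interpretation sign_char: multiplicative_char sign
  by unfold_locales (simp_all add: sign_compose)

lemma char_sum_in_sym_alg:
  assumes "H \<subseteq> {\<sigma>. \<sigma> permutes {1..m}}"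
  shows "(char_sum \<chi> H :: ('a::field_char_0) perm_comb) \<in> sym_alg m"
  unfolding char_sum_def using assms by (intro sym_alg_sum sym_alg_single) auto

lemma char_sum_stab_in_sym_alg: "E \<subseteq> {1..m} \<Longrightarrow> (char_sum \<chi> (stab E v) :: ('a::field_char_0) perm_comb) \<in> sym_alg m"
  by (rule char_sum_in_sym_alg) (auto dest: stab_permutes intro: permutes_subset)

lemma sym_alg_mono: "k \<le> n \<Longrightarrow> f \<in> sym_alg k \<Longrightarrow> f \<in> sym_alg n"
  unfolding sym_alg_def by (auto intro: permutes_subset)

section \<open>Fillings and Garnir relations\<close>

text \<open>A tableau with entry set \<open>E\<close> is encoded by its inverse, as the pair of functions giving the row
  and the column of an entry; relabelling the entries by \<open>\<sigma>\<close> is then composition with \<open>\<sigma>\<close>.\<close>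

definition filling :: "nat set \<Rightarrow> (nat \<Rightarrow> nat) \<Rightarrow> (nat \<Rightarrow> nat) \<Rightarrow> bool" where
  "filling E r c \<longleftrightarrow> finite E \<and> inj_on (\<lambda>x. (r x, c x)) E \<and> (\<forall>x\<in>E. 1 \<le> r x \<and> 1 \<le> c x) \<and>
     (\<forall>x\<in>E. \<forall>i j. 1 \<le> i \<longrightarrow> i \<le> r x \<longrightarrow> 1 \<le> j \<longrightarrow> j \<le> c x \<longrightarrow> (\<exists>y\<in>E. r y = i \<and> c y = j))"

lemma filling_finite: "filling E r c \<Longrightarrow> finite E"
  and filling_inj: "filling E r c \<Longrightarrow> inj_on (\<lambda>x. (r x, c x)) E"
  and filling_eqD: "filling E r c \<Longrightarrow> x \<in> E \<Longrightarrow> y \<in> E \<Longrightarrow> r x = r y \<Longrightarrow> c x = c y \<Longrightarrow> x = y"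
  and filling_pos: "filling E r c \<Longrightarrow> x \<in> E \<Longrightarrow> 1 \<le> r x \<and> 1 \<le> c x"
  and filling_down: "filling E r c \<Longrightarrow> x \<in> E \<Longrightarrow> 1 \<le> i \<Longrightarrow> i \<le> r x \<Longrightarrow> 1 \<le> j \<Longrightarrow> j \<le> c x \<Longrightarrow> \<exists>y\<in>E. r y = i \<and> c y = j"
  by (auto simp: filling_def inj_on_def)

lemma filling_compose:
  assumes f: "filling E r c" and s: "\<sigma> permutes E"
  shows "filling E (r \<circ> \<sigma>) (c \<circ> \<sigma>)"
  unfolding filling_def
proof (intro conjI ballI allI impI)
  have "\<sigma> x \<in> E \<longleftrightarrow> x \<in> E" for x using s by (rule permutes_in_image)
  note E = this
  show "finite E" using f by (rule filling_finite)
  show "inj_on (\<lambda>x. ((r \<circ> \<sigma>) x, (c \<circ> \<sigma>) x)) E"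
    using filling_eqD[OF f] E permutes_inj[OF s] by (auto simp: inj_on_def inj_def)
  show "1 \<le> (r \<circ> \<sigma>) x" "1 \<le> (c \<circ> \<sigma>) x" if "x \<in> E" for x
    using filling_pos[OF f, of "\<sigma> x"] E that by auto
  fix x i j assume *: "x \<in> E" "1 \<le> i" "i \<le> (r \<circ> \<sigma>) x" "1 \<le> j" "j \<le> (c \<circ> \<sigma>) x"
  then obtain y where y: "y \<in> E" "r y = i" "c y = j"
    using filling_down[OF f, of "\<sigma> x" i j] E by auto
  then show "\<exists>y\<in>E. (r \<circ> \<sigma>) y = i \<and> (c \<circ> \<sigma>) y = j"
    using permutes_inverses[OF s] E by (intro bexI[of _ "inv \<sigma> y"]) (auto simp: permutes_in_image[OF permutes_inv[OF s]])
qed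

text \<open>The Young symmetrizer of the tableau whose entry \<open>x\<close> stands in row
  \<open>r x\<close> and column \<open>c x\<close>; see \<open>young_symmetrizer_eq\<close>.\<close>

definition row_col_sum :: "nat set \<Rightarrow> (nat \<Rightarrow> nat) \<Rightarrow> (nat \<Rightarrow> nat) \<Rightarrow> ('a::field_char_0) perm_comb" where
  "row_col_sum E r c = row_sum E r \<cdot>\<^sub>S col_sum E c"

lemma row_col_sum_conj:
  assumes "finite E" "\<sigma> permutes E"
  shows "row_col_sum E r c \<cdot>\<^sub>S Poly_Mapping.single \<sigma> 1 =
    Poly_Mapping.single \<sigma> 1 \<cdot>\<^sub>S (row_col_sum E (r \<circ> \<sigma>) (c \<circ> \<sigma>) :: ('a::field_char_0) perm_comb)"
  unfolding row_col_sum_def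
  by (simp only: sym_mult_assoc sign_char.char_sum_conj[OF assms])
    (simp only: flip: sym_mult_assoc trivial_char.char_sum_conj[OF assms])

lemma perm_comb_eq_uminus_self:
  fixes f :: "('a::field_char_0) perm_comb"
  assumes "f = - f"
  shows "f = 0"
proof (rule poly_mapping_eqI)
  fix \<sigma>
  have "Poly_Mapping.lookup f \<sigma> = - Poly_Mapping.lookup f \<sigma>"
    using assms by (metis lookup_uminus)
  then show "Poly_Mapping.lookup f \<sigma> = Poly_Mapping.lookup 0 \<sigma>" by simp
qed

text \<open>The transposition of \<open>x\<close> and \<open>y\<close> is absorbed by the row sum
  with sign 1 and by the column sum with sign -1, so either product equals its own negative.\<close>

lemma common_transposition_zero:
  assumes fin: "finite E" "finite F" and "x \<noteq> y" "x \<in> E \<inter> F" "y \<in> E \<inter> F" "u x = u y" "v x = v y"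
  shows "row_sum E u \<cdot>\<^sub>S col_sum F v = (0 :: ('a::field_char_0) perm_comb)"
    and "col_sum F v \<cdot>\<^sub>S row_sum E u = (0 :: ('a::field_char_0) perm_comb)"
proof -
  let ?t = "Transposition.transpose x y"
  let ?T = "Poly_Mapping.single ?t 1 :: 'a perm_comb"
  let ?a = "row_sum E u :: 'a perm_comb" and ?b = "col_sum F v :: 'a perm_comb"
  have t: "?t \<in> stab E u" "?t \<in> stab F v" using assms by (auto intro: stab_transpose)
  have s: "sign ?t = -1" using assms by (simp add: sign_swap_id)
  have a: "?a \<cdot>\<^sub>S ?T = ?a" "?T \<cdot>\<^sub>S ?a = ?a"
    using trivial_char.char_sum_mult_single[OF fin(1) t(1), where 'a = 'a]
      trivial_char.single_mult_char_sum[OF fin(1) t(1), where 'a = 'a] by simp_all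
  have b: "?b \<cdot>\<^sub>S ?T = - ?b" "?T \<cdot>\<^sub>S ?b = - ?b"
    using sign_char.char_sum_mult_single[OF fin(2) t(2), where 'a = 'a]
      sign_char.single_mult_char_sum[OF fin(2) t(2), where 'a = 'a] s
    by (simp_all add: scale_uminus_left)
  have "?a \<cdot>\<^sub>S ?b = (?a \<cdot>\<^sub>S ?T) \<cdot>\<^sub>S ?b" by (simp only: a)
  also have "\<dots> = - (?a \<cdot>\<^sub>S ?b)" by (simp only: sym_mult_assoc b sym_mult_uminus_right)
  finally show "?a \<cdot>\<^sub>S ?b = 0" by (rule perm_comb_eq_uminus_self)
  have "?b \<cdot>\<^sub>S ?a = ?b \<cdot>\<^sub>S (?T \<cdot>\<^sub>S ?a)" by (simp only: a)
  also have "\<dots> = - (?b \<cdot>\<^sub>S ?a)" by (simp only: b sym_mult_uminus_left flip: sym_mult_assoc)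
  finally show "?b \<cdot>\<^sub>S ?a = 0" by (rule perm_comb_eq_uminus_self)
qed

text \<open>After any column permutation, the entries of \<open>X \<union> Y\<close> lie in the rows met by column \<open>j\<close>, so
  two of them share a row.\<close>

lemma garnir_relation:
  assumes f: "filling E r c" and j: "1 \<le> j" and X: "X \<subseteq> {x \<in> E. c x = j}" and Y: "Y \<subseteq> {x \<in> E. c x = Suc j}"
    and card: "card {x \<in> E. c x = j} < card X + card Y"
  shows "row_col_sum E r c \<cdot>\<^sub>S col_sum (X \<union> Y) (\<lambda>_. 0) = (0 :: ('a::field_char_0) perm_comb)"
proof -
  have fin: "finite E" using f by (rule filling_finite)
  have fXY: "finite X" "finite Y" by (rule finite_subset[OF X], simp add: fin) (rule finite_subset[OF Y], simp add: fin)
  have zero: "row_sum E r \<cdot>\<^sub>S (Poly_Mapping.single \<tau> 1 \<cdot>\<^sub>S col_sum (X \<union> Y) (\<lambda>_. 0)) = (0 :: 'a perm_comb)"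
    if t: "\<tau> \<in> stab E c" for \<tau>
  proof -
    have tp: "\<tau> permutes E" using t by (rule stab_permutes)
    have "(r \<circ> \<tau>) ` (X \<union> Y) \<subseteq> r ` {x \<in> E. c x = j}"
    proof clarify
      fix x assume x: "x \<in> X \<union> Y"
      then have xE: "x \<in> E" "\<tau> x \<in> E" using X Y permutes_in_image[OF tp] by auto
      show "(r \<circ> \<tau>) x \<in> r ` {x \<in> E. c x = j}"
      proof (cases "x \<in> X")
        case True
        then show ?thesis using X xE stab_eq'[OF t] by auto
      next
        case False
        with x have "x \<in> Y" by simp
        then have "c (\<tau> x) = Suc j" using Y stab_eq'[OF t] by auto
        \<comment> \<open>The left neighbour of the cell of \<open>\<tau> x\<close> puts the row of
          \<open>\<tau> x\<close> among the rows met by column \<open>j\<close>.\<close>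
        then obtain y where "y \<in> E" "r y = r (\<tau> x)" "c y = j"
          using filling_down[OF f xE(2), of "r (\<tau> x)" j] filling_pos[OF f xE(2)] j by auto
        then show ?thesis by (auto simp: image_iff intro!: exI[of _ y])
      qed
    qed
    then have "card ((r \<circ> \<tau>) ` (X \<union> Y)) \<le> card (r ` {x \<in> E. c x = j})"
      using fin by (intro card_mono) auto
    also have "\<dots> \<le> card {x \<in> E. c x = j}" using fin by (intro card_image_le) auto
    also have "\<dots> < card (X \<union> Y)"
    proof -
      have "X \<inter> Y = {}" using X Y by fastforce
      then show ?thesis using card fXY by (simp add: card_Un_disjoint)
    qed
    finally have "\<not> inj_on (r \<circ> \<tau>) (X \<union> Y)" by (rule pigeonhole)
    then obtain x y where xy: "x \<in> X \<union> Y" "y \<in> X \<union> Y" "x \<noteq> y" "(r \<circ> \<tau>) x = (r \<circ> \<tau>) y"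
      by (auto simp: inj_on_def)
    then have "row_sum E (r \<circ> \<tau>) \<cdot>\<^sub>S col_sum (X \<union> Y) (\<lambda>_. 0) = (0 :: 'a perm_comb)"
      using X Y fin fXY by (intro common_transposition_zero(1)[of _ _ x y]) auto
    then show ?thesis
      by (simp only: trivial_char.char_sum_conj[OF fin tp] sym_mult_assoc sym_mult_zero flip: sym_mult_assoc[of "row_sum E r"])
  qed
  have "row_col_sum E r c \<cdot>\<^sub>S col_sum (X \<union> Y) (\<lambda>_. 0) =
      (\<Sum>\<tau>\<in>stab E c. of_int (sign \<tau>) \<odot> (row_sum E r \<cdot>\<^sub>S (Poly_Mapping.single \<tau> 1 \<cdot>\<^sub>S (col_sum (X \<union> Y) (\<lambda>_. 0) :: 'a perm_comb))))"
    unfolding row_col_sum_def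
    by (subst (2) char_sum_def, subst single_eq_scale)
      (simp only: sym_mult_sum_left sym_mult_sum_right scale_mult_left scale_mult_right sym_mult_assoc)
  then show ?thesis using zero by simp
qed

section \<open>Straightening\<close>

text \<open>\<open>X\<close> sits in the left column and carries the larger weights, so exchanging
  \<open>z\<close> in \<open>X\<close> with \<open>z'\<close> in \<open>Y\<close> raises the total
  by \<open>w z - w z'\<close>. If nothing is gained, the two weights agree and
  \<open>col_sum E w\<close> absorbs the transposition. A permutation without exchanges preserves
  the columns and is absorbed by \<open>g\<close>. The induction undoes one exchange at a
  time.\<close>

lemma garnir_exchange:
  fixes g :: "('a::field_char_0) perm_comb"
  assumes fin: "finite E" and X: "X \<subseteq> {x \<in> E. c x = j}" and Y: "Y \<subseteq> {x \<in> E. c x = Suc j}"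
    and alt: "\<And>\<tau>. \<tau> \<in> stab E c \<Longrightarrow> g \<cdot>\<^sub>S Poly_Mapping.single \<tau> 1 = of_int (sign \<tau>) \<odot> g"
    and wt: "\<And>x y. x \<in> X \<Longrightarrow> y \<in> Y \<Longrightarrow> w y \<le> w x"
    and rho: "\<rho> permutes X \<union> Y"
  shows "(\<Sum>x\<in>E. c x * w x) \<le> (\<Sum>x\<in>E. c (\<rho> x) * w x) \<and>
    ((\<Sum>x\<in>E. c (\<rho> x) * w x) = (\<Sum>x\<in>E. c x * w x) \<longrightarrow>
     of_int (sign \<rho>) \<odot> (g \<cdot>\<^sub>S (Poly_Mapping.single \<rho> 1 \<cdot>\<^sub>S col_sum E w)) = g \<cdot>\<^sub>S col_sum E w)"
  using rho
proof (induction "card {x \<in> X. \<rho> x \<in> Y}" arbitrary: \<rho> rule: less_induct)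
  case (less \<rho>)
  have disj: "X \<inter> Y = {}" using X Y by fastforce
  have fXY: "finite X" "finite Y" by (rule finite_subset[OF X], simp add: fin) (rule finite_subset[OF Y], simp add: fin)
  have XYE: "X \<union> Y \<subseteq> E" using X Y by auto
  have rE: "\<rho> permutes E" using less.prems XYE by (rule permutes_subset)
  have inj: "inj \<rho>" using less.prems by (rule permutes_inj)
  have in_XY: "\<rho> x \<in> X \<union> Y \<longleftrightarrow> x \<in> X \<union> Y" for x using less.prems by (rule permutes_in_image)
  show ?case
  proof (cases "{x \<in> X. \<rho> x \<in> Y} = {}")
    case True
    then have XX: "\<rho> ` X \<subseteq> X" using in_XY by auto
    have "inj_on \<rho> X" using inj by (rule inj_on_subset) simp
    then have imX: "\<rho> ` X = X" using XX fXY by (simp add: endo_inj_surj)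
    have YY: "\<rho> y \<in> Y" if "y \<in> Y" for y
    proof (rule ccontr)
      assume "\<rho> y \<notin> Y"
      then have "\<rho> y \<in> \<rho> ` X" using in_XY that imX by auto
      then show False using inj disj that by (auto simp: inj_def)
    qed
    have cX: "c x = j" if "x \<in> X" for x using that X by blast
    have cY: "c x = Suc j" if "x \<in> Y" for x using that Y by blast
    have cr: "c (\<rho> x) = c x" for x
    proof -
      consider "x \<in> X" | "x \<in> Y" | "\<rho> x = x" using less.prems permutes_not_in by fastforce
      then show ?thesis
      proof cases
        case 1
        then have "\<rho> x \<in> X" using XX by auto
        then show ?thesis using 1 by (simp add: cX)
      next
        case 2
        then have "\<rho> x \<in> Y" by (rule YY)
        then show ?thesis using 2 by (simp add: cY)
      qed simp
    qed
    then have "\<rho> \<in> stab E c" using rE by (simp add: stab_def)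
    then have "g \<cdot>\<^sub>S (Poly_Mapping.single \<rho> 1 \<cdot>\<^sub>S col_sum E w) = of_int (sign \<rho>) \<odot> (g \<cdot>\<^sub>S col_sum E w)"
      by (simp only: alt scale_mult_left flip: sym_mult_assoc)
    then show ?thesis using cr by (simp add: sign_char.char_square_of_int)
  next
    case False
    then obtain z where z: "z \<in> X" "\<rho> z \<in> Y" by auto
    obtain z' where z': "z' \<in> Y" "\<rho> z' \<in> X"
    proof (rule ccontr)
      assume "\<not> thesis"
      then have "\<rho> ` Y \<subseteq> Y" using that in_XY by auto
      moreover have "inj_on \<rho> Y" using inj by (rule inj_on_subset) simp
      ultimately have "\<rho> ` Y = Y" using fXY by (simp add: endo_inj_surj)
      then have "\<rho> z \<in> \<rho> ` Y" using z by simp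
      then show False using inj z disj by (auto simp: inj_def)
    qed
    let ?t = "Transposition.transpose z z'"
    let ?r = "\<rho> \<circ> ?t"
    have ne: "z \<noteq> z'" using z z' disj by auto
    have zE: "z \<in> E" "z' \<in> E" using z z' XYE by auto
    have tp: "?t permutes X \<union> Y" using z z' by (intro permutes_swap_id) auto
    have perm: "permutation \<rho>" "permutation ?t"
      using permutes_imp_permutation[OF fin rE] permutation_swap_id by simp_all
    have sub: "{x \<in> X. ?r x \<in> Y} \<subset> {x \<in> X. \<rho> x \<in> Y}"
    proof -
      have "x \<in> {x \<in> X. \<rho> x \<in> Y} - {z}" if x: "x \<in> X" "?r x \<in> Y" for x
      proof -
        have "x \<noteq> z" using x(2) z' disj by auto
        moreover have "x \<noteq> z'" using x(1) z' disj by auto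
        ultimately show ?thesis using x by (simp add: transpose_def)
      qed
      then have "{x \<in> X. ?r x \<in> Y} \<subseteq> {x \<in> X. \<rho> x \<in> Y} - {z}" by blast
      then show ?thesis using z by blast
    qed
    then have "card {x \<in> X. ?r x \<in> Y} < card {x \<in> X. \<rho> x \<in> Y}"
      using fXY by (intro psubset_card_mono) auto
    note IH = less.hyps[OF this permutes_compose[OF tp less.prems]]
    have split: "(\<Sum>x\<in>E. c (q x) * w x) = c (q z) * w z + c (q z') * w z' + (\<Sum>x\<in>E - {z, z'}. c (q x) * w x)" for q
    proof -
      have "(\<Sum>x\<in>E. c (q x) * w x) = (\<Sum>x\<in>{z, z'}. c (q x) * w x) + (\<Sum>x\<in>E - {z, z'}. c (q x) * w x)"
        using sum.subset_diff[of "{z, z'}" E "\<lambda>x. c (q x) * w x"] fin zE by simp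
      then show ?thesis using ne by simp
    qed
    have rest: "(\<Sum>x\<in>E - {z, z'}. c (?r x) * w x) = (\<Sum>x\<in>E - {z, z'}. c (\<rho> x) * w x)"
      by (rule sum.cong) (auto simp: transpose_def)
    have cz: "c (\<rho> z) = Suc j" "c (\<rho> z') = j" using z z' X Y by auto
    have key: "(\<Sum>x\<in>E. c (\<rho> x) * w x) + w z' = (\<Sum>x\<in>E. c (?r x) * w x) + w z"
      unfolding split[of \<rho>] split[of ?r] rest using cz by simp
    have le: "w z' \<le> w z" using wt z z' by blast
    show ?thesis
    proof (intro conjI impI)
      show "(\<Sum>x\<in>E. c x * w x) \<le> (\<Sum>x\<in>E. c (\<rho> x) * w x)" using IH key le by linarith
      assume eq: "(\<Sum>x\<in>E. c (\<rho> x) * w x) = (\<Sum>x\<in>E. c x * w x)"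
      then have w: "w z' = w z" and eq': "(\<Sum>x\<in>E. c (?r x) * w x) = (\<Sum>x\<in>E. c x * w x)"
        using IH key le by linarith+
      have t: "?t \<in> stab E w" using zE w by (intro stab_transpose) auto
      have s: "sign ?r = - sign \<rho>" using perm ne by (simp add: sign_compose sign_swap_id)
      have "Poly_Mapping.single ?r 1 \<cdot>\<^sub>S col_sum E w =
          Poly_Mapping.single \<rho> 1 \<cdot>\<^sub>S (Poly_Mapping.single ?t 1 \<cdot>\<^sub>S (col_sum E w :: 'a perm_comb))"
        by (simp flip: sym_mult_assoc)
      also have "\<dots> = - (Poly_Mapping.single \<rho> 1 \<cdot>\<^sub>S col_sum E w)"
        using ne by (simp add: sign_char.single_mult_char_sum[OF fin t] sign_swap_id scale_uminus_left sym_mult_uminus_right)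
      finally have "Poly_Mapping.single ?r 1 \<cdot>\<^sub>S col_sum E w = - (Poly_Mapping.single \<rho> 1 \<cdot>\<^sub>S (col_sum E w :: 'a perm_comb))" .
      then show "of_int (sign \<rho>) \<odot> (g \<cdot>\<^sub>S (Poly_Mapping.single \<rho> 1 \<cdot>\<^sub>S col_sum E w)) = g \<cdot>\<^sub>S col_sum E w"
        using IH eq' s by (simp add: sym_mult_uminus_right scale_uminus_left scale_uminus_right)
    qed
  qed
qed

text \<open>Induct on the total weight \<open>\<Sum> c(\<sigma> x) w(x)\<close>: a Garnir relation at a row descent rewrites
  the product through products of larger total weight, the terms of equal weight all contributing
  with the same sign. Sorting the columns first makes the two halves of the Garnir set comparable.\<close>

lemma straightening:
  fixes g :: "('a::field_char_0) perm_comb"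
  assumes f: "filling E r c" and w: "\<And>x. x \<in> E \<Longrightarrow> 1 \<le> w x" and V: "lin_closed V"
    and alt: "\<And>\<tau>. \<tau> \<in> stab E c \<Longrightarrow> g \<cdot>\<^sub>S Poly_Mapping.single \<tau> 1 = of_int (sign \<tau>) \<odot> g"
    and garnir: "\<And>\<sigma> X Y j. \<sigma> permutes E \<Longrightarrow> 1 \<le> j \<Longrightarrow> X \<subseteq> {x \<in> E. c (\<sigma> x) = j} \<Longrightarrow>
      Y \<subseteq> {x \<in> E. c (\<sigma> x) = Suc j} \<Longrightarrow> card {x \<in> E. c (\<sigma> x) = j} < card X + card Y \<Longrightarrow>
      g \<cdot>\<^sub>S (Poly_Mapping.single \<sigma> 1 \<cdot>\<^sub>S (col_sum (X \<union> Y) (\<lambda>_. 0) \<cdot>\<^sub>S col_sum E w)) \<in> V"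
    and base: "\<And>\<sigma>. \<sigma> permutes E \<Longrightarrow> (\<And>x. x \<in> E \<Longrightarrow> c (\<sigma> x) \<le> w x) \<Longrightarrow>
      g \<cdot>\<^sub>S (Poly_Mapping.single \<sigma> 1 \<cdot>\<^sub>S col_sum E w) \<in> V"
    and s: "\<sigma> permutes E"
  shows "g \<cdot>\<^sub>S (Poly_Mapping.single \<sigma> 1 \<cdot>\<^sub>S col_sum E w) \<in> V"
proof -
  have fin: "finite E" using f by (rule filling_finite)
  \<comment> \<open>\<open>P c\<close> is the total weight. \<open>P r\<close> breaks ties: it grows
    when a column is sorted, which leaves \<open>P c\<close> unchanged. Both are bounded by
    \<open>B\<close>, so the differences can serve as measures.\<close>
  define P where "P = (\<lambda>(v :: nat \<Rightarrow> nat) \<sigma>. \<Sum>x\<in>E. v (\<sigma> x) * w x)"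
  define B where "B = (\<lambda>v :: nat \<Rightarrow> nat. sum v E * sum w E)"
  have bound: "P v \<sigma> \<le> B v" if "\<sigma> permutes E" for v \<sigma>
    unfolding P_def B_def sum_distrib_left
    by (intro sum_mono mult_right_mono member_le_sum) (use that fin in \<open>auto simp: permutes_in_image\<close>)
  show ?thesis using s
  proof (induction \<sigma> rule: wf_induct_rule[OF wf_measures[of "[\<lambda>\<sigma>. B c - P c \<sigma>, \<lambda>\<sigma>. B r - P r \<sigma>]"]])
    case (1 \<sigma>)
    note s = 1(2)
    have IH: "g \<cdot>\<^sub>S (Poly_Mapping.single \<tau> 1 \<cdot>\<^sub>S col_sum E w) \<in> V"
      if "\<tau> permutes E" "P c \<sigma> < P c \<tau> \<or> P c \<sigma> = P c \<tau> \<and> P r \<sigma> < P r \<tau>" for \<tau>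
    proof -
      have "P c \<tau> \<le> B c" "P r \<tau> \<le> B r" using that(1) by (simp_all add: bound)
      then show ?thesis using that by (intro 1(1)) auto
    qed
    have sE: "\<sigma> x \<in> E \<longleftrightarrow> x \<in> E" for x using s by (rule permutes_in_image)
    have sinj: "\<sigma> x = \<sigma> y \<longleftrightarrow> x = y" for x y using permutes_inj[OF s] by (auto simp: inj_def)
    show ?case
    proof (cases "\<exists>x\<in>E. \<exists>y\<in>E. c (\<sigma> x) = c (\<sigma> y) \<and> r (\<sigma> x) < r (\<sigma> y) \<and> w y < w x")
      case True
      then obtain x y where xy: "x \<in> E" "y \<in> E" "c (\<sigma> x) = c (\<sigma> y)" "r (\<sigma> x) < r (\<sigma> y)" "w y < w x" by auto
      let ?t = "Transposition.transpose x y" and ?t' = "Transposition.transpose (\<sigma> x) (\<sigma> y)"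
      have ne: "x \<noteq> y" using xy by auto
      \<comment> \<open>Seen from the left, the swap transposes two elements of one column of
        \<open>c\<close>, so \<open>g\<close> absorbs it with sign -1.\<close>
      have st: "\<sigma> \<circ> ?t = ?t' \<circ> \<sigma>" by (auto simp: fun_eq_iff transpose_def sinj)
      have p: "\<sigma> \<circ> ?t permutes E" using s xy by (intro permutes_compose permutes_swap_id)
      have split: "P v q = v (q x) * w x + v (q y) * w y + (\<Sum>z\<in>E - {x, y}. v (q z) * w z)" for v q
      proof -
        have "P v q = (\<Sum>z\<in>{x, y}. v (q z) * w z) + (\<Sum>z\<in>E - {x, y}. v (q z) * w z)"
          unfolding P_def using sum.subset_diff[of "{x, y}" E "\<lambda>x. v (q x) * w x"] fin xy by simp
        then show ?thesis using ne by simp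
      qed
      have rest: "(\<Sum>z\<in>E - {x, y}. v ((\<sigma> \<circ> ?t) z) * w z) = (\<Sum>z\<in>E - {x, y}. v (\<sigma> z) * w z)" for v
        by (rule sum.cong) (auto simp: transpose_def)
      have "P c (\<sigma> \<circ> ?t) = P c \<sigma>" unfolding split rest using xy by simp
      moreover have "P r \<sigma> < P r (\<sigma> \<circ> ?t)"
      proof -
        \<comment> \<open>As in the rearrangement inequality, the swap raises \<open>P r\<close> by
          exactly \<open>d * e\<close>.\<close>
        obtain d e where de: "r (\<sigma> y) = r (\<sigma> x) + d" "w x = w y + e" "0 < d" "0 < e"
          using xy by (metis add_diff_inverse_nat less_imp_le_nat not_less zero_less_diff)
        have "0 < d * e" using de by simp
        then show ?thesis unfolding split rest by (simp add: de algebra_simps)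
      qed
      ultimately have "g \<cdot>\<^sub>S (Poly_Mapping.single (\<sigma> \<circ> ?t) 1 \<cdot>\<^sub>S col_sum E w) \<in> V"
        using p by (intro IH) auto
      moreover have "g \<cdot>\<^sub>S (Poly_Mapping.single (\<sigma> \<circ> ?t) 1 \<cdot>\<^sub>S col_sum E w) = - (g \<cdot>\<^sub>S (Poly_Mapping.single \<sigma> 1 \<cdot>\<^sub>S col_sum E w))"
      proof -
        have t': "?t' \<in> stab E c" using xy sE by (intro stab_transpose) auto
        have "g \<cdot>\<^sub>S (Poly_Mapping.single (\<sigma> \<circ> ?t) 1 \<cdot>\<^sub>S col_sum E w) =
            (g \<cdot>\<^sub>S Poly_Mapping.single ?t' 1) \<cdot>\<^sub>S (Poly_Mapping.single \<sigma> 1 \<cdot>\<^sub>S col_sum E w)"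
          unfolding st by (simp flip: sym_mult_assoc) (simp add: sym_mult_assoc)
        then show ?thesis
          using alt[OF t'] ne sinj by (simp add: sign_swap_id scale_uminus_left sym_mult_uminus_left)
      qed
      ultimately show ?thesis using lin_closed_uminus[OF V] by fastforce
    next
      case sorted: False
      show ?thesis
      proof (cases "\<exists>x\<in>E. \<exists>y\<in>E. r (\<sigma> x) = r (\<sigma> y) \<and> c (\<sigma> y) = Suc (c (\<sigma> x)) \<and> w y \<le> w x")
        case True
        then obtain a b where ab: "a \<in> E" "b \<in> E" "r (\<sigma> a) = r (\<sigma> b)" "c (\<sigma> b) = Suc (c (\<sigma> a))" "w b \<le> w a" by auto
        define i j where "i = r (\<sigma> a)" and "j = c (\<sigma> a)"
        \<comment> \<open>The Garnir set at the descent: column \<open>j\<close> from row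
          \<open>i\<close> downwards and column \<open>j + 1\<close> down to row \<open>i\<close>.
          In sorted columns the weights on \<open>X\<close> are at least \<open>w a\<close> and
          those on \<open>Y\<close> at most \<open>w b\<close>.\<close>
        define X Y where "X = {x \<in> E. c (\<sigma> x) = j \<and> i \<le> r (\<sigma> x)}" and "Y = {x \<in> E. c (\<sigma> x) = Suc j \<and> r (\<sigma> x) \<le> i}"
        have ij: "1 \<le> i" "1 \<le> j" using filling_pos[OF f, of "\<sigma> a"] ab sE by (auto simp: i_def j_def)
        have wt: "w y \<le> w x" if "x \<in> X" "y \<in> Y" for x y
        proof -
          have x: "x \<in> E" "c (\<sigma> x) = c (\<sigma> a)" "r (\<sigma> a) \<le> r (\<sigma> x)"
            and y: "y \<in> E" "c (\<sigma> y) = c (\<sigma> b)" "r (\<sigma> y) \<le> r (\<sigma> b)"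
            using that ab(3,4) by (simp_all add: X_def Y_def i_def j_def)
          have "w a \<le> w x"
          proof (cases "r (\<sigma> x) = r (\<sigma> a)")
            case True
            then have "\<sigma> x = \<sigma> a" using filling_eqD[OF f] x ab(1,2) sE by metis
            then show ?thesis by (simp add: sinj)
          next
            case False
            then show ?thesis using sorted x ab(1,2) by (metis not_le le_neq_implies_less)
          qed
          moreover have "w y \<le> w b"
          proof (cases "r (\<sigma> y) = r (\<sigma> b)")
            case True
            then have "\<sigma> y = \<sigma> b" using filling_eqD[OF f] y ab(1,2) sE by metis
            then show ?thesis by (simp add: sinj)
          next
            case False
            then show ?thesis using sorted y ab(1,2) by (metis not_le le_neq_implies_less)
          qed
          ultimately show ?thesis using ab by linarith
        qed
        have fX: "finite X" "finite Y" using fin by (auto simp: X_def Y_def)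
        \<comment> \<open>Fewer than \<open>i\<close> cells of column \<open>j\<close> lie above row
          \<open>i\<close>, while column \<open>j + 1\<close> has \<open>i\<close> cells down to row
          \<open>i\<close>; replacing the former by the latter gains at least one element.\<close>
        have card: "card {x \<in> E. c (\<sigma> x) = j} < card X + card Y"
        proof -
          let ?Z = "{x \<in> E. c (\<sigma> x) = j \<and> r (\<sigma> x) < i}"
          have "card ?Z \<le> card {1..<i}"
          proof (rule card_inj_on_le[where f = "r \<circ> \<sigma>"])
            show "inj_on (r \<circ> \<sigma>) ?Z"
            proof (rule inj_onI)
              fix x y assume "x \<in> ?Z" "y \<in> ?Z" "(r \<circ> \<sigma>) x = (r \<circ> \<sigma>) y"
              then have "\<sigma> x \<in> E" "\<sigma> y \<in> E" "r (\<sigma> x) = r (\<sigma> y)" "c (\<sigma> x) = c (\<sigma> y)"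
                using sE by simp_all
              then have "\<sigma> x = \<sigma> y" by (rule filling_eqD[OF f])
              then show "x = y" by (simp add: sinj)
            qed
            show "(r \<circ> \<sigma>) ` ?Z \<subseteq> {1..<i}" using filling_pos[OF f] sE by auto
          qed simp
          moreover have "card {1..i} \<le> card Y"
          proof (rule surj_card_le[where f = "r \<circ> \<sigma>"])
            show "{1..i} \<subseteq> (r \<circ> \<sigma>) ` Y"
            proof
              fix i' assume i': "i' \<in> {1..i}"
              obtain y where y: "y \<in> E" "r y = i'" "c y = Suc j"
                using filling_down[OF f, of "\<sigma> b" i' "Suc j"] ab sE i' by (auto simp: i_def j_def)
              then have "inv \<sigma> y \<in> Y"
                using i' permutes_inverses[OF s] by (auto simp: Y_def permutes_in_image[OF permutes_inv[OF s]])
              then show "i' \<in> (r \<circ> \<sigma>) ` Y" using y permutes_inverses(1)[OF s] by (intro image_eqI[of _ _ "inv \<sigma> y"]) simp_all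
            qed
          qed (rule fX)
          moreover have "card {x \<in> E. c (\<sigma> x) = j} = card ?Z + card X"
          proof -
            have "{x \<in> E. c (\<sigma> x) = j} = ?Z \<union> X" "?Z \<inter> X = {}" by (auto simp: X_def)
            then show ?thesis using fin fX by (simp add: card_Un_disjoint)
          qed
          ultimately show ?thesis using ij by simp
        qed
        let ?g = "g \<cdot>\<^sub>S Poly_Mapping.single \<sigma> 1"
        let ?H = "{\<rho>. \<rho> permutes X \<union> Y}"
        have XY: "X \<subseteq> {x \<in> E. (c \<circ> \<sigma>) x = j}" "Y \<subseteq> {x \<in> E. (c \<circ> \<sigma>) x = Suc j}" by (auto simp: X_def Y_def)
        have alt': "?g \<cdot>\<^sub>S Poly_Mapping.single \<tau> 1 = of_int (sign \<tau>) \<odot> ?g" if t: "\<tau> \<in> stab E (c \<circ> \<sigma>)" for \<tau>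
        proof -
          let ?u = "\<sigma> \<circ> \<tau> \<circ> inv \<sigma>"
          have tp: "\<tau> permutes E" using t by (rule stab_permutes)
          have pp: "permutation \<sigma>" "permutation \<tau>" "permutation (inv \<sigma>)"
            using permutes_imp_permutation[OF fin] s tp permutes_inv[OF s] by simp_all
          have "c (\<sigma> (\<tau> x)) = c (\<sigma> x)" for x using stab_eq'[OF t, of x] by simp
          then have u: "?u \<in> stab E c"
            by (auto intro!: stabI permutes_compose s tp permutes_inv[OF s] simp: permutes_inverses[OF s])
          have su: "sign ?u = sign \<tau>"
            using pp by (simp add: sign_compose permutation_compose sign_inverse mult.commute flip: mult.assoc)
          have "?u \<circ> \<sigma> = \<sigma> \<circ> \<tau>" using permutes_inv_o[OF s] by (simp add: o_assoc[symmetric])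
          then have "?g \<cdot>\<^sub>S Poly_Mapping.single \<tau> 1 = (g \<cdot>\<^sub>S Poly_Mapping.single ?u 1) \<cdot>\<^sub>S Poly_Mapping.single \<sigma> 1"
            by (simp add: sym_mult_assoc)
          then show ?thesis by (simp only: alt[OF u] su scale_mult_left)
        qed
        have Pr: "(\<Sum>x\<in>E. (c \<circ> \<sigma>) (\<rho> x) * w x) = P c (\<sigma> \<circ> \<rho>)" "(\<Sum>x\<in>E. (c \<circ> \<sigma>) x * w x) = P c \<sigma>" for \<rho>
          by (simp_all add: P_def)
        have exch: "P c \<sigma> \<le> P c (\<sigma> \<circ> \<rho>) \<and> (P c (\<sigma> \<circ> \<rho>) = P c \<sigma> \<longrightarrow>
            of_int (sign \<rho>) \<odot> (?g \<cdot>\<^sub>S (Poly_Mapping.single \<rho> 1 \<cdot>\<^sub>S col_sum E w)) = ?g \<cdot>\<^sub>S col_sum E w)"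
          if "\<rho> permutes X \<union> Y" for \<rho>
          using garnir_exchange[where w = w, OF fin XY alt' wt that] unfolding Pr(1)[of \<rho>] Pr(2) by blast
        define G where "G = {\<rho> \<in> ?H. P c (\<sigma> \<circ> \<rho>) = P c \<sigma>}"
        have finH: "finite ?H" using fX by (intro finite_permutations) auto
        have "?g \<cdot>\<^sub>S (col_sum (X \<union> Y) (\<lambda>_. 0) \<cdot>\<^sub>S col_sum E w) \<in> V"
          using garnir[OF s ij(2) _ _ card] XY by (simp add: sym_mult_assoc)
        also have "?g \<cdot>\<^sub>S (col_sum (X \<union> Y) (\<lambda>_. 0) \<cdot>\<^sub>S col_sum E w) =
            (\<Sum>\<rho>\<in>?H. of_int (sign \<rho>) \<odot> (?g \<cdot>\<^sub>S (Poly_Mapping.single \<rho> 1 \<cdot>\<^sub>S col_sum E w)))"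
          unfolding stab_const
          by (subst (1) char_sum_def, subst single_eq_scale)
            (simp only: sym_mult_sum_left sym_mult_sum_right scale_mult_left scale_mult_right)
        also have "\<dots> = (\<Sum>\<rho>\<in>?H - G. of_int (sign \<rho>) \<odot> (?g \<cdot>\<^sub>S (Poly_Mapping.single \<rho> 1 \<cdot>\<^sub>S col_sum E w))) +
            (\<Sum>\<rho>\<in>G. of_int (sign \<rho>) \<odot> (?g \<cdot>\<^sub>S (Poly_Mapping.single \<rho> 1 \<cdot>\<^sub>S col_sum E w)))"
          by (rule sum.subset_diff) (use finH in \<open>auto simp: G_def\<close>)
        also have "(\<Sum>\<rho>\<in>G. of_int (sign \<rho>) \<odot> (?g \<cdot>\<^sub>S (Poly_Mapping.single \<rho> 1 \<cdot>\<^sub>S col_sum E w))) =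
            of_nat (card G) \<odot> (?g \<cdot>\<^sub>S col_sum E w)"
          unfolding sum_constant_scale[symmetric]
          by (rule sum.cong) (use exch in \<open>auto simp: G_def\<close>)
        finally have total: "(\<Sum>\<rho>\<in>?H - G. of_int (sign \<rho>) \<odot> (?g \<cdot>\<^sub>S (Poly_Mapping.single \<rho> 1 \<cdot>\<^sub>S col_sum E w))) +
            of_nat (card G) \<odot> (?g \<cdot>\<^sub>S col_sum E w) \<in> V" .
        have bad: "(\<Sum>\<rho>\<in>?H - G. of_int (sign \<rho>) \<odot> (?g \<cdot>\<^sub>S (Poly_Mapping.single \<rho> 1 \<cdot>\<^sub>S col_sum E w))) \<in> V"
        proof (intro lin_closed_sum[OF V] lin_closed_scale[OF V])
          fix \<rho> assume r: "\<rho> \<in> ?H - G"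
          then have rp: "\<rho> permutes X \<union> Y" by simp
          have "\<rho> permutes E" using rp by (rule permutes_subset) (use XY in auto)
          then have "\<sigma> \<circ> \<rho> permutes E" using s by (rule permutes_compose)
          moreover have "P c \<sigma> < P c (\<sigma> \<circ> \<rho>)" using exch[OF rp] r by (auto simp: G_def)
          ultimately have "g \<cdot>\<^sub>S (Poly_Mapping.single (\<sigma> \<circ> \<rho>) 1 \<cdot>\<^sub>S col_sum E w) \<in> V" by (intro IH) auto
          then show "?g \<cdot>\<^sub>S (Poly_Mapping.single \<rho> 1 \<cdot>\<^sub>S col_sum E w) \<in> V"
            by (simp add: sym_mult_assoc) (simp flip: sym_mult_assoc)
        qed
        have "of_nat (card G) \<odot> (?g \<cdot>\<^sub>S col_sum E w) \<in> V"
          using lin_closed_diff[OF V total bad] by simp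
        moreover have "of_nat (card G) \<noteq> (0 :: 'a)"
        proof -
          have "id \<in> G" by (simp add: G_def permutes_id)
          moreover have "finite G" using finH by (rule rev_finite_subset) (auto simp: G_def)
          ultimately have "card G \<noteq> 0" by auto
          then show ?thesis by simp
        qed
        ultimately have "?g \<cdot>\<^sub>S col_sum E w \<in> V" by (rule lin_closed_cancel_scale[OF V])
        then show ?thesis by (simp add: sym_mult_assoc)
      next
        case strict: False
        \<comment> \<open>No descent is left: weights increase strictly along each row and start at
          1 or more, so an entry in column \<open>m\<close> has weight at least
          \<open>m\<close>.\<close>
        have "c (\<sigma> x) = m \<Longrightarrow> x \<in> E \<Longrightarrow> m \<le> w x" for x m
        proof (induction m arbitrary: x)
          case (Suc m)
          show ?case
          proof (cases "m = 0")
            case True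
            then show ?thesis using w Suc by simp
          next
            case False
            then obtain y where y: "y \<in> E" "r y = r (\<sigma> x)" "c y = m"
              using filling_down[OF f, of "\<sigma> x" "r (\<sigma> x)" m] filling_pos[OF f, of "\<sigma> x"] Suc.prems sE by auto
            let ?y = "inv \<sigma> y"
            have y': "?y \<in> E" "\<sigma> ?y = y"
              using y permutes_inverses[OF s] by (auto simp: permutes_in_image[OF permutes_inv[OF s]])
            then have "m \<le> w ?y" using Suc.IH[of ?y] y by simp
            moreover have "w ?y < w x" using strict y y' Suc.prems by (force simp: not_le)
            ultimately show ?thesis by simp
          qed
        qed simp
        then show ?thesis using base[OF s] by blast
      qed
    qed
  qed
qed

section \<open>Quasi-idempotence\<close>

text \<open>The anti-involution that inverts permutations, written through
  \<open>bilinear_ext\<close> with a dummy second factor so that additivity is inherited.\<close>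

definition adjoint :: "('a::field) perm_comb \<Rightarrow> 'a perm_comb" where
  "adjoint f = bilinear_ext (\<lambda>\<sigma> (_ :: nat \<Rightarrow> nat). inv \<sigma>) f (Poly_Mapping.single id 1)"

lemma adjoint_add: "adjoint (f + g) = adjoint f + adjoint g"
  by (simp add: adjoint_def bilinear_ext_add_left)

lemma adjoint_zero [simp]: "adjoint 0 = 0"
  by (simp add: adjoint_def)

lemma adjoint_single [simp]: "adjoint (Poly_Mapping.single \<sigma> a) = Poly_Mapping.single (inv \<sigma>) a"
  by (simp add: adjoint_def)

lemma adjoint_sum: "adjoint (sum F A) = (\<Sum>x\<in>A. adjoint (F x))"
  by (induction A rule: infinite_finite_induct) (simp_all add: adjoint_add)

lemma keys_sum_subset:
  fixes F :: "'b \<Rightarrow> ('c \<Rightarrow>\<^sub>0 'a::comm_monoid_add)"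
  shows "Poly_Mapping.keys (sum F A) \<subseteq> (\<Union>x\<in>A. Poly_Mapping.keys (F x))"
proof (induction A rule: infinite_finite_induct)
  case (insert x A)
  then show ?case using Poly_Mapping.keys_add[of "F x" "sum F A"] by auto
qed simp_all

text \<open>The type of combinations admits arbitrary functions as keys, whereas reversing a
  composition by \<open>inv\<close> needs bijections.\<close>

definition bij_keys :: "('a::field) perm_comb \<Rightarrow> bool" where
  "bij_keys f \<longleftrightarrow> (\<forall>\<sigma>\<in>Poly_Mapping.keys f. bij \<sigma>)"

lemma bij_keys_char_sum: "bij_keys (char_sum \<chi> (stab E v) :: ('a::field_char_0) perm_comb)"
proof -
  have "Poly_Mapping.keys (char_sum \<chi> (stab E v) :: 'a perm_comb) \<subseteq>
      (\<Union>\<sigma>\<in>stab E v. Poly_Mapping.keys (Poly_Mapping.single \<sigma> (of_int (\<chi> \<sigma>) :: 'a)))"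
    unfolding char_sum_def by (rule keys_sum_subset)
  also have "\<dots> \<subseteq> stab E v" by auto
  finally show ?thesis unfolding bij_keys_def by (auto dest!: stab_permutes subsetD intro: permutes_bij)
qed

lemma bij_keys_mult:
  assumes "bij_keys f" "bij_keys g"
  shows "bij_keys (f \<cdot>\<^sub>S g)"
proof -
  have "Poly_Mapping.keys (f \<cdot>\<^sub>S g) \<subseteq> (\<Union>\<sigma>\<in>Poly_Mapping.keys f. \<Union>\<tau>\<in>Poly_Mapping.keys g. {\<sigma> \<circ> \<tau>})"
    unfolding sym_mult_def bilinear_ext_def
    by (rule order_trans[OF keys_sum_subset] UN_mono order_refl)+ auto
  then show ?thesis using assms by (force simp: bij_keys_def intro: bij_comp)
qed

lemma adjoint_mult:
  assumes "bij_keys f" "bij_keys g"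
  shows "adjoint (f \<cdot>\<^sub>S g) = adjoint g \<cdot>\<^sub>S adjoint f"
proof (induction f rule: perm_comb_induct)
  case (single \<sigma> a)
  show ?case
  proof (induction g rule: perm_comb_induct)
    case s2: (single \<tau> b)
    have "bij \<sigma>" "bij \<tau>" using single s2 assms by (auto simp: bij_keys_def)
    then show ?case by (simp add: o_inv_distrib mult.commute)
  qed (simp_all add: adjoint_add sym_mult_add_right sym_mult_add_left)
qed (simp_all add: adjoint_add sym_mult_add_right sym_mult_add_left)

lemma (in multiplicative_char) adjoint_char_sum:
  assumes "finite E"
  shows "adjoint (char_sum \<chi> (stab E v)) = (char_sum \<chi> (stab E v) :: ('a::field_char_0) perm_comb)"
proof -
  have bij: "bij_betw inv (stab E v) (stab E v)"
    by (rule bij_betw_byWitness[where f' = inv])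
      (auto simp: stab_inv permutes_inv_inv dest: stab_permutes)
  have chi: "\<chi> (inv \<sigma>) = \<chi> \<sigma>" if "\<sigma> \<in> stab E v" for \<sigma>
  proof -
    have p: "\<sigma> permutes E" using that by (rule stab_permutes)
    have pp: "permutation \<sigma>" "permutation (inv \<sigma>)"
      using permutes_imp_permutation[OF assms] p permutes_inv[OF p] by simp_all
    have "\<chi> \<sigma> * \<chi> (inv \<sigma>) = 1" using char_compose[OF pp] permutes_inv_o[OF p] char_id by simp
    then have "\<chi> \<sigma> * (\<chi> \<sigma> * \<chi> (inv \<sigma>)) = \<chi> \<sigma>" by simp
    then show ?thesis by (simp add: char_square flip: mult.assoc)
  qed
  have "adjoint (char_sum \<chi> (stab E v) :: 'a perm_comb) =
      (\<Sum>\<sigma>\<in>stab E v. Poly_Mapping.single (inv \<sigma>) (of_int (\<chi> (inv \<sigma>))))"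
    by (simp add: char_sum_def adjoint_sum chi)
  then show ?thesis
    using sum.reindex_bij_betw[OF bij, of "\<lambda>\<sigma>. Poly_Mapping.single \<sigma> (of_int (\<chi> \<sigma>) :: 'a)"]
    by (simp add: char_sum_def)
qed

text \<open>In a general field of characteristic zero a sum of nonzero squares may vanish; integral
  coefficients move the argument to the integers, where it cannot.\<close>

definition integral_comb :: "('a::field_char_0) perm_comb \<Rightarrow> bool" where
  "integral_comb f \<longleftrightarrow> (\<forall>\<sigma>. Poly_Mapping.lookup f \<sigma> \<in> \<int>)"

lemma integral_comb_char_sum: "integral_comb (char_sum \<chi> H)"
  by (auto simp: integral_comb_def char_sum_def lookup_sum lookup_single when_def intro!: Ints_sum)

lemma integral_comb_mult: "integral_comb f \<Longrightarrow> integral_comb g \<Longrightarrow> integral_comb (f \<cdot>\<^sub>S g)"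
  by (auto simp: integral_comb_def sym_mult_def bilinear_ext_def lookup_sum lookup_single when_def
      intro!: Ints_sum Ints_mult)

lemma mult_adjoint_eq_zero:
  fixes f :: "('a::field_char_0) perm_comb"
  assumes int: "integral_comb f" and bij: "bij_keys f" and zero: "f \<cdot>\<^sub>S adjoint f = 0"
  shows "f = 0"
proof -
  let ?K = "Poly_Mapping.keys f" and ?l = "Poly_Mapping.lookup f"
  have fin: "finite ?K" by simp
  have adj: "adjoint f = (\<Sum>\<tau>\<in>?K. Poly_Mapping.single (inv \<tau>) (?l \<tau>))"
    by (subst (1) poly_mapping_eq_sum_single) (simp add: adjoint_sum)
  have "f \<cdot>\<^sub>S adjoint f = (\<Sum>\<sigma>\<in>?K. \<Sum>\<tau>\<in>?K. Poly_Mapping.single (\<sigma> \<circ> inv \<tau>) (?l \<sigma> * ?l \<tau>))"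
    unfolding adj by (subst (1) poly_mapping_eq_sum_single[of f])
      (simp only: sym_mult_sum_left sym_mult_sum_right sym_mult_single, rule sum.swap)
  then have "0 = Poly_Mapping.lookup (\<Sum>\<sigma>\<in>?K. \<Sum>\<tau>\<in>?K. Poly_Mapping.single (\<sigma> \<circ> inv \<tau>) (?l \<sigma> * ?l \<tau>)) id"
    using zero by simp
  also have "\<dots> = (\<Sum>\<sigma>\<in>?K. \<Sum>\<tau>\<in>?K. if \<tau> = \<sigma> then ?l \<sigma> * ?l \<tau> else 0)"
    unfolding lookup_sum
  proof (intro sum.cong refl)
    fix \<sigma> \<tau> assume "\<sigma> \<in> ?K" "\<tau> \<in> ?K"
    then have b: "bij \<sigma>" "bij \<tau>" using bij by (auto simp: bij_keys_def)
    have "\<sigma> \<circ> inv \<tau> = id \<longleftrightarrow> \<tau> = \<sigma>"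
    proof
      assume "\<sigma> \<circ> inv \<tau> = id"
      then have "\<sigma> \<circ> (inv \<tau> \<circ> \<tau>) = \<tau>" by (simp add: o_assoc)
      then show "\<tau> = \<sigma>" using b by (simp add: bij_is_inj)
    qed (use b in \<open>simp add: bij_is_surj flip: surj_iff\<close>)
    then show "Poly_Mapping.lookup (Poly_Mapping.single (\<sigma> \<circ> inv \<tau>) (?l \<sigma> * ?l \<tau>)) id =
        (if \<tau> = \<sigma> then ?l \<sigma> * ?l \<tau> else 0)"
      by (simp add: lookup_single when_def)
  qed
  also have "\<dots> = (\<Sum>\<sigma>\<in>?K. ?l \<sigma> * ?l \<sigma>)" by simp
  finally have sq: "(\<Sum>\<sigma>\<in>?K. ?l \<sigma> * ?l \<sigma>) = 0" by simp
  obtain z where z: "?l \<sigma> = of_int (z \<sigma>)" for \<sigma>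
  proof -
    have "\<forall>\<sigma>. \<exists>z. ?l \<sigma> = of_int z" using int by (auto simp: integral_comb_def elim: Ints_cases)
    then show ?thesis using that by metis
  qed
  have "of_int (\<Sum>\<sigma>\<in>?K. z \<sigma> * z \<sigma>) = (0 :: 'a)" using sq by (simp add: z)
  then have "(\<Sum>\<sigma>\<in>?K. z \<sigma> * z \<sigma>) = 0" by (simp only: of_int_eq_0_iff)
  then have "\<forall>\<sigma>\<in>?K. z \<sigma> * z \<sigma> = 0" by (subst (asm) sum_nonneg_eq_0_iff) auto
  then have "?l \<sigma> = 0" for \<sigma> by (metis in_keys_iff mult_eq_0_iff of_int_0 z)
  then show "f = 0" by (intro poly_mapping_eqI) simp
qed

section \<open>Nonvanishing of a Young symmetrizer and of its square\<close>

lemma card_stab_nonzero: "finite E \<Longrightarrow> of_nat (card (stab E v)) \<noteq> (0 :: 'a::field_char_0)"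
  using stab_id[of E v] by (auto simp: card_eq_0_iff)

text \<open>Distinct entries never share both row and column, so the row group and the column group
  meet only in the identity. It therefore arises from exactly one pair, and its coefficient is
  1.\<close>

lemma row_col_sum_nonzero:
  assumes f: "filling E r c"
  shows "row_col_sum E r c \<noteq> (0 :: ('a::field_char_0) perm_comb)"
proof -
  have fin: "finite E" using f by (rule filling_finite)
  have iff: "\<sigma> \<circ> \<tau> = id \<longleftrightarrow> \<sigma> = id \<and> \<tau> = id" if s: "\<sigma> \<in> stab E r" and t: "\<tau> \<in> stab E c" for \<sigma> \<tau>
  proof
    assume eq: "\<sigma> \<circ> \<tau> = id"
    have tp: "\<tau> permutes E" using t by (rule stab_permutes)
    have "\<tau> x = x" for x
    proof (cases "x \<in> E")
      case True
      have "r (\<tau> x) = r x" using stab_eq'[OF s, of "\<tau> x"] eq by (metis comp_apply id_apply)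
      then show ?thesis
        using filling_eqD[OF f] True stab_eq'[OF t, of x] permutes_in_image[OF tp] by metis
    qed (use tp in \<open>simp add: permutes_not_in\<close>)
    then have "\<tau> = id" by (simp add: fun_eq_iff)
    then show "\<sigma> = id \<and> \<tau> = id" using eq by simp
  qed simp
  have "Poly_Mapping.lookup (row_col_sum E r c :: 'a perm_comb) id =
      (\<Sum>\<sigma>\<in>stab E r. \<Sum>\<tau>\<in>stab E c. of_int (sign \<tau>) when \<sigma> \<circ> \<tau> = id)"
    unfolding row_col_sum_def char_sum_def
    by (simp only: sym_mult_sum_left sym_mult_sum_right sym_mult_single lookup_sum lookup_single)
      (simp add: sum.swap[of _ "stab E c"])
  also have "\<dots> = (\<Sum>\<sigma>\<in>stab E r. \<Sum>\<tau>\<in>stab E c. if \<tau> = id then (if \<sigma> = id then 1 else 0) else 0)"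
    by (intro sum.cong refl) (auto simp: iff when_def)
  also have "\<dots> = 1" using fin by (simp add: stab_id)
  finally show ?thesis by (metis lookup_zero zero_neq_one)
qed

text \<open>\<open>f f\<^sup>*\<close> has the sum of the squares of the coefficients of \<open>f\<close> as coefficient of the identity, so it
  is nonzero for integral \<open>f \<noteq> 0\<close>. Apply this to \<open>f = a b\<close> and to \<open>f = a b a\<close>.\<close>

lemma row_col_sum_square_nonzero:
  assumes f: "filling E r c"
  shows "row_col_sum E r c \<cdot>\<^sub>S row_col_sum E r c \<noteq> (0 :: ('a::field_char_0) perm_comb)"
proof
  have fin: "finite E" using f by (rule filling_finite)
  let ?a = "row_sum E r :: 'a perm_comb" and ?b = "col_sum E c :: 'a perm_comb"
  have aa: "?a \<cdot>\<^sub>S ?a = of_nat (card (stab E r)) \<odot> ?a"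
    using trivial_char.char_sum_mult_subgroup[OF fin order_refl, where 'a = 'a] by simp
  have bb: "?b \<cdot>\<^sub>S ?b = of_nat (card (stab E c)) \<odot> ?b"
    using sign_char.char_sum_mult_subgroup[OF fin order_refl, where 'a = 'a] by simp
  have nz: "of_nat (card (stab E v)) \<noteq> (0 :: 'a)" for v using fin by (rule card_stab_nonzero)
  note adj = trivial_char.adjoint_char_sum[OF fin] sign_char.adjoint_char_sum[OF fin]
  note bk = bij_keys_char_sum bij_keys_mult
  note ic = integral_comb_char_sum integral_comb_mult
  assume "row_col_sum E r c \<cdot>\<^sub>S row_col_sum E r c = (0 :: 'a perm_comb)"
  then have abab: "?a \<cdot>\<^sub>S (?b \<cdot>\<^sub>S (?a \<cdot>\<^sub>S ?b)) = 0" by (simp add: row_col_sum_def sym_mult_assoc)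
  \<comment> \<open>\<open>a b a\<close> is self-adjoint, and its square is a multiple of
    \<open>(a b a b) a\<close>, which is zero by assumption.\<close>
  have "adjoint (?a \<cdot>\<^sub>S (?b \<cdot>\<^sub>S ?a)) = (?a \<cdot>\<^sub>S ?b) \<cdot>\<^sub>S ?a"
    by (simp add: adjoint_mult adj bk)
  then have "(?a \<cdot>\<^sub>S (?b \<cdot>\<^sub>S ?a)) \<cdot>\<^sub>S adjoint (?a \<cdot>\<^sub>S (?b \<cdot>\<^sub>S ?a)) = ?a \<cdot>\<^sub>S (?b \<cdot>\<^sub>S ((?a \<cdot>\<^sub>S ?a) \<cdot>\<^sub>S (?b \<cdot>\<^sub>S ?a)))"
    by (simp add: sym_mult_assoc)
  also have "\<dots> = of_nat (card (stab E r)) \<odot> ((?a \<cdot>\<^sub>S (?b \<cdot>\<^sub>S (?a \<cdot>\<^sub>S ?b))) \<cdot>\<^sub>S ?a)"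
    by (simp only: aa scale_mult_left scale_mult_right sym_mult_assoc)
  also have "\<dots> = 0" by (simp only: abab sym_mult_zero scale_zero)
  finally have "?a \<cdot>\<^sub>S (?b \<cdot>\<^sub>S ?a) = 0"
    by (rule mult_adjoint_eq_zero[rotated 2]) (intro bk ic)+
  \<comment> \<open>Now \<open>(a b) (b a)\<close> is a multiple of \<open>a b a\<close>, which has
    just been shown to vanish.\<close>
  moreover have "adjoint (?a \<cdot>\<^sub>S ?b) = ?b \<cdot>\<^sub>S ?a"
    by (simp add: adjoint_mult adj bk)
  then have "(?a \<cdot>\<^sub>S ?b) \<cdot>\<^sub>S adjoint (?a \<cdot>\<^sub>S ?b) = ?a \<cdot>\<^sub>S ((?b \<cdot>\<^sub>S ?b) \<cdot>\<^sub>S ?a)" by (simp add: sym_mult_assoc)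
  then have "(?a \<cdot>\<^sub>S ?b) \<cdot>\<^sub>S adjoint (?a \<cdot>\<^sub>S ?b) = of_nat (card (stab E c)) \<odot> (?a \<cdot>\<^sub>S (?b \<cdot>\<^sub>S ?a))"
    by (simp only: bb scale_mult_left scale_mult_right)
  ultimately have "(?a \<cdot>\<^sub>S ?b) \<cdot>\<^sub>S adjoint (?a \<cdot>\<^sub>S ?b) = 0" by (simp only: scale_zero)
  then have "?a \<cdot>\<^sub>S ?b = 0"
    by (rule mult_adjoint_eq_zero[rotated 2]) (intro bk ic)+
  then show False using row_col_sum_nonzero[OF f, where 'a = 'a] by (simp add: row_col_sum_def)
qed

text \<open>Straighten \<open>b \<sigma> b\<close> modulo \<open>Z\<close> with weight
  \<open>c\<close>. In a surviving term no entry moves to a larger column; the column numbers have a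
  fixed sum, so none changes, \<open>\<sigma>\<close> lies in the column group and the term is a
  multiple of \<open>b\<close>. Summing over the row group gives \<open>b a b = N b\<close> modulo
  \<open>Z\<close>. As \<open>a\<close> kills \<open>Z\<close>, it follows that
  \<open>a b a b = N a b\<close>, and the nonzero square forces \<open>N\<close> to be nonzero.
  Keeping \<open>Z\<close> general serves both quasi-idempotence and completeness.\<close>

lemma col_row_col_modulo:
  fixes Z :: "('a::field_char_0) perm_comb set"
  assumes f: "filling E r c" and Z: "lin_closed Z"
    and garnir: "\<And>\<sigma> X Y j. \<sigma> permutes E \<Longrightarrow> 1 \<le> j \<Longrightarrow> X \<subseteq> {x \<in> E. c (\<sigma> x) = j} \<Longrightarrow>
      Y \<subseteq> {x \<in> E. c (\<sigma> x) = Suc j} \<Longrightarrow> card {x \<in> E. c (\<sigma> x) = j} < card X + card Y \<Longrightarrow>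
      col_sum E c \<cdot>\<^sub>S (Poly_Mapping.single \<sigma> 1 \<cdot>\<^sub>S (col_sum (X \<union> Y) (\<lambda>_. 0) \<cdot>\<^sub>S col_sum E c)) \<in> Z"
    and kill: "\<And>z. z \<in> Z \<Longrightarrow> row_sum E r \<cdot>\<^sub>S z = 0"
  shows "\<exists>N. N \<noteq> 0 \<and> col_sum E c \<cdot>\<^sub>S (row_sum E r \<cdot>\<^sub>S col_sum E c) - N \<odot> col_sum E c \<in> Z"
proof -
  have fin: "finite E" using f by (rule filling_finite)
  let ?a = "row_sum E r :: 'a perm_comb" and ?b = "col_sum E c :: 'a perm_comb"
  define V where "V = {y. \<exists>\<alpha>. y - \<alpha> \<odot> ?b \<in> Z}"
  have VZ: "y \<in> V" if "y \<in> Z" for y using that unfolding V_def by (auto intro!: exI[of _ 0])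
  have V: "lin_closed V"
    unfolding lin_closed_def
  proof (intro conjI ballI allI)
    show "0 \<in> V" using Z by (intro VZ lin_closed_zero)
    fix x y assume "x \<in> V" "y \<in> V"
    then obtain \<alpha> \<beta> where "x - \<alpha> \<odot> ?b \<in> Z" "y - \<beta> \<odot> ?b \<in> Z" by (auto simp: V_def)
    then have "(x - \<alpha> \<odot> ?b) + (y - \<beta> \<odot> ?b) \<in> Z" by (rule lin_closed_add[OF Z])
    then have "(x + y) - (\<alpha> + \<beta>) \<odot> ?b \<in> Z" by (simp add: scale_add_left algebra_simps)
    then show "x + y \<in> V" by (auto simp: V_def)
  next
    fix a x assume "x \<in> V"
    then obtain \<alpha> where "x - \<alpha> \<odot> ?b \<in> Z" by (auto simp: V_def)
    then have "a \<odot> (x - \<alpha> \<odot> ?b) \<in> Z" by (rule lin_closed_scale[OF Z])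
    moreover have "a \<odot> (x - \<alpha> \<odot> ?b) = a \<odot> x - (a * \<alpha>) \<odot> ?b"
      using scale_add[of a x "- (\<alpha> \<odot> ?b)"] by (simp add: scale_uminus_right)
    ultimately show "a \<odot> x \<in> V" by (auto simp: V_def)
  qed
  have bV: "\<alpha> \<odot> ?b \<in> V" for \<alpha> using lin_closed_zero[OF Z] by (auto simp: V_def intro!: exI[of _ \<alpha>])
  have alt: "?b \<cdot>\<^sub>S Poly_Mapping.single \<tau> 1 = of_int (sign \<tau>) \<odot> ?b" if "\<tau> \<in> stab E c" for \<tau>
    using that fin by (rule sign_char.char_sum_mult_single[rotated])
  have str: "?b \<cdot>\<^sub>S (Poly_Mapping.single \<sigma> 1 \<cdot>\<^sub>S ?b) \<in> V" if "\<sigma> permutes E" for \<sigma>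
  proof (rule straightening[OF f _ V alt _ _ that])
    show "1 \<le> c x" if "x \<in> E" for x using filling_pos[OF f that] by simp
    show "?b \<cdot>\<^sub>S (Poly_Mapping.single \<sigma> 1 \<cdot>\<^sub>S (col_sum (X \<union> Y) (\<lambda>_. 0) \<cdot>\<^sub>S ?b)) \<in> V"
      if "\<sigma> permutes E" "1 \<le> j" "X \<subseteq> {x \<in> E. c (\<sigma> x) = j}" "Y \<subseteq> {x \<in> E. c (\<sigma> x) = Suc j}"
        "card {x \<in> E. c (\<sigma> x) = j} < card X + card Y" for \<sigma> X Y j
      by (rule VZ, rule garnir[OF that])
    fix \<sigma> assume s: "\<sigma> permutes E" and le: "\<And>x. x \<in> E \<Longrightarrow> c (\<sigma> x) \<le> c x"
    have "(\<Sum>x\<in>E. c (\<sigma> x)) = (\<Sum>x\<in>E. c x)"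
      using sum.reindex_bij_betw[OF permutes_imp_bij[OF s], of c] .
    then have "c (\<sigma> x) = c x" if "x \<in> E" for x
      using le that fin by (rule sum_mono_inv)
    then have "\<sigma> \<in> stab E c" using s by (rule stabI[rotated])
    then have "?b \<cdot>\<^sub>S (Poly_Mapping.single \<sigma> 1 \<cdot>\<^sub>S ?b) = (of_int (sign \<sigma>) * of_nat (card (stab E c))) \<odot> ?b"
      using sign_char.char_sum_mult_subgroup[OF fin order_refl, of c, where 'a = 'a]
      by (simp add: alt scale_mult_left flip: sym_mult_assoc)
    then show "?b \<cdot>\<^sub>S (Poly_Mapping.single \<sigma> 1 \<cdot>\<^sub>S ?b) \<in> V" using bV by simp
  qed
  have "?b \<cdot>\<^sub>S (?a \<cdot>\<^sub>S ?b) = (\<Sum>\<sigma>\<in>stab E r. ?b \<cdot>\<^sub>S (Poly_Mapping.single \<sigma> 1 \<cdot>\<^sub>S ?b))"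
    by (subst (2) char_sum_def) (simp add: sym_mult_sum_left sym_mult_sum_right)
  also have "\<dots> \<in> V" by (intro lin_closed_sum[OF V] str stab_permutes)
  finally obtain N where N: "?b \<cdot>\<^sub>S (?a \<cdot>\<^sub>S ?b) - N \<odot> ?b \<in> Z" by (auto simp: V_def)
  have "?a \<cdot>\<^sub>S (?b \<cdot>\<^sub>S (?a \<cdot>\<^sub>S ?b)) = N \<odot> (?a \<cdot>\<^sub>S ?b)"
    using kill[OF N] by (simp add: sym_mult_diff_right scale_mult_right)
  then have "N \<noteq> 0"
    using row_col_sum_square_nonzero[OF f, where 'a = 'a] by (auto simp: row_col_sum_def sym_mult_assoc)
  with N show ?thesis by blast
qed

text \<open>Moving the symmetrizer past \<open>\<sigma>\<close> relabels its filling, and the Garnir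
  relation of the relabelled filling applies. This settles the Garnir hypothesis whenever
  straightening starts from a Young symmetrizer.\<close>

lemma row_col_sum_conj_garnir:
  assumes f: "filling E r c" and s: "\<sigma> permutes E" and j: "1 \<le> j" and X: "X \<subseteq> {x \<in> E. c (\<sigma> x) = j}"
    and Y: "Y \<subseteq> {x \<in> E. c (\<sigma> x) = Suc j}" and card: "card {x \<in> E. c (\<sigma> x) = j} < card X + card Y"
  shows "row_col_sum E r c \<cdot>\<^sub>S (Poly_Mapping.single \<sigma> 1 \<cdot>\<^sub>S (col_sum (X \<union> Y) (\<lambda>_. 0) \<cdot>\<^sub>S h)) = (0 :: ('a::field_char_0) perm_comb)"
proof -
  have fin: "finite E" using f by (rule filling_finite)
  have "row_col_sum E (r \<circ> \<sigma>) (c \<circ> \<sigma>) \<cdot>\<^sub>S col_sum (X \<union> Y) (\<lambda>_. 0) = (0 :: 'a perm_comb)"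
    using X Y card by (intro garnir_relation[OF filling_compose[OF f s] j]) auto
  then show ?thesis
    by (simp add: row_col_sum_conj[OF fin s] sym_mult_assoc flip: sym_mult_assoc[of "row_col_sum E r c"])
      (simp flip: sym_mult_assoc[of "row_col_sum E (r \<circ> \<sigma>) (c \<circ> \<sigma>)"])
qed

text \<open>Take for \<open>Z\<close> the whole right annihilator of the row symmetrizer
  \<open>a\<close>, and multiply \<open>b a b = N b\<close> modulo \<open>Z\<close> by
  \<open>a\<close> from the left.\<close>

lemma row_col_sum_square:
  assumes f: "filling E r c"
  shows "\<exists>N. N \<noteq> 0 \<and> row_col_sum E r c \<cdot>\<^sub>S row_col_sum E r c = N \<odot> (row_col_sum E r c :: ('a::field_char_0) perm_comb)"
proof -
  let ?a = "row_sum E r :: 'a perm_comb" and ?b = "col_sum E c :: 'a perm_comb"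
  have "lin_closed {z. ?a \<cdot>\<^sub>S z = 0}"
    by (auto simp: lin_closed_def sym_mult_add_right scale_mult_right)
  then have "\<exists>N. N \<noteq> 0 \<and> ?b \<cdot>\<^sub>S (?a \<cdot>\<^sub>S ?b) - N \<odot> ?b \<in> {z. ?a \<cdot>\<^sub>S z = 0}"
  proof (rule col_row_col_modulo[OF f])
    fix \<sigma> X Y j assume "\<sigma> permutes E" "1 \<le> j" "X \<subseteq> {x \<in> E. c (\<sigma> x) = j}"
      "Y \<subseteq> {x \<in> E. c (\<sigma> x) = Suc j}" "card {x \<in> E. c (\<sigma> x) = j} < card X + card Y"
    note row_col_sum_conj_garnir[OF f this, of ?b, unfolded row_col_sum_def sym_mult_assoc]
    then show "?b \<cdot>\<^sub>S (Poly_Mapping.single \<sigma> 1 \<cdot>\<^sub>S (col_sum (X \<union> Y) (\<lambda>_. 0) \<cdot>\<^sub>S ?b)) \<in> {z. ?a \<cdot>\<^sub>S z = 0}"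
      by simp
  qed simp
  then obtain N where N: "N \<noteq> 0" "?a \<cdot>\<^sub>S (?b \<cdot>\<^sub>S (?a \<cdot>\<^sub>S ?b) - N \<odot> ?b) = 0"
    by blast
  then have "row_col_sum E r c \<cdot>\<^sub>S row_col_sum E r c = N \<odot> (row_col_sum E r c :: 'a perm_comb)"
    by (simp add: sym_mult_diff_right scale_mult_right row_col_sum_def sym_mult_assoc)
  with N show ?thesis by blast
qed

section \<open>Completeness\<close>

text \<open>Applied with \<open>s\<close> the size of a class: classes listed by decreasing size can
  be the consecutive columns of a diagram.\<close>

lemma decreasing_enumeration:
  fixes s :: "'v \<Rightarrow> nat"
  assumes "finite V"
  shows "\<exists>f. bij_betw f V {1..card V} \<and> (\<forall>u\<in>V. \<forall>v\<in>V. f u \<le> f v \<longrightarrow> s v \<le> s u)"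
  using assms
\<comment> \<open>Ranking by \<open>- s\<close> inserts an element with the smallest value of
  \<open>s\<close>, which can be appended at the end.\<close>
proof (induction rule: finite_ranking_induct[where f = "\<lambda>v. - int (s v)"])
  case (insert x V)
  show ?case
  proof (cases "x \<in> V")
    case True
    then show ?thesis using insert by (simp add: insert_absorb)
  next
    case False
    from insert obtain f where f: "bij_betw f V {1..card V}" "\<forall>u\<in>V. \<forall>v\<in>V. f u \<le> f v \<longrightarrow> s v \<le> s u" by blast
    let ?f = "f(x := Suc (card V))"
    have range: "1 \<le> f v" "f v \<le> card V" if "v \<in> V" for v using bij_betwE[OF f(1)] that by auto
    have im: "?f ` V = f ` V" using False by (intro image_cong) auto
    have "inj_on ?f (insert x V)"
      using f(1) False range by (fastforce simp: bij_betw_def inj_on_def)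
    moreover have "?f ` insert x V = {1..card (insert x V)}"
      using f(1) False insert.hyps(1) im by (auto simp: bij_betw_def)
    ultimately have "bij_betw ?f (insert x V) {1..card (insert x V)}" by (simp add: bij_betw_def)
    moreover have "s v \<le> s u" if uv: "u \<in> insert x V" "v \<in> insert x V" "?f u \<le> ?f v" for u v
    proof (cases "v = x")
      case True
      then show ?thesis using uv(1) insert.hyps(2) by force
    next
      case False
      then have "u \<noteq> x" using uv range[of v] by auto
      then show ?thesis using False uv f(2) by auto
    qed
    ultimately show ?thesis by blast
  qed
qed (simp add: bij_betw_def)

text \<open>The classes of \<open>w\<close>, ordered by decreasing size, become the columns, and
  each class is listed downwards in any order. Decreasing sizes guarantee that no cell lacks a left
  neighbour.\<close>

lemma filling_exists:
  assumes fin: "finite E"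
  shows "\<exists>r c. filling E r c \<and> (\<forall>x\<in>E. \<forall>y\<in>E. c x = c y \<longleftrightarrow> w x = w y)"
proof -
  define s where "s = (\<lambda>v. card {x \<in> E. w x = v})"
  let ?V = "w ` E"
  obtain f where f: "bij_betw f ?V {1..card ?V}" "\<And>u v. u \<in> ?V \<Longrightarrow> v \<in> ?V \<Longrightarrow> f u \<le> f v \<Longrightarrow> s v \<le> s u"
    using decreasing_enumeration[of ?V s] fin by blast
  have "\<exists>h. bij_betw h {x \<in> E. w x = v} {1..s v}" for v
    unfolding s_def using fin by (intro finite_same_card_bij) simp_all
  then obtain h where h: "bij_betw (h v) {x \<in> E. w x = v} {1..s v}" for v by metis
  define r c where "r = (\<lambda>x. h (w x) x)" and "c = (\<lambda>x. f (w x))"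
  have ceq: "c x = c y \<longleftrightarrow> w x = w y" if "x \<in> E" "y \<in> E" for x y
    using f(1) that by (auto simp: c_def bij_betw_def inj_on_def)
  have rin: "r x \<in> {1..s (w x)}" if "x \<in> E" for x
    using bij_betwE[OF h[of "w x"]] that by (auto simp: r_def)
  have cin: "c x \<in> {1..card ?V}" if "x \<in> E" for x
    using bij_betwE[OF f(1)] that by (auto simp: c_def)
  have "filling E r c"
    unfolding filling_def
  proof (intro conjI ballI allI impI)
    show "inj_on (\<lambda>x. (r x, c x)) E"
    proof (rule inj_onI)
      fix x y assume xy: "x \<in> E" "y \<in> E" "(r x, c x) = (r y, c y)"
      then have "w x = w y" using ceq by simp
      moreover have "h (w x) x = h (w x) y" using xy \<open>w x = w y\<close> by (simp add: r_def)
      ultimately show "x = y" using h[of "w x"] xy by (auto simp: bij_betw_def inj_on_def)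
    qed
    show "1 \<le> r x" "1 \<le> c x" if "x \<in> E" for x using rin[OF that] cin[OF that] by auto
    fix x i j assume x: "x \<in> E" "1 \<le> i" "i \<le> r x" "1 \<le> j" "j \<le> c x"
    then have "j \<in> {1..card ?V}" using cin[OF x(1)] by auto
    then have "j \<in> f ` ?V" using bij_betw_imp_surj_on[OF f(1)] by simp
    then obtain u where u: "u \<in> ?V" "f u = j" by blast
    then have "s (w x) \<le> s u" using f(2)[of u "w x"] x by (auto simp: c_def)
    then have "i \<in> {1..s u}" using rin[OF x(1)] x by auto
    then have "i \<in> h u ` {x \<in> E. w x = u}" using bij_betw_imp_surj_on[OF h[of u]] by simp
    then obtain y where "y \<in> E" "w y = u" "h u y = i" by blast
    then show "\<exists>y\<in>E. r y = i \<and> c y = j" using u by (auto simp: r_def c_def)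
  qed (rule fin)
  then show ?thesis using ceq by blast
qed

text \<open>A class of size \<open>p\<close> contributes \<open>p * 2 ^ p\<close>. The base 2 lets
  one class of size \<open>p + 1\<close> outweigh two classes of size at most \<open>p\<close>,
  since \<open>2 * p * 2 ^ p < (p + 1) * 2 ^ (p + 1)\<close>.\<close>

definition class_weight :: "nat set \<Rightarrow> (nat \<Rightarrow> nat) \<Rightarrow> nat" where
  "class_weight E w = (\<Sum>x\<in>E. 2 ^ card {y \<in> E. w y = w x})"

lemma class_weight_le: "finite E \<Longrightarrow> class_weight E w \<le> card E * 2 ^ card E"
  unfolding class_weight_def using sum_bounded_above[of E "\<lambda>x. 2 ^ card {y \<in> E. w y = w x}" "2 ^ card E :: nat"]
  by (simp add: card_mono power_increasing)

lemma class_weight_cong: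
  "(\<And>x y. x \<in> E \<Longrightarrow> y \<in> E \<Longrightarrow> v x = v y \<longleftrightarrow> w x = w y) \<Longrightarrow> class_weight E v = class_weight E w"
  unfolding class_weight_def by (intro sum.cong refl arg_cong[where f = "\<lambda>A. 2 ^ card A"]) auto

lemma class_weight_permute:
  assumes "\<sigma> permutes E"
  shows "class_weight E (w \<circ> \<sigma>) = class_weight E w"
proof -
  have "card {y \<in> E. w (\<sigma> y) = w (\<sigma> x)} = card {y \<in> E. w y = w (\<sigma> x)}" for x
  proof (rule bij_betw_same_card[of \<sigma>])
    show "bij_betw \<sigma> {y \<in> E. w (\<sigma> y) = w (\<sigma> x)} {y \<in> E. w y = w (\<sigma> x)}"
      by (rule bij_betw_byWitness[where f' = "inv \<sigma>"])
        (auto simp: permutes_inverses[OF assms] permutes_in_image[OF assms]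
          permutes_in_image[OF permutes_inv[OF assms]])
  qed
  then show ?thesis
    unfolding class_weight_def
    using sum.reindex_bij_betw[OF permutes_imp_bij[OF assms], of "\<lambda>x. 2 ^ card {y \<in> E. w y = w x}"] by simp
qed

lemma card_next_column_le:
  assumes f: "filling E r c" and j: "1 \<le> j"
  shows "card {x \<in> E. c x = Suc j} \<le> card {x \<in> E. c x = j}"
proof -
  have fin: "finite E" using f by (rule filling_finite)
  have "r ` {x \<in> E. c x = Suc j} \<subseteq> r ` {x \<in> E. c x = j}"
  proof clarify
    fix x assume x: "x \<in> E" "c x = Suc j"
    then obtain y where "y \<in> E" "r y = r x" "c y = j"
      using filling_down[OF f x(1), of "r x" j] filling_pos[OF f x(1)] j by auto
    then show "r x \<in> r ` {x \<in> E. c x = j}" by (intro image_eqI[of _ _ y]) simp_all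
  qed
  then have "card (r ` {x \<in> E. c x = Suc j}) \<le> card (r ` {x \<in> E. c x = j})"
    using fin by (intro card_mono) auto
  moreover have "card (r ` {x \<in> E. c x = Suc j}) = card {x \<in> E. c x = Suc j}"
    by (rule card_image, rule inj_onI, rule filling_eqD[OF f]) simp_all
  moreover have "card (r ` {x \<in> E. c x = j}) \<le> card {x \<in> E. c x = j}" using fin by (intro card_image_le) simp
  ultimately show ?thesis by linarith
qed

text \<open>With \<open>p\<close> the length of column \<open>j\<close>, columns \<open>j\<close>
  and \<open>j + 1\<close> contribute at most \<open>2 * p * 2 ^ p\<close>, while
  \<open>X \<union> Y\<close> becomes a single class of more than \<open>p\<close> elements. All
  other columns keep their contribution. The value 0 is free for the new class because column
  numbers are positive.\<close>

lemma class_weight_garnir: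
  assumes f: "filling E r c" and j: "1 \<le> j" and X: "X \<subseteq> {x \<in> E. c x = j}" and Y: "Y \<subseteq> {x \<in> E. c x = Suc j}"
    and card: "card {x \<in> E. c x = j} < card X + card Y"
  shows "class_weight E c < class_weight E (\<lambda>x. if x \<in> X \<union> Y then 0 else c x)"
proof -
  let ?w = "\<lambda>x. if x \<in> X \<union> Y then 0 else c x"
  let ?p = "card {x \<in> E. c x = j}"
  have fin: "finite E" using f by (rule filling_finite)
  have XYE: "X \<union> Y \<subseteq> E" using X Y by blast
  have fXY: "finite X" "finite Y" using XYE fin finite_subset by blast+
  have disj: "X \<inter> Y = {}" using X Y by fastforce
  define A where "A = {x \<in> E. c x = j \<or> c x = Suc j}"
  have XYA: "X \<union> Y \<subseteq> A" using X Y by (auto simp: A_def)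
  have AE: "A \<subseteq> E" by (auto simp: A_def)
  have fA: "finite A" using fin AE by (rule rev_finite_subset)
  have cardA: "card A \<le> ?p + ?p"
  proof -
    have "A = {x \<in> E. c x = j} \<union> {x \<in> E. c x = Suc j}" by (auto simp: A_def)
    then have "card A \<le> ?p + card {x \<in> E. c x = Suc j}" by (simp add: card_Un_le)
    then show ?thesis using card_next_column_le[OF f j] by linarith
  qed
  have split: "class_weight E v = (\<Sum>x\<in>E - A. 2 ^ card {y \<in> E. v y = v x}) + (\<Sum>x\<in>A. 2 ^ card {y \<in> E. v y = v x})" for v
    unfolding class_weight_def by (rule sum.subset_diff[OF AE fin])
  have "(\<Sum>x\<in>A. 2 ^ card {y \<in> E. c y = c x}) \<le> (\<Sum>x\<in>A. 2 ^ ?p :: nat)"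
  proof (intro sum_mono power_increasing)
    fix x assume "x \<in> A"
    then show "card {y \<in> E. c y = c x} \<le> ?p" using card_next_column_le[OF f j] by (auto simp: A_def)
  qed simp
  also have "\<dots> \<le> (?p + ?p) * 2 ^ ?p" using cardA by simp
  also have "\<dots> < Suc ?p * 2 ^ Suc ?p" by (simp add: algebra_simps)
  also have "\<dots> \<le> card (X \<union> Y) * 2 ^ card (X \<union> Y)"
    using card fXY disj by (intro mult_mono power_increasing) (auto simp: card_Un_disjoint)
  also have "\<dots> = (\<Sum>x\<in>X \<union> Y. 2 ^ card (X \<union> Y))" by simp
  also have "\<dots> \<le> (\<Sum>x\<in>X \<union> Y. 2 ^ card {y \<in> E. ?w y = ?w x})"
  proof (intro sum_mono power_increasing card_mono)
    fix x assume "x \<in> X \<union> Y"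
    then show "X \<union> Y \<subseteq> {y \<in> E. ?w y = ?w x}" using XYE by auto
  qed (use fin in auto)
  also have "\<dots> \<le> (\<Sum>x\<in>A. 2 ^ card {y \<in> E. ?w y = ?w x})" by (rule sum_mono2[OF fA XYA]) simp
  finally have less: "(\<Sum>x\<in>A. 2 ^ card {y \<in> E. c y = c x}) < (\<Sum>x\<in>A. 2 ^ card {y \<in> E. ?w y = ?w x} :: nat)" .
  have "{y \<in> E. c y = c x} = {y \<in> E. ?w y = ?w x}" if x: "x \<in> E - A" for x
  proof -
    have "c x \<ge> 1" "x \<notin> X \<union> Y" using filling_pos[OF f] x XYA by auto
    moreover have "c y \<noteq> c x" if "y \<in> X \<union> Y" for y using that XYA x by (auto simp: A_def)
    ultimately show ?thesis by auto
  qed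
  then have eq: "(\<Sum>x\<in>E - A. 2 ^ card {y \<in> E. c y = c x}) = (\<Sum>x\<in>E - A. 2 ^ card {y \<in> E. ?w y = ?w x} :: nat)"
    by (intro sum.cong refl) simp
  show ?thesis unfolding split eq using less by simp
qed

text \<open>Let \<open>b\<close> be the column antisymmetrizer of a filling whose columns are the classes of \<open>w\<close>, and
  \<open>a\<close> the corresponding row symmetrizer. Then \<open>b a b = N b + z\<close> with \<open>N \<noteq> 0\<close>, where \<open>z\<close> is a
  combination of antisymmetrizers of larger class weight, which lie in the ideal by induction.\<close>

lemma col_sum_in_ideal:
  fixes I :: "('a::field_char_0) perm_comb set"
  assumes fin: "finite E" and I: "lin_closed I"
    and left: "\<And>\<sigma> x. \<sigma> permutes E \<Longrightarrow> x \<in> I \<Longrightarrow> Poly_Mapping.single \<sigma> 1 \<cdot>\<^sub>S x \<in> I"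
    and right: "\<And>\<sigma> x. \<sigma> permutes E \<Longrightarrow> x \<in> I \<Longrightarrow> x \<cdot>\<^sub>S Poly_Mapping.single \<sigma> 1 \<in> I"
    and gen: "\<And>r c. filling E r c \<Longrightarrow> row_col_sum E r c \<in> I"
  shows "col_sum E w \<in> I"
proof (induction "card E * 2 ^ card E - class_weight E w" arbitrary: w rule: less_induct)
  case (less w)
  have IH: "col_sum E v \<in> I" if "class_weight E w < class_weight E v" for v
    using that class_weight_le[OF fin, of v] by (intro less) linarith
  have left': "char_sum \<chi> (stab E v) \<cdot>\<^sub>S x \<in> I" if "x \<in> I" for \<chi> v x
    unfolding char_sum_def sym_mult_sum_left
  proof (rule lin_closed_sum[OF I])
    fix \<sigma> assume "\<sigma> \<in> stab E v"
    then have "of_int (\<chi> \<sigma>) \<odot> (Poly_Mapping.single \<sigma> 1 \<cdot>\<^sub>S x) \<in> I"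
      using that by (intro lin_closed_scale[OF I] left stab_permutes)
    then show "Poly_Mapping.single \<sigma> (of_int (\<chi> \<sigma>)) \<cdot>\<^sub>S x \<in> I" by (simp flip: scale_mult_left)
  qed
  have right': "x \<cdot>\<^sub>S char_sum \<chi> (stab E v) \<in> I" if "x \<in> I" for \<chi> v x
    unfolding char_sum_def sym_mult_sum_right
  proof (rule lin_closed_sum[OF I])
    fix \<sigma> assume "\<sigma> \<in> stab E v"
    then have "of_int (\<chi> \<sigma>) \<odot> (x \<cdot>\<^sub>S Poly_Mapping.single \<sigma> 1) \<in> I"
      using that by (intro lin_closed_scale[OF I] right stab_permutes)
    then show "x \<cdot>\<^sub>S Poly_Mapping.single \<sigma> (of_int (\<chi> \<sigma>)) \<in> I" by (simp flip: scale_mult_right)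
  qed
  obtain r c where f: "filling E r c" and cw: "\<And>x y. x \<in> E \<Longrightarrow> y \<in> E \<Longrightarrow> c x = c y \<longleftrightarrow> w x = w y"
    using filling_exists[OF fin, of w] by blast
  let ?a = "row_sum E r :: 'a perm_comb" and ?b = "col_sum E c :: 'a perm_comb"
  have "stab E w = stab E c" using cw by (intro stab_cong) auto
  then have bw: "col_sum E w = ?b" by simp
  \<comment> \<open>Garnir terms lie in \<open>I\<close> by the induction hypothesis and are killed
    by the row symmetrizer by the Garnir relations; the second property is what keeps
    \<open>N\<close> nonzero.\<close>
  define Z where "Z = {z \<in> I. ?a \<cdot>\<^sub>S z = 0}"
  have Z: "lin_closed Z"
    using I by (auto simp: lin_closed_def Z_def sym_mult_add_right scale_mult_right)
  have "\<exists>N. N \<noteq> 0 \<and> ?b \<cdot>\<^sub>S (?a \<cdot>\<^sub>S ?b) - N \<odot> ?b \<in> Z"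
  proof (rule col_row_col_modulo[OF f Z])
    fix \<sigma> X Y j assume h: "\<sigma> permutes E" "1 \<le> j" "X \<subseteq> {x \<in> E. c (\<sigma> x) = j}"
      "Y \<subseteq> {x \<in> E. c (\<sigma> x) = Suc j}" "card {x \<in> E. c (\<sigma> x) = j} < card X + card Y"
    let ?B = "col_sum (X \<union> Y) (\<lambda>_. 0) :: 'a perm_comb" and ?c = "c \<circ> \<sigma>"
    let ?v = "\<lambda>x. if x \<in> X \<union> Y then 0 else ?c x"
    have f': "filling E (r \<circ> \<sigma>) ?c" using f h(1) by (rule filling_compose)
    have XYE: "X \<union> Y \<subseteq> E" using h by auto
    have cpos: "0 < c (\<sigma> x)" if "x \<in> E" for x using filling_pos[OF f' that] by simp
    have "class_weight E w = class_weight E ?c"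
      using class_weight_permute[OF h(1), of c] class_weight_cong[of E c w] cw by simp
    also have "\<dots> < class_weight E ?v" using h by (intro class_weight_garnir[OF f' h(2)]) auto
    finally have "col_sum E ?v \<in> I" by (rule IH)
    then have in1: "col_sum E ?c \<cdot>\<^sub>S col_sum E ?v \<in> I" by (rule left')
    \<comment> \<open>The antisymmetrizer of larger class weight splits into one on
      \<open>X \<union> Y\<close> and one on the rest. The column sum of
      \<open>c \<circ> \<sigma>\<close> absorbs the latter up to a nonzero integer, which leaves the
      Garnir term.\<close>
    have "col_sum (E - (X \<union> Y)) ?v \<cdot>\<^sub>S col_sum (X \<union> Y) ?v = (col_sum ((E - (X \<union> Y)) \<union> (X \<union> Y)) ?v :: 'a perm_comb)"
      using fin XYE cpos by (intro sign_char.char_sum_stab_union) (auto intro: finite_subset)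
    moreover have "stab (E - (X \<union> Y)) ?v = stab (E - (X \<union> Y)) ?c" by (intro stab_cong) auto
    moreover have "stab (X \<union> Y) ?v = stab (X \<union> Y) (\<lambda>_. 0)" by (intro stab_cong) auto
    moreover have "(E - (X \<union> Y)) \<union> (X \<union> Y) = E" using XYE by auto
    ultimately have fac: "(col_sum E ?v :: 'a perm_comb) = col_sum (E - (X \<union> Y)) ?c \<cdot>\<^sub>S ?B" by simp
    have "stab (E - (X \<union> Y)) ?c \<subseteq> stab E ?c" by (intro stab_mono) auto
    then have "col_sum E ?c \<cdot>\<^sub>S col_sum (E - (X \<union> Y)) ?c = of_nat (card (stab (E - (X \<union> Y)) ?c)) \<odot> (col_sum E ?c :: 'a perm_comb)"
      by (rule sign_char.char_sum_mult_subgroup[OF fin])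
    then have "of_nat (card (stab (E - (X \<union> Y)) ?c)) \<odot> (col_sum E ?c \<cdot>\<^sub>S ?B) \<in> I"
      using in1 unfolding fac by (simp flip: sym_mult_assoc scale_mult_left)
    moreover have "of_nat (card (stab (E - (X \<union> Y)) ?c)) \<noteq> (0 :: 'a)" using fin by (intro card_stab_nonzero) simp
    ultimately have "col_sum E ?c \<cdot>\<^sub>S ?B \<in> I" by (rule lin_closed_cancel_scale[OF I])
    then have "Poly_Mapping.single \<sigma> 1 \<cdot>\<^sub>S ((col_sum E ?c \<cdot>\<^sub>S ?B) \<cdot>\<^sub>S ?b) \<in> I" by (intro left right' h(1))
    also have "Poly_Mapping.single \<sigma> 1 \<cdot>\<^sub>S ((col_sum E ?c \<cdot>\<^sub>S ?B) \<cdot>\<^sub>S ?b) =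
        (?b \<cdot>\<^sub>S Poly_Mapping.single \<sigma> 1) \<cdot>\<^sub>S (?B \<cdot>\<^sub>S ?b)"
      unfolding sign_char.char_sum_conj[OF fin h(1)] by (simp only: sym_mult_assoc)
    finally have "?b \<cdot>\<^sub>S (Poly_Mapping.single \<sigma> 1 \<cdot>\<^sub>S (?B \<cdot>\<^sub>S ?b)) \<in> I" by (simp only: sym_mult_assoc)
    then show "?b \<cdot>\<^sub>S (Poly_Mapping.single \<sigma> 1 \<cdot>\<^sub>S (?B \<cdot>\<^sub>S ?b)) \<in> Z"
      using row_col_sum_conj_garnir[OF f h, of ?b] by (simp add: Z_def row_col_sum_def sym_mult_assoc)
  qed (simp add: Z_def)
  then obtain N where N: "N \<noteq> 0" "?b \<cdot>\<^sub>S (?a \<cdot>\<^sub>S ?b) - N \<odot> ?b \<in> I" by (auto simp: Z_def)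
  have "?b \<cdot>\<^sub>S (?a \<cdot>\<^sub>S ?b) \<in> I" using left'[OF gen[OF f]] by (simp add: row_col_sum_def)
  then have "?b \<cdot>\<^sub>S (?a \<cdot>\<^sub>S ?b) - (?b \<cdot>\<^sub>S (?a \<cdot>\<^sub>S ?b) - N \<odot> ?b) \<in> I" using N(2) by (rule lin_closed_diff[OF I])
  then have "N \<odot> ?b \<in> I" by simp
  then show ?case unfolding bw using N(1) by (rule lin_closed_cancel_scale[OF I])
qed

section \<open>Vanishing outside the shape\<close>

text \<open>Straighten with weights that are the column numbers \<open>c'\<close> on \<open>F\<close> and large and distinct elsewhere. A
  surviving term would put each \<open>x \<in> F\<close> into a column \<open>\<le> c' x\<close>, with the entries of every row of \<open>c'\<close> in
  different columns; then all columns agree with \<open>c'\<close>, and the shape of \<open>F\<close> is contained in that of \<open>E\<close>.\<close>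

lemma row_col_sum_annihilates:
  assumes f: "filling E r c" and f': "filling F r' c'" and FE: "F \<subseteq> E"
    and x0: "x0 \<in> F" "\<And>y. y \<in> E \<Longrightarrow> \<not> (r y = r' x0 \<and> c y = c' x0)" and s: "\<sigma> permutes E"
  shows "row_col_sum E r c \<cdot>\<^sub>S (Poly_Mapping.single \<sigma> 1 \<cdot>\<^sub>S (col_sum F c' \<cdot>\<^sub>S row_sum F r')) = (0 :: ('a::field_char_0) perm_comb)"
proof -
  have fin: "finite E" "finite F" using f f' by (auto intro: filling_finite)
  define w where "w = (\<lambda>x. if x \<in> F then c' x else Suc (sum c' F + x))"
  have wF: "w x = c' x" if "x \<in> F" for x using that by (simp add: w_def)
  have small: "c' x \<le> sum c' F" if "x \<in> F" for x using that fin by (intro member_le_sum) auto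
  let ?C = "row_col_sum E r c :: 'a perm_comb"
  \<comment> \<open>The values of \<open>w\<close> outside \<open>F\<close> are distinct and exceed
    those on \<open>F\<close>, so a permutation preserving \<open>w\<close> fixes
    \<open>E - F\<close> pointwise.\<close>
  have "stab E w = stab F c'"
  proof
    show "stab F c' \<subseteq> stab E w" using FE by (intro stab_mono) (simp_all add: wF)
    show "stab E w \<subseteq> stab F c'"
    proof
      fix \<tau> assume t: "\<tau> \<in> stab E w"
      have "\<tau> x = x" if "x \<in> E - F" for x
      proof -
        have "w (\<tau> x) = Suc (sum c' F + x)" using stab_eq'[OF t, of x] that by (simp add: w_def)
        then show ?thesis using small[of "\<tau> x"] by (auto simp: w_def split: if_splits)
      qed
      then have p: "\<tau> permutes F" by (rule permutes_superset[OF stab_permutes[OF t]])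
      then show "\<tau> \<in> stab F c'"
        using stab_eq'[OF t] by (intro stabI) (simp_all add: permutes_in_image flip: wF)
    qed
  qed
  then have bw: "(col_sum E w :: 'a perm_comb) = col_sum F c'" by simp
  have zero: "?C \<cdot>\<^sub>S (Poly_Mapping.single \<pi> 1 \<cdot>\<^sub>S row_sum F r') = 0"
    if p: "\<pi> permutes E" and le: "\<And>x. x \<in> E \<Longrightarrow> c (\<pi> x) \<le> w x" for \<pi>
  proof -
    have pE: "\<pi> x \<in> E" if "x \<in> F" for x using that FE by (auto simp: permutes_in_image[OF p])
    have "\<exists>x\<in>F. \<exists>y\<in>F. x \<noteq> y \<and> c (\<pi> x) = c (\<pi> y) \<and> r' x = r' y"
    proof (rule ccontr)
      assume no: "\<not> (\<exists>x\<in>F. \<exists>y\<in>F. x \<noteq> y \<and> c (\<pi> x) = c (\<pi> y) \<and> r' x = r' y)"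
      \<comment> \<open>If \<open>x\<close> moved to an earlier column, the entry \<open>y\<close>
        of its row that belongs to that column would already be there, by induction on the column
        number; \<open>x\<close> and \<open>y\<close> would then be a forbidden pair.\<close>
      have same: "m = c' x \<Longrightarrow> x \<in> F \<Longrightarrow> c (\<pi> x) = m" for m x
      proof (induction m arbitrary: x rule: less_induct)
        case (less m)
        have "c (\<pi> x) \<le> m" using le[of x] less.prems FE by (auto simp: w_def)
        moreover have "\<not> c (\<pi> x) < m"
        proof
          assume lt: "c (\<pi> x) < m"
          obtain y where y: "y \<in> F" "r' y = r' x" "c' y = c (\<pi> x)"
            using filling_down[OF f' less.prems(2), of "r' x" "c (\<pi> x)"] filling_pos[OF f' less.prems(2)]
              filling_pos[OF f pE[OF less.prems(2)]] lt less.prems(1) by auto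
          then have "c (\<pi> y) = c (\<pi> x)" using less.IH[OF lt, of y] by simp
          moreover have "y \<noteq> x" using y(3) lt less.prems(1) by auto
          ultimately show False using no y(1,2) less.prems(2) by metis
        qed
        ultimately show ?case by simp
      qed
      let ?i = "r' x0" and ?j = "c' x0"
      have pos: "1 \<le> ?i" "1 \<le> ?j" using filling_pos[OF f' x0(1)] by auto
      \<comment> \<open>Column \<open>?j\<close> of \<open>F\<close> has at least \<open>?i\<close>
        entries. They go injectively into column \<open>?j\<close> of \<open>E\<close>, which stops
        above row \<open>?i\<close> because the cell of \<open>x0\<close> is missing there.\<close>
      have "?i = card {1..?i}" by simp
      also have "\<dots> \<le> card {y \<in> F. c' y = ?j}"
      proof (rule surj_card_le[where f = r'])
        show "{1..?i} \<subseteq> r' ` {y \<in> F. c' y = ?j}"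
        proof
          fix i assume "i \<in> {1..?i}"
          then obtain y where "y \<in> F" "r' y = i" "c' y = ?j"
            using filling_down[OF f' x0(1), of i ?j] pos by auto
          then show "i \<in> r' ` {y \<in> F. c' y = ?j}" by blast
        qed
      qed (use fin in simp)
      also have "\<dots> \<le> card {1..<?i}"
      proof (rule card_inj_on_le[where f = "\<lambda>y. r (\<pi> y)"])
        show "inj_on (\<lambda>y. r (\<pi> y)) {y \<in> F. c' y = ?j}"
        proof (rule inj_onI)
          fix x y assume xy: "x \<in> {y \<in> F. c' y = ?j}" "y \<in> {y \<in> F. c' y = ?j}" "r (\<pi> x) = r (\<pi> y)"
          then have "c (\<pi> x) = c (\<pi> y)" using same by auto
          then have "\<pi> x = \<pi> y" using filling_eqD[OF f, of "\<pi> x" "\<pi> y"] xy pE by simp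
          then show "x = y" using permutes_inj[OF p] by (auto simp: inj_def)
        qed
        show "(\<lambda>y. r (\<pi> y)) ` {y \<in> F. c' y = ?j} \<subseteq> {1..<?i}"
        proof clarify
          fix y assume y: "y \<in> F" "c' y = ?j"
          have "\<not> ?i \<le> r (\<pi> y)"
          proof
            assume "?i \<le> r (\<pi> y)"
            then obtain z where "z \<in> E" "r z = ?i" "c z = ?j"
              using filling_down[OF f pE[OF y(1)], of ?i ?j] pos same[of ?j y] y by auto
            then show False using x0(2) by blast
          qed
          then show "r (\<pi> y) \<in> {1..<?i}" using filling_pos[OF f pE[OF y(1)]] by auto
        qed
      qed simp
      finally show False using pos by simp
    qed
    then obtain x y where "x \<in> F" "y \<in> F" "x \<noteq> y" "c (\<pi> x) = c (\<pi> y)" "r' x = r' y" by blast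
    then have "col_sum E (c \<circ> \<pi>) \<cdot>\<^sub>S row_sum F r' = (0 :: 'a perm_comb)"
      using FE fin by (intro common_transposition_zero(2)[of F E x y]) auto
    then have "row_col_sum E (r \<circ> \<pi>) (c \<circ> \<pi>) \<cdot>\<^sub>S row_sum F r' = (0 :: 'a perm_comb)"
      by (simp add: row_col_sum_def sym_mult_assoc)
    moreover have "?C \<cdot>\<^sub>S (Poly_Mapping.single \<pi> 1 \<cdot>\<^sub>S row_sum F r') =
        Poly_Mapping.single \<pi> 1 \<cdot>\<^sub>S (row_col_sum E (r \<circ> \<pi>) (c \<circ> \<pi>) \<cdot>\<^sub>S row_sum F r')"
      by (simp only: row_col_sum_conj[OF fin(1) p] flip: sym_mult_assoc)
    ultimately show ?thesis by simp
  qed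
  have V: "lin_closed {y. y \<cdot>\<^sub>S row_sum F r' = (0 :: 'a perm_comb)}"
    by (auto simp: lin_closed_def sym_mult_add_left scale_mult_left)
  have "?C \<cdot>\<^sub>S (Poly_Mapping.single \<sigma> 1 \<cdot>\<^sub>S col_sum E w) \<in> {y. y \<cdot>\<^sub>S row_sum F r' = 0}"
  proof (rule straightening[OF f _ V _ _ _ s])
    show "1 \<le> w x" for x using filling_pos[OF f', of x] by (simp add: w_def)
    show "?C \<cdot>\<^sub>S Poly_Mapping.single \<tau> 1 = of_int (sign \<tau>) \<odot> ?C" if "\<tau> \<in> stab E c" for \<tau>
      by (simp only: row_col_sum_def sym_mult_assoc sign_char.char_sum_mult_single[OF fin(1) that] scale_mult_right)
    show "?C \<cdot>\<^sub>S (Poly_Mapping.single \<sigma> 1 \<cdot>\<^sub>S (col_sum (X \<union> Y) (\<lambda>_. 0) \<cdot>\<^sub>S col_sum E w)) \<in> {y. y \<cdot>\<^sub>S row_sum F r' = 0}"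
      if "\<sigma> permutes E" "1 \<le> j" "X \<subseteq> {x \<in> E. c (\<sigma> x) = j}" "Y \<subseteq> {x \<in> E. c (\<sigma> x) = Suc j}"
        "card {x \<in> E. c (\<sigma> x) = j} < card X + card Y" for \<sigma> X Y j
      using row_col_sum_conj_garnir[OF f that, where 'a = 'a] by simp
    fix \<sigma> assume s: "\<sigma> permutes E" and le: "\<And>x. x \<in> E \<Longrightarrow> c (\<sigma> x) \<le> w x"
    have "?C \<cdot>\<^sub>S (Poly_Mapping.single (\<sigma> \<circ> \<tau>) 1 \<cdot>\<^sub>S row_sum F r') = 0" if t: "\<tau> \<in> stab E w" for \<tau>
    proof (rule zero)
      have tp: "\<tau> permutes E" using t by (rule stab_permutes)
      then show "\<sigma> \<circ> \<tau> permutes E" using s by (rule permutes_compose)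
      fix x assume "x \<in> E"
      then show "c ((\<sigma> \<circ> \<tau>) x) \<le> w x"
        using le[of "\<tau> x"] stab_eq'[OF t, of x] by (simp add: permutes_in_image[OF tp])
    qed
    then have "?C \<cdot>\<^sub>S (Poly_Mapping.single (\<sigma> \<circ> \<tau>) (of_int (sign \<tau>)) \<cdot>\<^sub>S row_sum F r') = 0" if "\<tau> \<in> stab E w" for \<tau>
      using that by (subst single_eq_scale) (simp add: scale_mult_left scale_mult_right del: scale_single)
    then have "(\<Sum>\<tau>\<in>stab E w. ?C \<cdot>\<^sub>S (Poly_Mapping.single (\<sigma> \<circ> \<tau>) (of_int (sign \<tau>)) \<cdot>\<^sub>S row_sum F r')) = 0"
      by (simp add: sum.neutral)
    also have "(\<Sum>\<tau>\<in>stab E w. ?C \<cdot>\<^sub>S (Poly_Mapping.single (\<sigma> \<circ> \<tau>) (of_int (sign \<tau>)) \<cdot>\<^sub>S row_sum F r')) =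
        (?C \<cdot>\<^sub>S (Poly_Mapping.single \<sigma> 1 \<cdot>\<^sub>S col_sum E w)) \<cdot>\<^sub>S row_sum F r'"
      by (simp add: char_sum_def[of sign "stab E w"] sym_mult_sum_left sym_mult_sum_right sym_mult_assoc)
    finally show "?C \<cdot>\<^sub>S (Poly_Mapping.single \<sigma> 1 \<cdot>\<^sub>S col_sum E w) \<in> {y. y \<cdot>\<^sub>S row_sum F r' = 0}"
      by simp
  qed
  then show ?thesis by (simp add: bw sym_mult_assoc)
qed

section \<open>Partitions, fillings and Young symmetrizers\<close>

lemma part_antimono:
  assumes "lam \<turnstile> n" "1 \<le> i" "i \<le> i'"
  shows "part lam i' \<le> part lam i"
proof (cases "i = i' \<or> length lam < i'")
  case False
  then have "i - 1 < i' - 1" "i' - 1 < length lam" using assms by auto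
  moreover have "sorted_wrt (\<ge>) lam" using assms(1) by (simp add: partition_of_def)
  ultimately have "lam ! (i' - 1) \<le> lam ! (i - 1)" by (simp add: sorted_wrt_iff_nth_less)
  then show ?thesis using assms by (auto simp: part_def)
qed (auto simp: part_def)

lemma filling_of_diagram:
  assumes lam: "lam \<turnstile> n" and fin: "finite E" and p: "bij_betw p E (diagram lam)"
  shows "filling E (fst \<circ> p) (snd \<circ> p)"
  unfolding filling_def
proof (intro conjI ballI allI impI)
  show "inj_on (\<lambda>x. ((fst \<circ> p) x, (snd \<circ> p) x)) E"
    using bij_betw_imp_inj_on[OF p] by (auto simp: inj_on_def)
  have D: "p x \<in> diagram lam" if "x \<in> E" for x using bij_betwE[OF p] that by blast
  show "1 \<le> (fst \<circ> p) x" "1 \<le> (snd \<circ> p) x" if "x \<in> E" for x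
    using D[OF that] by (auto simp: diagram_def)
  fix x i j assume x: "x \<in> E" "1 \<le> i" "i \<le> (fst \<circ> p) x" "1 \<le> j" "j \<le> (snd \<circ> p) x"
  then have "(i, j) \<in> diagram lam"
    using D[OF x(1)] part_antimono[OF lam x(2,3)] by (auto simp: diagram_def)
  then have "(i, j) \<in> p ` E" using bij_betw_imp_surj_on[OF p] by simp
  then show "\<exists>y\<in>E. (fst \<circ> p) y = i \<and> (snd \<circ> p) y = j" by (metis comp_apply fst_conv image_iff snd_conv)
qed (rule fin)

lemma down_closed_nat_set:
  fixes A :: "nat set"
  assumes "finite A" "\<And>a. a \<in> A \<Longrightarrow> 1 \<le> a" "\<And>a b. a \<in> A \<Longrightarrow> 1 \<le> b \<Longrightarrow> b \<le> a \<Longrightarrow> b \<in> A"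
  shows "A = {1..card A}"
proof (cases "A = {}")
  case False
  have "A = {1..Max A}"
  proof
    show "A \<subseteq> {1..Max A}" using assms(1,2) by auto
    show "{1..Max A} \<subseteq> A" using assms(3)[OF Max_in[OF assms(1) False]] by auto
  qed
  then show ?thesis by (metis card_atLeastAtMost diff_Suc_1)
qed simp

text \<open>By down-closure every row occupies an initial segment of columns and contains the column
  numbers of every lower row, so the row lengths form a partition.\<close>

lemma filling_partition:
  assumes f: "filling E r c"
  shows "\<exists>\<delta>. \<delta> \<turnstile> card E \<and> bij_betw (\<lambda>x. (r x, c x)) E (diagram \<delta>)"
proof -
  have fin: "finite E" using f by (rule filling_finite)
  \<comment> \<open>The inserted 0 keeps the maximum defined for empty \<open>E\<close>, where the
    partition is empty.\<close>
  define h where "h = Max (insert 0 (r ` E))"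
  define l where "l = (\<lambda>i. card {x \<in> E. r x = i})"
  define \<delta> where "\<delta> = map l [1..<Suc h]"
  have rh: "r x \<le> h" if "x \<in> E" for x unfolding h_def using fin that by (intro Max_ge) auto
  have row: "c ` {x \<in> E. r x = i} = {1..l i}" for i
  proof -
    let ?A = "c ` {x \<in> E. r x = i}"
    have "?A = {1..card ?A}"
    proof (rule down_closed_nat_set)
      show "finite ?A" using fin by simp
      show "1 \<le> a" if "a \<in> ?A" for a using that filling_pos[OF f] by auto
      show "b \<in> ?A" if ab: "a \<in> ?A" "1 \<le> b" "b \<le> a" for a b
      proof -
        obtain x where x: "x \<in> E" "r x = i" "c x = a" using ab(1) by blast
        then obtain y where "y \<in> E" "r y = i" "c y = b"
          using filling_down[OF f x(1), of i b] filling_pos[OF f x(1)] ab by auto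
        then show ?thesis by blast
      qed
    qed
    moreover have "inj_on c {x \<in> E. r x = i}"
      by (rule inj_onI, rule filling_eqD[OF f]) simp_all
    ultimately show ?thesis by (simp add: l_def card_image)
  qed
  have part: "part \<delta> i = l i" if "1 \<le> i" for i
  proof (cases "i \<le> h")
    case True
    then have "[1..<Suc h] ! (i - 1) = i" using that by (subst nth_upt) auto
    then show ?thesis using True that by (simp add: part_def \<delta>_def nth_map del: upt_Suc)
  next
    case False
    then have "{x \<in> E. r x = i} = {}" using rh by auto
    then have "l i = 0" unfolding l_def by (simp only: card.empty)
    then show ?thesis using False that by (simp add: part_def \<delta>_def del: upt_Suc)
  qed
  have pos: "0 < l i" if i: "1 \<le> i" "i \<le> h" for i
  proof -
    have "h \<in> insert 0 (r ` E)" unfolding h_def using fin by (intro Max_in) auto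
    then obtain x where x: "x \<in> E" "r x = h" using i by auto
    then obtain y where "y \<in> E" "r y = i" using filling_down[OF f x(1), of i 1] filling_pos[OF f x(1)] x(2) i by auto
    then show ?thesis unfolding l_def using fin by (auto simp: card_gt_0_iff)
  qed
  have mono: "l i' \<le> l i" if i: "1 \<le> i" "i \<le> i'" for i i'
  proof -
    have "{1..l i'} \<subseteq> {1..l i}"
      unfolding row[symmetric]
    proof clarify
      fix x assume x: "x \<in> E" "i' = r x"
      then obtain y where "y \<in> E" "r y = i" "c y = c x"
        using filling_down[OF f x(1), of i "c x"] filling_pos[OF f x(1)] x(2) i by auto
      then show "c x \<in> c ` {x \<in> E. r x = i}" by (metis (mono_tags, lifting) imageI mem_Collect_eq)
    qed
    then show ?thesis by (cases "l i' = 0") auto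
  qed
  have "\<delta> \<turnstile> card E"
    unfolding partition_of_def
  proof (intro conjI)
    show "sorted_wrt (\<ge>) \<delta>"
      unfolding \<delta>_def sorted_wrt_map by (rule sorted_wrt_mono_rel[OF _ sorted_wrt_upt]) (auto intro!: mono)
    show "\<forall>a\<in>set \<delta>. 0 < a" using pos by (auto simp: \<delta>_def)
    have "sum_list \<delta> = sum l {1..<Suc h}" unfolding \<delta>_def by (simp add: interv_sum_list_conv_sum_set_nat del: upt_Suc)
    also have "\<dots> = (\<Sum>i\<in>{1..<Suc h}. \<Sum>x\<in>{x \<in> E. r x = i}. 1)" by (simp add: l_def)
    also have "\<dots> = (\<Sum>x\<in>E. 1)"
      using fin rh filling_pos[OF f] by (intro sum.group) (auto simp: less_Suc_eq_le)
    finally show "sum_list \<delta> = card E" by simp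
  qed
  moreover have "bij_betw (\<lambda>x. (r x, c x)) E (diagram \<delta>)"
    unfolding bij_betw_def
  proof (intro conjI filling_inj[OF f] equalityI subsetI)
    fix d assume "d \<in> (\<lambda>x. (r x, c x)) ` E"
    then obtain x where x: "x \<in> E" "d = (r x, c x)" by auto
    moreover have "c x \<in> {1..l (r x)}" unfolding row[symmetric] using x by blast
    ultimately show "d \<in> diagram \<delta>" using filling_pos[OF f x(1)] by (auto simp: diagram_def part)
  next
    fix d assume "d \<in> diagram \<delta>"
    then obtain i j where d: "d = (i, j)" "1 \<le> i" "j \<in> {1..l i}" by (auto simp: diagram_def part)
    then obtain x where "x \<in> E" "r x = i" "c x = j" unfolding row[symmetric] by blast
    then show "d \<in> (\<lambda>x. (r x, c x)) ` E" using d by blast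
  qed
  ultimately show ?thesis by blast
qed

text \<open>Distinct values have disjoint level sets, so the factors of the product merge one by one
  into the sum over a single Young subgroup.\<close>

lemma (in multiplicative_char) sym_prod_list_char_sum:
  assumes fin: "finite E"
  shows "distinct js \<Longrightarrow> sym_prod_list (map (\<lambda>j. char_sum \<chi> {\<sigma>. \<sigma> permutes {x \<in> E. v x = j}}) js) =
    (char_sum \<chi> (stab {x \<in> E. v x \<in> set js} v) :: ('a::field_char_0) perm_comb)"
proof (induction js)
  case Nil
  have "stab {} v = {id}" by (auto simp: stab_def)
  then show ?case using char_id by (simp only: sym_prod_list_def sym_one_def char_sum_def) simp
next
  case (Cons j js)
  have "stab {x \<in> E. v x = j} v = {\<sigma>. \<sigma> permutes {x \<in> E. v x = j}}"
    unfolding stab_const[of _ j, symmetric] by (intro stab_cong) auto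
  moreover have "{x \<in> E. v x \<in> set (j # js)} = {x \<in> E. v x = j} \<union> {x \<in> E. v x \<in> set js}" by auto
  moreover have "char_sum \<chi> (stab {x \<in> E. v x = j} v) \<cdot>\<^sub>S char_sum \<chi> (stab {x \<in> E. v x \<in> set js} v) =
      (char_sum \<chi> (stab ({x \<in> E. v x = j} \<union> {x \<in> E. v x \<in> set js}) v) :: 'a perm_comb)"
    using fin Cons.prems by (intro char_sum_stab_union) auto
  ultimately show ?case using Cons by (simp add: sym_prod_list_def)
qed

text \<open>The bridge from tableaux to fillings: \<open>p\<close> sends an entry to its cell, so
  rows and columns of \<open>T\<close> are the level sets of the two coordinates of
  \<open>p\<close>.\<close>

lemma young_symmetrizer_eq:
  assumes lam: "lam \<turnstile> n" and fin: "finite E" and p: "bij_betw p E (diagram lam)"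
    and T: "\<And>x. x \<in> E \<Longrightarrow> T (p x) = x"
  shows "\<cc> lam T = (row_col_sum E (fst \<circ> p) (snd \<circ> p) :: ('a::field_char_0) perm_comb)"
proof -
  let ?r = "fst \<circ> p" and ?c = "snd \<circ> p"
  have D: "p x \<in> diagram lam" if "x \<in> E" for x using bij_betwE[OF p] that by blast
  have surj: "\<exists>x\<in>E. p x = d" if "d \<in> diagram lam" for d
    using that unfolding bij_betw_imp_surj_on[OF p, symmetric] by blast
  have row: "tab_row lam T i = {x \<in> E. ?r x = i}" for i
  proof (intro equalityI subsetI)
    fix y assume "y \<in> tab_row lam T i"
    then obtain j where "y = T (i, j)" "(i, j) \<in> diagram lam" by (auto simp: tab_row_def)
    then show "y \<in> {x \<in> E. ?r x = i}" using surj T by (metis (mono_tags, lifting) comp_apply fst_conv mem_Collect_eq)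
  next
    fix y assume "y \<in> {x \<in> E. ?r x = i}"
    then have "y = T (i, snd (p y))" "(i, snd (p y)) \<in> diagram lam" using T D by force+
    then show "y \<in> tab_row lam T i" by (auto simp: tab_row_def)
  qed
  have col: "tab_column lam T j = {x \<in> E. ?c x = j}" for j
  proof (intro equalityI subsetI)
    fix y assume "y \<in> tab_column lam T j"
    then obtain i where "y = T (i, j)" "(i, j) \<in> diagram lam" by (auto simp: tab_column_def)
    then show "y \<in> {x \<in> E. ?c x = j}" using surj T by (metis (mono_tags, lifting) comp_apply snd_conv mem_Collect_eq)
  next
    fix y assume "y \<in> {x \<in> E. ?c x = j}"
    then have "y = T (fst (p y), j)" "(fst (p y), j) \<in> diagram lam" using T D by force+
    then show "y \<in> tab_column lam T j" by (auto simp: tab_column_def)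
  qed
  have "?r x \<in> set [1..<length lam + 1]" if "x \<in> E" for x
    using D[OF that] by (auto simp: diagram_def part_def split: if_splits)
  then have rE: "{x \<in> E. ?r x \<in> set [1..<length lam + 1]} = E" by blast
  have "?c x \<in> set [1..<part lam 1 + 1]" if "x \<in> E" for x
    using D[OF that] part_antimono[OF lam, of 1 "fst (p x)"] by (auto simp: diagram_def)
  then have cE: "{x \<in> E. ?c x \<in> set [1..<part lam 1 + 1]} = E" by blast
  have a: "(\<aa> X :: 'a perm_comb) = char_sum (\<lambda>_. 1) {\<sigma>. \<sigma> permutes X}"
    and b: "(\<bb> X :: 'a perm_comb) = char_sum sign {\<sigma>. \<sigma> permutes X}" for X
    by (simp_all add: symmetrizer_def antisymmetrizer_def char_sum_def)
  show ?thesis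
    unfolding young_symmetrizer_def row_col_sum_def a b row col
      trivial_char.sym_prod_list_char_sum[OF fin distinct_upt] sign_char.sym_prod_list_char_sum[OF fin distinct_upt] rE cE ..
qed

lemma tab_column_iff:
  assumes p: "bij_betw p E (diagram lam)" and T: "\<And>x. x \<in> E \<Longrightarrow> T (p x) = x" and "x \<in> tab_column lam T j"
  shows "snd (p x) = j"
proof -
  obtain i where i: "x = T (i, j)" "(i, j) \<in> diagram lam" using assms(3) by (auto simp: tab_column_def)
  then obtain y where "y \<in> E" "p y = (i, j)" using bij_betw_imp_surj_on[OF p] by (metis imageE)
  then show ?thesis using i T by force
qed

section \<open>Membership in the generated ideal\<close>

lemma perm_concat_id:
  assumes "\<sigma> permutes {1..m}"
  shows "perm_concat m \<sigma> id = \<sigma>"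
proof
  fix i show "perm_concat m \<sigma> id i = \<sigma> i"
    using permutes_not_in[OF assms, of i] by (auto simp: perm_concat_def)
qed

text \<open>Concatenation with an identity only adds fixed points. Permutations are total functions,
  so the underlying element is literally the same and only its degree changes.\<close>

lemma single_mult_single_one:
  assumes "f \<in> sym_alg m"
  shows "Poly_Mapping.single m f \<star> Poly_Mapping.single p (Poly_Mapping.single id 1) =
    Poly_Mapping.single (m + p) (f :: ('a::field) perm_comb)"
proof (cases "f = 0")
  case False
  have "bilinear_ext (perm_concat m) f (Poly_Mapping.single id 1) =
      (\<Sum>\<sigma>\<in>Poly_Mapping.keys f. Poly_Mapping.single \<sigma> (Poly_Mapping.lookup f \<sigma>))"
    using assms by (simp add: bilinear_ext_def perm_concat_id sym_alg_def cong: sum.cong)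
  then have "bilinear_ext (perm_concat m) f (Poly_Mapping.single id 1) = f"
    using poly_mapping_eq_sum_single[of f] by simp
  moreover have "Poly_Mapping.single (id :: nat \<Rightarrow> nat) (1 :: 'a) \<noteq> 0" by (metis lookup_single_eq lookup_zero zero_neq_one)
  ultimately show ?thesis using False by (simp add: gta_mult_def)
qed (simp add: gta_mult_def)

lemma sym_alg_scale: "f \<in> sym_alg m \<Longrightarrow> a \<odot> f \<in> sym_alg m"
  unfolding scale_def by (intro sym_alg_mult sym_alg_single permutes_id)

lemma sym_alg_one: "Poly_Mapping.single id 1 \<in> sym_alg m"
  by (intro sym_alg_single permutes_id)

context
  fixes I :: "('a::field) perm_family set"
  assumes I: "invariant_right_ideal I"
begin

lemma invariant_add:
  "Poly_Mapping.single m f \<in> I \<Longrightarrow> Poly_Mapping.single m g \<in> I \<Longrightarrow> Poly_Mapping.single m (f + g) \<in> I"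
  using I by (simp add: invariant_right_ideal_def right_ideal_def single_add)

lemma invariant_zero: "Poly_Mapping.single m 0 \<in> I"
  using I by (simp add: invariant_right_ideal_def right_ideal_def)

lemma invariant_left:
  assumes "Poly_Mapping.single m f \<in> I" "f \<in> sym_alg m" "g \<in> sym_alg m"
  shows "Poly_Mapping.single m (g \<cdot>\<^sub>S f) \<in> I"
proof -
  have "f \<in> degree_part I m" using assms by (simp add: degree_part_def)
  moreover have "sym_left_ideal m (degree_part I m)" using I by (simp add: invariant_right_ideal_def)
  ultimately have "g \<cdot>\<^sub>S f \<in> degree_part I m" using assms(3) by (simp add: sym_left_ideal_def)
  then show ?thesis by (simp add: degree_part_def)
qed

lemma invariant_scale:
  assumes "Poly_Mapping.single m f \<in> I" "f \<in> sym_alg m"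
  shows "Poly_Mapping.single m (a \<odot> f) \<in> I"
  unfolding scale_def by (rule invariant_left[OF assms]) (intro sym_alg_single permutes_id)

lemma invariant_raise:
  assumes "Poly_Mapping.single m f \<in> I" "f \<in> sym_alg m" "m \<le> n"
  shows "Poly_Mapping.single n f \<in> I"
proof -
  have "Poly_Mapping.single (n - m) (Poly_Mapping.single id 1) \<in> (gta :: 'a perm_family set)"
    by (intro gta_single sym_alg_one)
  then have "Poly_Mapping.single m f \<star> Poly_Mapping.single (n - m) (Poly_Mapping.single id 1) \<in> I"
    using I assms(1) by (simp add: invariant_right_ideal_def right_ideal_def)
  then show ?thesis using assms by (simp only: single_mult_single_one[OF assms(2)]) simp
qed

end

text \<open>The elements \<open>y\<close> with \<open>y \<sigma> b \<in> W\<close> for all \<open>\<sigma>\<close>, where \<open>b = col_sum E w\<close>, form a two-sided ideal.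
  It contains all Young symmetrizers by straightening, hence contains \<open>1\<close> by completeness.\<close>

lemma col_sum_in_left_ideal:
  fixes W :: "('a::field_char_0) perm_comb set"
  assumes fin: "finite E" and w: "\<And>x. x \<in> E \<Longrightarrow> 1 \<le> w x" and W: "lin_closed W"
    and left: "\<And>\<sigma> x. \<sigma> permutes E \<Longrightarrow> x \<in> W \<Longrightarrow> Poly_Mapping.single \<sigma> 1 \<cdot>\<^sub>S x \<in> W"
    and gen: "\<And>r c. filling E r c \<Longrightarrow> (\<And>x. x \<in> E \<Longrightarrow> c x \<le> w x) \<Longrightarrow> row_col_sum E r c \<in> W"
  shows "col_sum E w \<in> W"
proof -
  let ?b = "col_sum E w :: 'a perm_comb"
  \<comment> \<open>Quantifying over all \<open>\<sigma>\<close> makes \<open>J\<close> closed under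
    right multiplication as well, although \<open>W\<close> is only a left ideal.\<close>
  define J where "J = {y. \<forall>\<sigma>. \<sigma> permutes E \<longrightarrow> y \<cdot>\<^sub>S (Poly_Mapping.single \<sigma> 1 \<cdot>\<^sub>S ?b) \<in> W}"
  have J: "lin_closed J"
    using W by (auto simp: J_def lin_closed_def sym_mult_add_left scale_mult_left)
  \<comment> \<open>The classes of the identity function are singletons, so this antisymmetrizer is
    the unit of the group algebra.\<close>
  have "col_sum E (\<lambda>x. x) \<in> J"
  proof (rule col_sum_in_ideal[OF fin J])
    show "Poly_Mapping.single \<sigma> 1 \<cdot>\<^sub>S x \<in> J" if "\<sigma> permutes E" "x \<in> J" for \<sigma> x
      using that left by (simp add: J_def sym_mult_assoc)
    show "x \<cdot>\<^sub>S Poly_Mapping.single \<sigma> 1 \<in> J" if s: "\<sigma> permutes E" and x: "x \<in> J" for \<sigma> x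
    proof -
      have "x \<cdot>\<^sub>S (Poly_Mapping.single (\<sigma> \<circ> \<tau>) 1 \<cdot>\<^sub>S ?b) \<in> W" if "\<tau> permutes E" for \<tau>
        using x permutes_compose[OF that s] by (simp add: J_def)
      then show ?thesis by (simp add: J_def sym_mult_assoc) (simp flip: sym_mult_assoc[of "Poly_Mapping.single \<sigma> 1"])
    qed
    fix r c assume f: "filling E r c"
    let ?C = "row_col_sum E r c :: 'a perm_comb"
    have "?C \<cdot>\<^sub>S (Poly_Mapping.single \<sigma> 1 \<cdot>\<^sub>S ?b) \<in> W" if "\<sigma> permutes E" for \<sigma>
    proof (rule straightening[OF f w W _ _ _ that])
      show "?C \<cdot>\<^sub>S Poly_Mapping.single \<tau> 1 = of_int (sign \<tau>) \<odot> ?C" if "\<tau> \<in> stab E c" for \<tau>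
        by (simp only: row_col_sum_def sym_mult_assoc sign_char.char_sum_mult_single[OF fin that] scale_mult_right)
      show "?C \<cdot>\<^sub>S (Poly_Mapping.single \<sigma> 1 \<cdot>\<^sub>S (col_sum (X \<union> Y) (\<lambda>_. 0) \<cdot>\<^sub>S ?b)) \<in> W"
        if "\<sigma> permutes E" "1 \<le> j" "X \<subseteq> {x \<in> E. c (\<sigma> x) = j}" "Y \<subseteq> {x \<in> E. c (\<sigma> x) = Suc j}"
          "card {x \<in> E. c (\<sigma> x) = j} < card X + card Y" for \<sigma> X Y j
        using row_col_sum_conj_garnir[OF f that, where 'a = 'a] lin_closed_zero[OF W] by simp
      fix \<sigma> assume s: "\<sigma> permutes E" and le: "\<And>x. x \<in> E \<Longrightarrow> c (\<sigma> x) \<le> w x"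
      have "?C \<cdot>\<^sub>S Poly_Mapping.single (\<sigma> \<circ> \<tau>) (of_int (sign \<tau>)) \<in> W" if t: "\<tau> \<in> stab E w" for \<tau>
      proof -
        have tp: "\<tau> permutes E" using t by (rule stab_permutes)
        have p: "\<sigma> \<circ> \<tau> permutes E" using tp s by (rule permutes_compose)
        \<comment> \<open>As \<open>\<tau>\<close> preserves \<open>w\<close>, the column bound
          passes from \<open>\<sigma>\<close> to \<open>\<sigma> \<circ> \<tau>\<close>, and the
          relabelled filling is one of the generators.\<close>
        have "row_col_sum E (r \<circ> (\<sigma> \<circ> \<tau>)) (c \<circ> (\<sigma> \<circ> \<tau>)) \<in> W"
        proof (rule gen[OF filling_compose[OF f p]])
          fix x assume "x \<in> E"
          then show "(c \<circ> (\<sigma> \<circ> \<tau>)) x \<le> w x"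
            using le[of "\<tau> x"] stab_eq'[OF t, of x] by (simp add: permutes_in_image[OF tp])
        qed
        then have "?C \<cdot>\<^sub>S Poly_Mapping.single (\<sigma> \<circ> \<tau>) 1 \<in> W"
          unfolding row_col_sum_conj[OF fin p] by (rule left[OF p])
        then have "of_int (sign \<tau>) \<odot> (?C \<cdot>\<^sub>S Poly_Mapping.single (\<sigma> \<circ> \<tau>) 1) \<in> W" by (rule lin_closed_scale[OF W])
        then show ?thesis by (simp flip: scale_mult_right)
      qed
      then have "(\<Sum>\<tau>\<in>stab E w. ?C \<cdot>\<^sub>S Poly_Mapping.single (\<sigma> \<circ> \<tau>) (of_int (sign \<tau>))) \<in> W"
        by (rule lin_closed_sum[OF W])
      then show "?C \<cdot>\<^sub>S (Poly_Mapping.single \<sigma> 1 \<cdot>\<^sub>S ?b) \<in> W"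
        by (simp add: char_sum_def[of sign "stab E w"] sym_mult_sum_right)
    qed
    then show "?C \<in> J" by (simp add: J_def)
  qed
  moreover have "stab E (\<lambda>x. x) = {id}"
    by (auto simp: stab_def fun_eq_iff permutes_id) (metis permutes_not_in)
  ultimately have "Poly_Mapping.single id 1 \<in> J" by (simp only: char_sum_def) simp
  then have "Poly_Mapping.single id 1 \<cdot>\<^sub>S (Poly_Mapping.single id 1 \<cdot>\<^sub>S ?b) \<in> W"
    unfolding J_def using permutes_id[of E] by blast
  then show ?thesis by (simp only: sym_mult_id)
qed

text \<open>The vanishing result concerns the factor \<open>b a\<close>, whereas the symmetrizer is
  \<open>D = a b\<close>. Quasi-idempotence replaces \<open>D\<close> by a multiple of
  \<open>D D = a (b a) b\<close>, which contains that factor.\<close>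

lemma row_col_sum_mult_outside:
  assumes f: "filling {1..n} r c" and f': "filling F r' c'" and FE: "F \<subseteq> {1..n}"
    and x0: "x0 \<in> F" "\<And>y. y \<in> {1..n} \<Longrightarrow> \<not> (r y = r' x0 \<and> c y = c' x0)" and x: "x \<in> sym_alg n"
  shows "row_col_sum {1..n} r c \<cdot>\<^sub>S (x \<cdot>\<^sub>S row_col_sum F r' c') = (0 :: ('a::field_char_0) perm_comb)"
proof -
  let ?C = "row_col_sum {1..n} r c :: 'a perm_comb" and ?D = "row_col_sum F r' c' :: 'a perm_comb"
  let ?a = "row_sum F r' :: 'a perm_comb" and ?b = "col_sum F c' :: 'a perm_comb"
  have zero: "?C \<cdot>\<^sub>S (y \<cdot>\<^sub>S (?b \<cdot>\<^sub>S ?a)) = 0" if "y \<in> sym_alg n" for y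
  proof (induction y rule: perm_comb_induct)
    case (single \<sigma> d)
    then have "\<sigma> permutes {1..n}" using that by (simp add: sym_alg_def)
    note row_col_sum_annihilates[OF f f' FE x0 this, where 'a = 'a]
    then show ?case
      by (subst single_eq_scale) (simp add: scale_mult_left scale_mult_right del: scale_single)
  qed (simp_all add: sym_mult_add_left sym_mult_add_right)
  obtain N where N: "N \<noteq> 0" "?D \<cdot>\<^sub>S ?D = N \<odot> ?D" using row_col_sum_square[OF f', where 'a = 'a] by blast
  have "?C \<cdot>\<^sub>S (x \<cdot>\<^sub>S (?D \<cdot>\<^sub>S ?D)) = (?C \<cdot>\<^sub>S ((x \<cdot>\<^sub>S ?a) \<cdot>\<^sub>S (?b \<cdot>\<^sub>S ?a))) \<cdot>\<^sub>S ?b"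
    by (simp add: row_col_sum_def sym_mult_assoc)
  also have "\<dots> = 0"
    using FE x by (subst zero) (auto intro!: sym_alg_mult char_sum_stab_in_sym_alg)
  finally have "N \<odot> (?C \<cdot>\<^sub>S (x \<cdot>\<^sub>S ?D)) = 0" by (simp add: N scale_mult_right)
  then show ?thesis using N(1) by (simp add: scale_eq_iff)
qed

theorem theorem1p5:
  fixes k n :: nat and lam \<mu> :: "nat list" and T S :: tableau
  assumes "1 \<le> k" and "k \<le> n"
    and "lam \<turnstile> n" and "\<mu> \<turnstile> k" and "shape_contained \<mu> lam"
    and "young_tableau lam {1..n} T"
    and "S = subtableau \<mu> T"
    and "young_tableau \<mu> {1..k} S"
  shows "Poly_Mapping.single n (\<cc> lam T :: ('a::field_char_0) perm_comb)
    \<in> \<I> {Poly_Mapping.single k (\<cc> \<delta> S') |\<delta> S'.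
          \<delta> \<turnstile> k \<and> shape_contained \<delta> lam \<and> young_tableau \<delta> {1..k} S' \<and> dominates k \<delta> S' \<mu> S}"
proof -
  let ?A = "{Poly_Mapping.single k (\<cc> \<delta> S') |\<delta> S'. \<delta> \<turnstile> k \<and> shape_contained \<delta> lam \<and>
      young_tableau \<delta> {1..k} S' \<and> dominates k \<delta> S' \<mu> S} :: 'a perm_family set"
  let ?E = "{1..n}" and ?F = "{1..k}"
  have FE: "?F \<subseteq> ?E" using assms(2) by auto
  define J where "J = \<I> ?A"
  have "?A \<subseteq> gta" by (auto intro!: gta_single young_symmetrizer_in)
  then have inv: "invariant_right_ideal J" unfolding J_def by (rule invariant_right_ideal_generated)
  have bij: "bij_betw T (diagram lam) ?E" using assms(6) by (simp add: young_tableau_def)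
  define p where "p = inv_into (diagram lam) T"
  have p: "bij_betw p ?E (diagram lam)" unfolding p_def using bij by (rule bij_betw_inv_into)
  have Tp: "T (p x) = x" if "x \<in> ?E" for x
    unfolding p_def using bij_betw_inv_into_right[OF bij that] .
  define r c where "r = fst \<circ> p" and "c = snd \<circ> p"
  have f: "filling ?E r c" unfolding r_def c_def by (rule filling_of_diagram[OF assms(3) _ p]) simp
  let ?C = "row_col_sum ?E r c :: 'a perm_comb"
  have CT: "\<cc> lam T = ?C" unfolding r_def c_def by (rule young_symmetrizer_eq[OF assms(3) _ p Tp]) simp
  have C: "?C \<in> sym_alg n"
    unfolding row_col_sum_def by (intro sym_alg_mult char_sum_stab_in_sym_alg) auto
  have sub: "sym_alg k \<subseteq> (sym_alg n :: 'a perm_comb set)" using sym_alg_mono[OF assms(2)] by blast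
  \<comment> \<open>The columns of \<open>S\<close> are parts of those of \<open>T\<close>, so a
    column bound by \<open>c\<close> on \<open>[k]\<close> is domination of
    \<open>S\<close>.\<close>
  have colS: "c x = j" if x: "x \<in> tab_column \<mu> S j" for x j
  proof -
    obtain i where i: "x = S (i, j)" "(i, j) \<in> diagram \<mu>" using x by (auto simp: tab_column_def)
    then have "x = T (i, j)" by (simp add: assms(7) subtableau_def)
    moreover have "(i, j) \<in> diagram lam"
      using i(2) assms(5) by (force simp: diagram_def shape_contained_def)
    ultimately have "x \<in> tab_column lam T j" by (auto simp: tab_column_def)
    then show ?thesis using tab_column_iff[OF p Tp] by (simp add: c_def)
  qed
  \<comment> \<open>The quantifier over \<open>x\<close> makes \<open>W\<close> a left ideal of
    \<open>K[S_k]\<close>; the fixed factor \<open>?C\<close> removes the shapes outside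
    \<open>lam\<close>.\<close>
  define W where "W = {y \<in> sym_alg k. \<forall>x\<in>sym_alg n. Poly_Mapping.single n (?C \<cdot>\<^sub>S (x \<cdot>\<^sub>S y)) \<in> J}"
  have inW: "?C \<cdot>\<^sub>S (x \<cdot>\<^sub>S y) \<in> sym_alg n" if "x \<in> sym_alg n" "y \<in> sym_alg k" for x y
    using that C sub by (blast intro: sym_alg_mult)
  have "lin_closed W"
    unfolding lin_closed_def W_def
    using inW invariant_zero[OF inv, of n]
    by (auto simp: sym_alg_zero sym_alg_add sym_alg_scale sym_mult_add_right scale_mult_right intro: invariant_add[OF inv] invariant_scale[OF inv])
  have "col_sum ?F c \<in> W"
  proof (rule col_sum_in_left_ideal[OF _ _ \<open>lin_closed W\<close>])
    show "1 \<le> c x" if "x \<in> ?F" for x using filling_pos[OF f] that FE by blast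
    show "Poly_Mapping.single \<sigma> 1 \<cdot>\<^sub>S y \<in> W" if p: "\<sigma> permutes ?F" and y: "y \<in> W" for \<sigma> y
    proof -
      have s: "Poly_Mapping.single \<sigma> (1 :: 'a) \<in> sym_alg k" using p by (rule sym_alg_single)
      have "Poly_Mapping.single n (?C \<cdot>\<^sub>S (x \<cdot>\<^sub>S (Poly_Mapping.single \<sigma> 1 \<cdot>\<^sub>S y))) \<in> J" if "x \<in> sym_alg n" for x
      proof -
        have "x \<cdot>\<^sub>S Poly_Mapping.single \<sigma> 1 \<in> sym_alg n" using that s sub by (blast intro: sym_alg_mult)
        then have "Poly_Mapping.single n (?C \<cdot>\<^sub>S ((x \<cdot>\<^sub>S Poly_Mapping.single \<sigma> 1) \<cdot>\<^sub>S y)) \<in> J"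
          using y by (simp add: W_def)
        then show ?thesis by (simp only: sym_mult_assoc)
      qed
      then show ?thesis using y s by (simp add: W_def sym_alg_mult)
    qed
    fix r' c' assume f': "filling ?F r' c'" and le: "\<And>x. x \<in> ?F \<Longrightarrow> c' x \<le> c x"
    let ?D = "row_col_sum ?F r' c' :: 'a perm_comb"
    have D: "?D \<in> sym_alg k"
      unfolding row_col_sum_def by (intro sym_alg_mult char_sum_stab_in_sym_alg) auto
    obtain \<delta> where \<delta>: "\<delta> \<turnstile> k" and q: "bij_betw (\<lambda>x. (r' x, c' x)) ?F (diagram \<delta>)"
      using filling_partition[OF f'] by auto
    have "Poly_Mapping.single n (?C \<cdot>\<^sub>S (x \<cdot>\<^sub>S ?D)) \<in> J" if x: "x \<in> sym_alg n" for x
    proof (cases "shape_contained \<delta> lam")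
      case True
      define S' where "S' = inv_into ?F (\<lambda>x. (r' x, c' x))"
      have S'q: "S' (r' x, c' x) = x" if "x \<in> ?F" for x
        unfolding S'_def using bij_betw_inv_into_left[OF q that] .
      have yt: "young_tableau \<delta> ?F S'"
        unfolding young_tableau_def S'_def using q by (rule bij_betw_inv_into)
      have cD: "\<cc> \<delta> S' = ?D"
        using young_symmetrizer_eq[OF \<delta> _ q, of S', where 'a = 'a] S'q by (simp add: comp_def)
      have "dominates k \<delta> S' \<mu> S"
        unfolding dominates_def
      proof (intro ballI allI impI)
        fix i j j' assume i: "i \<in> ?F" "i \<in> tab_column \<mu> S j" "i \<in> tab_column \<delta> S' j'"
        have "c' i = j'" using tab_column_iff[OF q S'q i(3)] by simp
        then show "j' \<le> j" using le[OF i(1)] colS[OF i(2)] by simp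
      qed
      then have "Poly_Mapping.single k ?D \<in> ?A" using \<delta> True yt cD by force
      then have "Poly_Mapping.single k ?D \<in> J" unfolding J_def using generated_ideal_least(1)[of ?A] by blast
      then have "Poly_Mapping.single n ?D \<in> J" by (rule invariant_raise[OF inv _ D assms(2)])
      then have "Poly_Mapping.single n ((?C \<cdot>\<^sub>S x) \<cdot>\<^sub>S ?D) \<in> J"
        using D sub by (intro invariant_left[OF inv] sym_alg_mult C x) auto
      then show ?thesis by (simp only: sym_mult_assoc)
    next
      case False
      \<comment> \<open>The last cell of a row in which \<open>\<delta>\<close> exceeds
        \<open>lam\<close> is missing from the diagram of \<open>lam\<close>; its entry serves as
        \<open>x0\<close>.\<close>
      then obtain i where i: "1 \<le> i" "part lam i < part \<delta> i" by (auto simp: shape_contained_def not_le)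
      then have "(i, part \<delta> i) \<in> diagram \<delta>" by (auto simp: diagram_def)
      then have "(i, part \<delta> i) \<in> (\<lambda>x. (r' x, c' x)) ` ?F" using bij_betw_imp_surj_on[OF q] by simp
      then obtain x0 where x0: "x0 \<in> ?F" "r' x0 = i" "c' x0 = part \<delta> i" by (auto simp del: atLeastAtMost_iff)
      have "\<not> (r y = r' x0 \<and> c y = c' x0)" if "y \<in> ?E" for y
      proof
        assume y: "r y = r' x0 \<and> c y = c' x0"
        have "(r y, c y) \<in> diagram lam" using bij_betwE[OF p] that by (simp add: r_def c_def)
        then show False using x0 y i by (auto simp: diagram_def)
      qed
      then have "?C \<cdot>\<^sub>S (x \<cdot>\<^sub>S ?D) = 0" using x by (intro row_col_sum_mult_outside[OF f f' FE x0(1)])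
      then show ?thesis using invariant_zero[OF inv] by simp
    qed
    then show "?D \<in> W" using D by (simp add: W_def)
  qed simp
  then have "Poly_Mapping.single n (?C \<cdot>\<^sub>S (Poly_Mapping.single id 1 \<cdot>\<^sub>S col_sum ?F c)) \<in> J"
    using sym_alg_one by (auto simp: W_def simp del: sym_mult_id)
  moreover have "?C \<cdot>\<^sub>S (Poly_Mapping.single id 1 \<cdot>\<^sub>S col_sum ?F c) = of_nat (card (stab ?F c)) \<odot> ?C"
  proof -
    have "stab ?F c \<subseteq> stab ?E c" using FE by (rule stab_mono)
    note sign_char.char_sum_mult_subgroup[OF finite_atLeastAtMost this, where 'a = 'a]
    then show ?thesis by (simp only: sym_mult_id row_col_sum_def sym_mult_assoc scale_mult_right)
  qed
  ultimately have "Poly_Mapping.single n (of_nat (card (stab ?F c)) \<odot> ?C) \<in> J" by (simp only:)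
  then have "Poly_Mapping.single n (inverse (of_nat (card (stab ?F c))) \<odot> (of_nat (card (stab ?F c)) \<odot> ?C)) \<in> J"
    by (rule invariant_scale[OF inv]) (intro sym_alg_scale C)
  then show ?thesis using card_stab_nonzero[of ?F c, where 'a = 'a] by (simp add: CT J_def)
qed

end
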